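(* Let $\mathbb K$ be an algebraically closed field (of arbitrary characteristic), let $\mathbb V$ be a vector space over $\mathbb K$ with $\dim\mathbb V\ge2$, and let $\mathfrak g=\mathfrak{gl}(\mathbb V)$. Then for any nilpotent element $e\in\mathfrak g$, the set $(\mathfrak g_e^* )_{\rm sing}$ has codimension $\ge 2$ in $\mathfrak g_e^*$.
   Context: $\mathfrak g_e$ is the centraliser of $e$ in $\mathfrak g$. For a finite-dimensional Lie algebra $\mathfrak q$ and $\gamma\in\mathfrak q^*$, $\mathfrak q^\gamma=\{x\in\mathfrak q:\gamma([x,\mathfrak q])=0\}$, ${\rm ind}\,\mathfrak q=\min_\gamma\dim\mathfrak q^\gamma$, and $(\mathfrak q^* )_{\rm sing}=\{\gamma\in\mathfrak q^*:\dim\mathfrak q^\gamma>{\rm ind}\,\mathfrak q\}$. *)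

theory Defs
  imports "HOL-Analysis.Analysis" "HOL-Computational_Algebra.Polynomial"
begin

text \<open>We model \<open>V = K^n\<close> (index type 'n, \<open>dim V = CARD('n)\<close>) and
  \<open>gl(V)\<close> as the square matrices \<open>'k^'n^'n\<close> with bracket \<open>[x,y] = x y - y x\<close>.\<close>

definition mscale :: "'k::field \<Rightarrow> 'k^'n^'n \<Rightarrow> 'k^'n^'n" where
  "mscale c A = (\<chi> i j. c * A $ i $ j)"

definition mdim :: "('k::field^'n^'n) set \<Rightarrow> nat" where
  "mdim S = vector_space.dim mscale S"

definition matpow :: "'k::field^'n^'n \<Rightarrow> nat \<Rightarrow> 'k^'n^'n" where
  "matpow A m = ((\<lambda>B. A ** B) ^^ m) (mat 1)"

definition nilpotent_mat :: "'k::field^'n^'n \<Rightarrow> bool" where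
  "nilpotent_mat e \<longleftrightarrow> (\<exists>m. matpow e m = 0)"

definition lie_bracket :: "'k::field^'n^'n \<Rightarrow> 'k^'n^'n \<Rightarrow> 'k^'n^'n" where
  "lie_bracket x y = x ** y - y ** x"

definition centraliser :: "'k::field^'n^'n \<Rightarrow> ('k^'n^'n) set" where
  "centraliser e = {x. lie_bracket x e = 0}"

text \<open>The dual space \<open>q^*\<close> of a subspace \<open>q\<close> of matrices: linear functionals
  on \<open>q\<close>, canonically extended by 0 outside \<open>q\<close> (so that they are unique HOL functions).\<close>
definition dual_space :: "('k::field^'n^'n) set \<Rightarrow> ('k^'n^'n \<Rightarrow> 'k) set" where
  "dual_space q = {\<gamma>. (\<forall>x\<in>q. \<forall>y\<in>q. \<gamma> (x + y) = \<gamma> x + \<gamma> y)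
                     \<and> (\<forall>c. \<forall>x\<in>q. \<gamma> (mscale c x) = c * \<gamma> x)
                     \<and> (\<forall>x. x \<notin> q \<longrightarrow> \<gamma> x = 0)}"

definition stabiliser :: "('k::field^'n^'n) set \<Rightarrow> ('k^'n^'n \<Rightarrow> 'k) \<Rightarrow> ('k^'n^'n) set" where
  "stabiliser q \<gamma> = {x \<in> q. \<forall>y\<in>q. \<gamma> (lie_bracket x y) = 0}"

definition lie_index :: "('k::field^'n^'n) set \<Rightarrow> nat" where
  "lie_index q = Min ((\<lambda>\<gamma>. mdim (stabiliser q \<gamma>)) ` dual_space q)"

definition sing_set :: "('k::field^'n^'n) set \<Rightarrow> ('k^'n^'n \<Rightarrow> 'k) set" where
  "sing_set q = {\<gamma> \<in> dual_space q. mdim (stabiliser q \<gamma>) > lie_index q}"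

text \<open>Polynomial functions on \<open>q^*\<close>: the algebra generated by constants and the
  linear coordinate functions \<open>\<gamma> \<mapsto> \<gamma> x\<close>, \<open>x \<in> q\<close> (these span \<open>(q^*)^* = q\<close>).\<close>
inductive_set poly_fun :: "('k::field^'n^'n) set \<Rightarrow> (('k^'n^'n \<Rightarrow> 'k) \<Rightarrow> 'k) set"
  for q where
  const: "(\<lambda>\<gamma>. c) \<in> poly_fun q"
| coord: "x \<in> q \<Longrightarrow> (\<lambda>\<gamma>. \<gamma> x) \<in> poly_fun q"
| add: "f \<in> poly_fun q \<Longrightarrow> g \<in> poly_fun q \<Longrightarrow> (\<lambda>\<gamma>. f \<gamma> + g \<gamma>) \<in> poly_fun q"
| mult: "f \<in> poly_fun q \<Longrightarrow> g \<in> poly_fun q \<Longrightarrow> (\<lambda>\<gamma>. f \<gamma> * g \<gamma>) \<in> poly_fun q"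

definition zariski_closed :: "('k::field^'n^'n) set \<Rightarrow> ('k^'n^'n \<Rightarrow> 'k) set \<Rightarrow> bool" where
  "zariski_closed q Z \<longleftrightarrow>
     (\<exists>F \<subseteq> poly_fun q. Z = {\<gamma> \<in> dual_space q. \<forall>f\<in>F. f \<gamma> = 0})"

definition zariski_irreducible :: "('k::field^'n^'n) set \<Rightarrow> ('k^'n^'n \<Rightarrow> 'k) set \<Rightarrow> bool" where
  "zariski_irreducible q Z \<longleftrightarrow> Z \<noteq> {} \<and> zariski_closed q Z \<and>
     (\<forall>Z1 Z2. zariski_closed q Z1 \<longrightarrow> zariski_closed q Z2 \<longrightarrow> Z = Z1 \<union> Z2 \<longrightarrow> Z = Z1 \<or> Z = Z2)"

definition krull_dim :: "('k::field^'n^'n) set \<Rightarrow> ('k^'n^'n \<Rightarrow> 'k) set \<Rightarrow> enat" where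
  "krull_dim q S = Sup {enat k | k. \<exists>Zs :: nat \<Rightarrow> ('k^'n^'n \<Rightarrow> 'k) set.
      (\<forall>i\<le>k. zariski_irreducible q (Zs i)) \<and> (\<forall>i<k. Zs i \<subset> Zs (Suc i)) \<and> Zs k \<subseteq> S}"

text \<open>Codimension of \<open>S\<close> in \<open>q^*\<close> (\<open>\<infinity>\<close> for the empty set); \<open>dim q^* = dim q\<close>.\<close>
definition codim_in_dual :: "('k::field^'n^'n) set \<Rightarrow> ('k^'n^'n \<Rightarrow> 'k) set \<Rightarrow> enat" where
  "codim_in_dual q S = (if S = {} then \<infinity> else enat (mdim q) - krull_dim q S)"

end

theory Submission
  imports Defs "HOL-Library.Function_Algebras" "Jordan_Normal_Form.Determinant"
begin

text \<open>Geometrically, the singular set is a cone that meets the plane at most in 0: where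
  \<open>y1\<close> or \<open>y2\<close> is nonzero, a minor of size \<open>N - n\<close> does not
  vanish, so the stabiliser has dimension at most \<open>n\<close>. A closed cone that meets a plane
  only in the origin has codimension at least 2. The bookkeeping of degrees replaces this projective
  argument: the minors are homogeneous, so the cofactors of the linear forms have degree below
  \<open>N - n\<close>, and repeated reduction leaves bounded exponents for \<open>y1\<close> and
  \<open>y2\<close> and free exponents only for the \<open>N - 2\<close> forms. Dimension is defined
  by chains of irreducible sets, so it is bounded by counting: the monomials with exponents at most
  \<open>m\<close> in \<open>c\<close> algebraically independent functions number about
  \<open>m ^ c\<close>, too many for a space of size \<open>O(m ^ (N - 2))\<close> when
  \<open>c > N - 2\<close>. The bound on the stabilisers is a limit \<open>t = 0\<close> over a
  field without topology: all \<open>t\<close> outside a finite set behave alike, and an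
  algebraically closed field is infinite.\<close>

text \<open>Write \<open>q\<close> for the centraliser of \<open>e\<close>, \<open>n\<close> for the size of the matrices and \<open>N = dim q\<close>.

  Every stabiliser \<open>q\<^sup>\<gamma>\<close> has dimension at least \<open>n\<close>: if \<open>\<gamma>\<close> is represented by the trace form of \<open>A\<close>,
  then \<open>q\<^sup>\<gamma>\<close> contains every \<open>x\<close> for which some \<open>x + t z\<close> commutes with \<open>e + t A\<close> modulo \<open>t\<^sup>2\<close>, and the
  centraliser of \<open>e + t A\<close> has dimension at least \<open>n\<close> for all \<open>t\<close>. So a singular \<open>\<gamma>\<close> kills all minors
  of size \<open>N - n\<close> of the form \<open>(x, y) \<mapsto> \<gamma> [x, y]\<close>.

  A Jordan basis of \<open>e\<close> gives a basis of \<open>q\<close> and two functionals: the sums of the dual vectors of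
  the maps from the generator of string \<open>i\<close> to the end of string \<open>i + 1\<close>, respectively \<open>i - 1\<close>. On
  the plane that they span, with coordinates \<open>y1, y2\<close>, two of these minors are triangular and equal
  \<open>\<plusminus> y1 ^ (N - n)\<close> and \<open>\<plusminus> y2 ^ (N - n)\<close>. Hence modulo functions vanishing on the singular set both
  powers lie in the ideal of the \<open>N - 2\<close> linear forms that vanish on the plane, in a way that respects
  degrees, and polynomial functions of degree at most \<open>m\<close> span a space of dimension \<open>O(m ^ (N - 2))\<close>.
  On the other hand, a chain of irreducible closed sets of length \<open>c\<close> yields \<open>c\<close> algebraically
  independent functions, so \<open>c \<le> N - 2\<close>.\<close>

no_notation vec_index (infixl "$" 100)

subsection \<open>Determinants indexed by natural numbers\<close>

text \<open>The permutation sum is kept visible because \<open>minor_reduction\<close> lifts it to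
  functions: each product of entries becomes a product of linear forms whose degree is tracked,
  while the values at a functional are determinants.\<close>

definition leibniz_det :: "nat \<Rightarrow> (nat \<Rightarrow> nat \<Rightarrow> 'k::field) \<Rightarrow> 'k" where
  "leibniz_det r A = (\<Sum>p | p permutes {0..<r}. signof p * (\<Prod>i<r. A i (p i)))"

lemma leibniz_det_eq: "leibniz_det r A = Determinant.det (Matrix.mat r r (\<lambda>(i, j). A i j))"
proof -
  have "(\<Prod>i<r. A i (p i)) = (\<Prod>i = 0..<r. Matrix.mat r r (\<lambda>(i, j). A i j) $$ (i, p i))"
    if "p permutes {0..<r}" for p
    using permutes_in_image[OF that] by (intro prod.cong) (auto simp: atLeast0LessThan)
  then show ?thesis
    unfolding leibniz_det_def by (subst Determinant.det_def'[of _ r]) (auto intro!: sum.cong)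
qed

lemma leibniz_det_eq_0:
  assumes "\<And>t. t < r \<Longrightarrow> (\<Sum>s<r. c s * A s t) = 0" "s < r" "c s \<noteq> 0"
  shows "leibniz_det r A = 0"
proof -
  let ?B = "Matrix.mat r r (\<lambda>(i, j). A j i)"
  let ?v = "Matrix.vec r c"
  have "?v \<noteq> 0\<^sub>v r"
  proof
    assume "?v = 0\<^sub>v r"
    then have "vec_index ?v s = vec_index (0\<^sub>v r) s" by (rule arg_cong)
    then show False using assms(2,3) by simp
  qed
  moreover have "?B *\<^sub>v ?v = 0\<^sub>v r"
    by (rule eq_vecI) (use assms(1) in \<open>auto simp: scalar_prod_def atLeast0LessThan mult.commute\<close>)
  ultimately have "Determinant.det ?B = 0"
    using Determinant.det_0_iff_vec_prod_zero_field[of ?B r] by (auto intro!: exI[of _ ?v])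
  also have "?B = transpose_mat (Matrix.mat r r (\<lambda>(i, j). A i j))" by (rule eq_matI) auto
  finally show ?thesis by (simp add: leibniz_det_eq Determinant.det_transpose[of _ r])
qed

lemma leibniz_det_triangular:
  assumes "\<And>s t. t < s \<Longrightarrow> s < r \<Longrightarrow> A s t = 0"
  shows "leibniz_det r A = (\<Prod>s<r. A s s)"
proof -
  have "upper_triangular (Matrix.mat r r (\<lambda>(i, j). A i j))"
    using assms by (auto simp: upper_triangular_def)
  then show ?thesis
    unfolding leibniz_det_eq
    by (subst Determinant.det_upper_triangular[of _ r]) (auto simp: prod_list_diag_prod atLeast0LessThan)
qed

hide_const (open) Module.smult Matrix.mat Matrix.vec Matrix.row Matrix.col Determinant.det

subsection \<open>Linear algebra\<close>

text \<open>Independence of an indexed family rather than of a set: a repeated vector makes it fail,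
  so injectivity and the count of basis vectors follow from it.\<close>

definition indep_family :: "('k::zero \<Rightarrow> 'b \<Rightarrow> 'b::comm_monoid_add) \<Rightarrow> 'i set \<Rightarrow> ('i \<Rightarrow> 'b) \<Rightarrow> bool" where
  "indep_family sc I G \<longleftrightarrow> (\<forall>c. (\<Sum>i\<in>I. sc (c i) (G i)) = 0 \<longrightarrow> (\<forall>i\<in>I. c i = 0))"

context vector_space
begin

lemma indep_familyD: "indep_family scale I G \<Longrightarrow> (\<Sum>i\<in>I. scale (c i) (G i)) = 0 \<Longrightarrow> i \<in> I \<Longrightarrow> c i = 0"
  unfolding indep_family_def by blast

lemma indep_family_inj_on:
  assumes "finite I" "indep_family scale I G"
  shows "inj_on G I"
proof (rule inj_onI, rule ccontr)
  fix a b assume ab: "a \<in> I" "b \<in> I" "G a = G b" "a \<noteq> b"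
  define c where "c x = (if x = a then 1 else 0) - (if x = b then 1 else 0 :: 'a)" for x
  have "(\<Sum>x\<in>I. scale (c x) (G x)) = (\<Sum>x\<in>I. (if x = a then G x else 0) - (if x = b then G x else 0))"
    by (intro sum.cong) (auto simp: c_def)
  also have "\<dots> = G a - G b" using ab(1,2) assms(1) by (simp add: sum_subtractf)
  finally have "c a = 0" using ab(1,3) by (intro indep_familyD[OF assms(2)]) simp_all
  then show False using ab(4) by (simp add: c_def)
qed

lemma indep_family_independent:
  assumes "finite I" "indep_family scale I G"
  shows "independent (G ` I)"
proof (rule independent_if_scalars_zero)
  fix c x assume c: "(\<Sum>x\<in>G ` I. scale (c x) x) = 0" and x: "x \<in> G ` I"
  have "(\<Sum>i\<in>I. scale (c (G i)) (G i)) = 0"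
    using c by (simp add: sum.reindex[OF indep_family_inj_on[OF assms]])
  then have "c (G i) = 0" if "i \<in> I" for i
    using indep_familyD[OF assms(2), of "\<lambda>i. c (G i)"] that by simp
  then show "c x = 0" using x by auto
qed (use assms in simp)

lemma indep_family_subset:
  assumes "finite I" "indep_family scale I G" "J \<subseteq> I"
  shows "indep_family scale J G"
  unfolding indep_family_def
proof (intro allI impI ballI)
  fix c i assume c: "(\<Sum>i\<in>J. scale (c i) (G i)) = 0" and i: "i \<in> J"
  have "(\<Sum>i\<in>I. scale (if i \<in> J then c i else 0) (G i)) = (\<Sum>i\<in>J. scale (if i \<in> J then c i else 0) (G i))"
    using assms by (intro sum.mono_neutral_right) auto
  also have "\<dots> = 0" using c by simp
  finally have "(if i \<in> J then c i else 0) = 0"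
    using indep_familyD[OF assms(2), of "\<lambda>i. if i \<in> J then c i else 0" i] i assms(3) by blast
  then show "c i = 0" using i by simp
qed

lemma indep_family_reindex:
  assumes "bij_betw h J I" "indep_family scale I G"
  shows "indep_family scale J (\<lambda>j. G (h j))"
  unfolding indep_family_def
proof (intro allI impI ballI)
  fix c j assume c: "(\<Sum>j\<in>J. scale (c j) (G (h j))) = 0" and j: "j \<in> J"
  have inv: "inv_into J h (h j) = j" if "j \<in> J" for j
    using that assms(1) by (simp add: bij_betw_def inv_into_f_f)
  have "(\<Sum>i\<in>I. scale (c (inv_into J h i)) (G i)) = (\<Sum>j\<in>J. scale (c (inv_into J h (h j))) (G (h j)))"
    by (rule sum.reindex_bij_betw[OF assms(1), symmetric])
  also have "\<dots> = 0" using c inv by simp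
  finally have "c (inv_into J h (h j)) = 0"
    using j assms(1) by (intro indep_familyD[OF assms(2), where c = "\<lambda>i. c (inv_into J h i)"]) (auto simp: bij_betw_def)
  then show "c j = 0" using inv[OF j] by simp
qed

end

context finite_dimensional_vector_space
begin

text \<open>The linear map that fixes \<open>A\<close> and kills \<open>B\<close> sends
  \<open>x\<close> both to \<open>x\<close> and to 0.\<close>

lemma span_Int_eq_zero:
  assumes "independent (A \<union> B)" "A \<inter> B = {}" "x \<in> span A" "x \<in> span B"
  shows "x = 0"
proof -
  interpret P: vector_space_pair scale scale ..
  obtain p where p: "Vector_Spaces.linear scale scale p" "\<forall>x\<in>A \<union> B. p x = (if x \<in> A then x else 0)"
    using P.linear_independent_extend[OF assms(1), of "\<lambda>x. if x \<in> A then x else 0"] by blast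
  have "p x = id x"
    by (rule P.linear_eq_on[OF p(1) linear_id assms(3)]) (use p(2) in simp)
  moreover have "p x = (\<lambda>_. 0) x"
    by (rule P.linear_eq_on[OF p(1) P.linear_zero assms(4)])
      (use p(2) assms(2) in auto)
  ultimately show ?thesis by simp
qed

text \<open>If \<open>B\<close> is a basis of the kernel in \<open>U\<close> and \<open>C\<close> a
  basis of \<open>U\<close> containing it, then \<open>f\<close> is injective on the span of
  \<open>C - B\<close>.\<close>

lemma dim_le_dim_kernel_add_dim_image:
  assumes f: "Vector_Spaces.linear scale scale f" and U: "subspace U"
  shows "dim U \<le> dim {x \<in> U. f x = 0} + dim (f ` U)"
proof -
  interpret P: finite_dimensional_vector_space_pair scale Basis scale Basis ..
  interpret f: Vector_Spaces.linear scale scale f by fact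
  let ?K = "{x \<in> U. f x = 0}"
  have K: "subspace ?K"
    using U by (auto simp: subspace_def f.add f.scale)
  obtain B where B: "B \<subseteq> ?K" "independent B" "?K \<subseteq> span B" "card B = dim ?K"
    using basis_exists by blast
  have spanB: "span B = ?K" using B span_minimal[OF B(1) K] by blast
  obtain C where C: "B \<subseteq> C" "C \<subseteq> U" "independent C" "U \<subseteq> span C"
    using maximal_independent_subset_extend[of B U] B by auto
  have CU: "span C = U" using C U by (meson span_minimal subset_antisym)
  have inj: "inj_on f (span (C - B))"
  proof (subst P.linear_inj_on_iff_eq_0[OF f])
    show "\<forall>x\<in>span (C - B). f x = 0 \<longrightarrow> x = 0"
    proof (intro ballI impI)
      fix x assume x: "x \<in> span (C - B)" "f x = 0"
      then have "x \<in> U" using span_mono[of "C - B" C] CU by blast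
      then have "x \<in> span B" using x spanB by blast
      then show "x = 0" using span_Int_eq_zero[of "C - B" B x] x C(1,3) by (simp add: Un_absorb2 Int_commute)
    qed
  qed simp
  have "card (C - B) = dim (C - B)" 
    using independent_mono[OF C(3), of "C - B"] by (intro dim_eq_card_independent[symmetric]) blast
  also have "\<dots> = dim (f ` (C - B))" using P.dim_image_eq[OF f inj] by simp
  also have "\<dots> \<le> dim (f ` U)" using C by (intro dim_subset) auto
  finally have "card (C - B) \<le> dim (f ` U)" .
  moreover have "dim U = card C" using dim_span_eq_card_independent[OF C(3)] CU by simp
  moreover have "card C = card B + card (C - B)"
    using finiteI_independent[OF C(3)] C(1) card_Diff_subset[of B C] card_mono[of C B] finite_subset[of B C]
    by simp
  ultimately show ?thesis using B by simp
qed

lemma exists_nontrivial_relation: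
  assumes "finite E" "dimension < card E"
  shows "\<exists>c. (\<exists>a\<in>E. c a \<noteq> 0) \<and> (\<Sum>a\<in>E. scale (c a) (G a)) = 0"
proof (cases "inj_on G E")
  case False
  then obtain a b where ab: "a \<in> E" "b \<in> E" "a \<noteq> b" "G a = G b" by (auto simp: inj_on_def)
  define c where "c x = (if x = a then 1 else 0) - (if x = b then 1 else 0 :: 'a)" for x
  have "(\<Sum>x\<in>E. scale (c x) (G x)) = (\<Sum>x\<in>E. (if x = a then G x else 0) - (if x = b then G x else 0))"
    by (intro sum.cong) (auto simp: c_def)
  also have "\<dots> = G a - G b" using ab assms by (simp add: sum_subtractf)
  finally show ?thesis using ab by (intro exI[of _ c] conjI bexI[of _ a]) (auto simp: c_def)
next
  case True
  have "dependent (G ` E)"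
    using independent_bound_general[of "G ` E"] dim_subset_UNIV[of "G ` E"] card_image[OF True] assms by auto
  then obtain u where u: "\<exists>v\<in>G ` E. u v \<noteq> 0" "(\<Sum>v\<in>G ` E. scale (u v) v) = 0"
    using dependent_finite[OF finite_imageI[OF assms(1)]] by blast
  then show ?thesis by (intro exI[of _ "u \<circ> G"]) (auto simp: sum.reindex[OF True])
qed

section \<open>Eigenvalues and kernels of linear pencils\<close>

lemma eigenvectors_independent:
  assumes f: "Vector_Spaces.linear scale scale f" and "finite L"
    and "\<And>c. c \<in> L \<Longrightarrow> v c \<noteq> 0 \<and> f (v c) = scale c (v c)"
    and "(\<Sum>c\<in>L. scale (a c) (v c)) = 0" "c \<in> L"
  shows "a c = 0"
  using assms(2-)
proof (induction L arbitrary: a c)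
  case empty then show ?case by simp
next
  case (insert d L)
  interpret f: Vector_Spaces.linear scale scale f by fact
  \<comment> \<open>Applying \<open>f - d\<close> to the relation removes the term of
    \<open>d\<close> and multiplies every other coefficient by the nonzero scalar
    \<open>c - d\<close>.\<close>
  have "0 = f (\<Sum>c\<in>insert d L. scale (a c) (v c)) - scale d (\<Sum>c\<in>insert d L. scale (a c) (v c))"
    unfolding insert.prems(2) by (simp add: f.zero)
  also have "\<dots> = (\<Sum>c\<in>insert d L. scale ((c - d) * a c) (v c))"
    unfolding f.sum scale_sum_right sum_subtractf[symmetric]
  proof (intro sum.cong refl)
    fix c assume "c \<in> insert d L"
    then have "f (v c) = scale c (v c)" using insert.prems(1) by blast
    then show "f (scale (a c) (v c)) - scale d (scale (a c) (v c)) = scale ((c - d) * a c) (v c)"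
      by (simp add: f.scale scale_left_diff_distrib left_diff_distrib mult.commute[of "a c" c])
  qed
  also have "\<dots> = (\<Sum>c\<in>L. scale ((c - d) * a c) (v c))" using insert.hyps by simp
  finally have zero: "(\<Sum>c\<in>L. scale ((c - d) * a c) (v c)) = 0" by simp
  have z: "(c - d) * a c = 0" if c: "c \<in> L" for c
    by (rule insert.IH[OF insert.prems(1)[OF insertI2] zero c])
  have L: "a c = 0" if "c \<in> L" for c using z[OF that] that insert.hyps(2) by (metis mult_eq_0_iff right_minus_eq)
  then have "(\<Sum>c\<in>L. scale (a c) (v c)) = 0" by (intro sum.neutral) simp
  then have "scale (a d) (v d) = 0" using insert.prems(2) insert.hyps by simp
  then have "a d = 0" using insert.prems(1)[of d] by simp
  then show ?case using insert.prems(3) L by blast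
qed

lemma finite_eigenvalues:
  assumes f: "Vector_Spaces.linear scale scale f"
  shows "finite {c. \<exists>x. x \<noteq> 0 \<and> f x = scale c x}" (is "finite ?S")
proof (rule ccontr)
  assume "infinite ?S"
  from infinite_arbitrarily_large[OF this, of "Suc dimension"]
  obtain L where L: "L \<subseteq> ?S" "finite L" "card L = Suc dimension" by (elim exE conjE)
  obtain v where v: "\<And>c. c \<in> L \<Longrightarrow> v c \<noteq> 0 \<and> f (v c) = scale c (v c)"
  proof -
    have "\<forall>c\<in>L. \<exists>x. x \<noteq> 0 \<and> f x = scale c x" using L(1) by auto
    then obtain v where "\<forall>c\<in>L. v c \<noteq> 0 \<and> f (v c) = scale c (v c)"
      by (rule bchoice[THEN exE])
    then show ?thesis by (intro that[of v]) blast
  qed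
  obtain a where "\<exists>c\<in>L. a c \<noteq> 0" "(\<Sum>c\<in>L. scale (a c) (v c)) = 0"
    using exists_nontrivial_relation[OF L(2), of v] L(3) by auto
  then obtain c where c: "c \<in> L" "a c \<noteq> 0" by blast
  have "a c = 0"
    by (rule eigenvectors_independent[where v = v and L = L and c = c, OF f L(2)]) (fact v, fact+)
  then show False using c by simp
qed

text \<open>The subspace in the conclusion consists of the kernel vectors of \<open>T\<close> that
  extend to first order to kernel vectors of \<open>T + t R\<close>. For all but finitely many
  \<open>t\<close>, \<open>T + t R\<close> is injective on a complement \<open>D\<close> of it, so
  the kernel of \<open>T + t R\<close> projects injectively onto a part of it along
  \<open>D\<close>.\<close>

lemma dim_kernel_deformation:
  assumes T: "Vector_Spaces.linear scale scale T" and R: "Vector_Spaces.linear scale scale R"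
    and UN: "infinite (UNIV :: 'a set)"
    and n: "\<And>t. n \<le> dim {x. T x + scale t (R x) = 0}"
  shows "n \<le> dim {x. T x = 0 \<and> R x \<in> range T}"
proof -
  interpret P: finite_dimensional_vector_space_pair scale Basis scale Basis ..
  interpret T: Vector_Spaces.linear scale scale T by fact
  interpret R: Vector_Spaces.linear scale scale R by fact
  let ?K = "{x. T x = 0}" and ?Q = "{x. T x = 0 \<and> R x \<in> range T}"
  have K: "subspace ?K" by (auto simp: subspace_def T.add T.scale)
  have rT: "subspace (range T)" using T.subspace_image[OF subspace_UNIV] by simp
  have Q: "subspace ?Q"
    using subspace_inter[OF K R.subspace_vimage[OF rT]] by (simp add: Collect_conj_eq vimage_def)
  obtain B where B: "B \<subseteq> ?Q" "independent B" "?Q \<subseteq> span B" "card B = dim ?Q"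
    using basis_exists by blast
  obtain C where C: "B \<subseteq> C" "C \<subseteq> ?K" "independent C" "?K \<subseteq> span C"
  proof -
    have "B \<subseteq> ?K" using B(1) by blast
    from maximal_independent_subset_extend[OF this B(2)] show ?thesis using that by blast
  qed
  obtain E where E: "C \<subseteq> E" "independent E" "UNIV \<subseteq> span E"
    by (rule maximal_independent_subset_extend[OF subset_UNIV C(3)])
  have span_C: "span C = ?K" using C(2,4) span_minimal[OF C(2) K] by blast
  have span_B: "span B = ?Q" using B span_minimal[OF B(1) Q] by blast
  \<comment> \<open>\<open>p\<close> is a projection along the kernel of \<open>T\<close>, and
    \<open>q\<close> a projection onto \<open>?Q\<close>; thus \<open>x - p x\<close> is the kernel
    component of \<open>x\<close>.\<close>
  obtain p where p: "Vector_Spaces.linear scale scale p" "\<And>x. x \<in> E \<Longrightarrow> p x = (if x \<in> C then 0 else x)"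
    using P.linear_independent_extend[OF E(2), of "\<lambda>x. if x \<in> C then 0 else x"] by blast
  obtain q where q: "Vector_Spaces.linear scale scale q" "\<And>x. x \<in> E \<Longrightarrow> q x = (if x \<in> B then x else 0)"
    using P.linear_independent_extend[OF E(2), of "\<lambda>x. if x \<in> B then x else 0"] by blast
  interpret p: Vector_Spaces.linear scale scale p by fact
  interpret q: Vector_Spaces.linear scale scale q by fact
  have in_span: "x \<in> span E" for x using E(3) by blast
  have pp: "p (p x) = p x" for x
  proof -
    have "(p \<circ> p) x = p x"
      by (rule P.linear_eq_on[OF Vector_Spaces.linear_compose[OF p(1) p(1)] p(1) in_span]) (use p(2) in auto)
    then show ?thesis by simp
  qed
  have qp: "q (p x) = 0" for x
  proof -
    have "(q \<circ> p) x = (\<lambda>_. 0) x"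
      by (rule P.linear_eq_on[OF Vector_Spaces.linear_compose[OF p(1) q(1)] P.linear_zero in_span])
        (use p(2) q(2) C(1) in auto)
    then show ?thesis by simp
  qed
  have Tp: "T (p x) = T x" for x
  proof -
    have "(T \<circ> p) x = T x"
      by (rule P.linear_eq_on[OF Vector_Spaces.linear_compose[OF p(1) T] T in_span]) (use p(2) C(2) in auto)
    then show ?thesis by simp
  qed
  have q_range: "q x \<in> ?Q" for x
  proof -
    have "q ` span E \<subseteq> span (q ` E)" using q.span_image by simp
    also have "\<dots> \<subseteq> span (insert 0 B)" using q(2) by (intro span_mono) auto
    also have "\<dots> = ?Q" using span_B by simp
    finally show ?thesis using in_span by blast
  qed
  have ker: "x = 0" if "q x = 0" "T x = 0" "R x \<in> range T" for x
  proof -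
    have x: "x \<in> span B" unfolding span_B using that(2,3) by blast
    have "q b = id b" if "b \<in> B" for b using q(2)[of b] C(1) E(1) that by auto
    then have "q x = id x" by (rule P.linear_eq_on[OF q(1) linear_id x])
    then show ?thesis using that(1) by simp
  qed
  define D where "D = {x. q x = 0}"
  have D: "subspace D" unfolding D_def by (auto simp: subspace_def q.add q.scale)
  \<comment> \<open>The limit of \<open>T + t R\<close> at \<open>t = 0\<close> once the kernel
    component of the argument has been divided by \<open>t\<close>.\<close>
  define F where "F x = T x + R (x - p x)" for x
  have F: "Vector_Spaces.linear scale scale F"
    unfolding F_def[abs_def] Vector_Spaces.linear_iff
    by (simp add: T.add T.scale R.add R.scale p.add p.scale R.diff algebra_simps vector_space_axioms)
  have "inj_on F D"
  proof (subst P.linear_inj_on_iff_eq_0[OF F D], intro ballI impI)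
    fix x assume x: "x \<in> D" "F x = 0"
    have "R (x - p x) = T (- x)" using x(2) minus_unique[of "T x" "R (x - p x)"] by (simp add: F_def T.neg)
    then have "R (x - p x) \<in> range T" by (rule range_eqI)
    have "q (x - p x) = 0" "T (x - p x) = 0" using x(1) by (simp_all add: D_def q.diff T.diff Tp qp)
    from ker[OF this \<open>R (x - p x) \<in> range T\<close>] have "x - p x = 0" .
    then have "T x = 0" using x(2) by (simp add: F_def)
    then have "x \<in> span C" unfolding span_C by blast
    then have "p x = (\<lambda>_. 0) x"
    proof (rule P.linear_eq_on[OF p(1) P.linear_zero])
      show "p b = 0" if "b \<in> C" for b using p(2)[of b] E(1) that by auto
    qed
    then show "x = 0" using \<open>x - p x = 0\<close> by simp
  qed
  then obtain g where g: "Vector_Spaces.linear scale scale g" "\<And>x. x \<in> D \<Longrightarrow> g (F x) = x"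
    using P.linear_exists_left_inverse_on[OF F D] by blast
  interpret g: Vector_Spaces.linear scale scale g by fact
  define M where "M = g \<circ> R \<circ> p"
  have M: "Vector_Spaces.linear scale scale M"
    unfolding M_def by (intro Vector_Spaces.linear_compose[OF p(1)] Vector_Spaces.linear_compose[OF R] g)
  define S where "S = {c. \<exists>x. x \<noteq> 0 \<and> M x = scale c x}"
  have "finite S" unfolding S_def by (rule finite_eigenvalues[OF M])
  then have "finite (insert 0 ((\<lambda>c. - inverse c) ` S))" by simp
  \<comment> \<open>In the rescaled variable \<open>z\<close> below, a kernel vector of
    \<open>T + t R\<close> in \<open>D\<close> satisfies \<open>M z = - z / t\<close>. So
    \<open>t\<close> is chosen nonzero such that \<open>- 1 / t\<close> is not an eigenvalue of
    \<open>M\<close>.\<close>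
  from ex_new_if_finite[OF UN this] obtain t where t: "t \<notin> insert 0 ((\<lambda>c. - inverse c) ` S)" ..
  then have t0: "t \<noteq> 0" by simp
  have inj: "x = 0" if x: "x \<in> D" "T x + scale t (R x) = 0" for x
  proof -
    define z where "z = p x + scale t (x - p x)"
    have pz: "p z = p x" by (simp add: z_def p.add p.scale p.diff pp)
    have zD: "z \<in> D" using x(1) by (simp add: z_def D_def q.add q.scale q.diff qp)
    have "T z = T x" by (simp add: z_def T.add T.scale T.diff Tp)
    moreover have "z - p z = scale t (x - p x)" unfolding pz by (simp add: z_def)
    ultimately have "F z = T x + scale t (R x - R (p x))" unfolding F_def by (simp only: R.scale R.diff)
    then have "F z + scale t (R (p z)) = T x + scale t (R x)" by (simp add: pz algebra_simps)
    then have "g (F z + scale t (R (p z))) = 0" using x(2) by simp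
    then have "z + scale t (M z) = 0" using g(2)[OF zD] by (simp add: g.add g.scale M_def)
    then have "scale t (M z) = - z" using minus_unique[of z "scale t (M z)"] by simp
    then have "scale (inverse t) (scale t (M z)) = scale (- inverse t) z" by simp
    then have "M z = scale (- inverse t) z" using t0 by simp
    moreover have "- inverse t \<notin> S"
    proof
      assume "- inverse t \<in> S"
      then have "- inverse (- inverse t) \<in> (\<lambda>c. - inverse c) ` S" by (rule imageI)
      then show False using t by simp
    qed
    ultimately have "z = 0" unfolding S_def by blast
    then have "p x = 0" using pz p.zero by metis
    moreover from this have "scale t x = 0" using \<open>z = 0\<close> unfolding z_def by simp
    ultimately show "x = 0" using t0 by simp
  qed
  let ?Kt = "{x. T x + scale t (R x) = 0}"
  have Kt: "subspace ?Kt"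
  proof -
    have "Vector_Spaces.linear scale scale (\<lambda>x. T x + scale t (R x))"
      unfolding Vector_Spaces.linear_iff by (simp add: T.add T.scale R.add R.scale algebra_simps vector_space_axioms)
    then interpret TR: Vector_Spaces.linear scale scale "\<lambda>x. T x + scale t (R x)" .
    show ?thesis by (rule TR.subspace_kernel)
  qed
  have "inj_on q (span ?Kt)"
    unfolding span_eq_iff[THEN iffD2, OF Kt]
    unfolding P.linear_inj_on_iff_eq_0[OF q(1) Kt] using inj unfolding D_def by blast
  then have "dim ?Kt = dim (q ` ?Kt)" using P.dim_image_eq[OF q(1), of ?Kt] by simp
  also have "\<dots> \<le> dim ?Q" using q_range by (intro dim_subset) blast
  finally show ?thesis using n[of t] by simp
qed

end

text \<open>Over a finite field, 1 plus the product of all \<open>x - a\<close> is nonconstant and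
  takes the value 1 everywhere.\<close>

lemma infinite_UNIV_alg_closed: "infinite (UNIV :: 'k::alg_closed_field set)"
proof
  assume fin: "finite (UNIV :: 'k set)"
  define p where "p = (\<Prod>a\<in>(UNIV :: 'k set). [:- a, 1:]) + 1"
  have "degree (\<Prod>a\<in>(UNIV :: 'k set). [:- a, 1:]) = card (UNIV :: 'k set)"
    by (subst degree_prod_eq_sum_degree) auto
  moreover have "card (UNIV :: 'k set) > 0" using fin by (simp add: card_gt_0_iff)
  ultimately have "degree p > 0" unfolding p_def by (subst degree_add_eq_left) auto
  then obtain x where "poly p x = 0" using alg_closed_imp_poly_has_root by blast
  moreover have "poly p x = 1" using fin by (auto simp: p_def poly_prod intro!: prod_zero bexI[of _ x])
  ultimately show False by simp
qed

subsection \<open>Growth of filtered algebras and chains of irreducible sets\<close>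

text \<open>\<open>N\<close> will be the set of functions that vanish on a given set. Adding it to
  the spanning sets of the filtration amounts to working modulo \<open>N\<close> without forming a
  quotient.\<close>

locale algebra_with_ideal = vector_space scale
  for scale :: "'k::field \<Rightarrow> 'a::comm_ring_1 \<Rightarrow> 'a" +
  fixes N :: "'a set"
  assumes scale_mult_left: "scale c x * y = scale c (x * y)"
    and ideal_mult: "x \<in> N \<Longrightarrow> y * x \<in> N"
begin

lemma scale_mult_right: "x * scale c y = scale c (x * y)"
  by (metis mult.commute scale_mult_left)

lemma span_mult_closed:
  assumes "\<And>a. a \<in> A \<Longrightarrow> g * a \<in> span B" "f \<in> span A"
  shows "g * f \<in> span B"
  using assms(2)
proof (induction rule: span_induct_alt)
  case base then show ?case by (simp add: span_zero)
next
  case (step c x y)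
  then show ?case
    using span_add span_scale assms(1) by (simp add: distrib_left scale_mult_right)
qed

primrec monoms :: "'a set \<Rightarrow> nat \<Rightarrow> 'a set" where
  "monoms C 0 = {1}"
| "monoms C (Suc d) = monoms C d \<union> {x * f |x f. x \<in> C \<and> f \<in> monoms C d}"

definition filt :: "'a set \<Rightarrow> nat \<Rightarrow> 'a set" where
  "filt C d = span (monoms C d \<union> N)"

text \<open>The part of the ideal of \<open>X\<close>, modulo \<open>N\<close>, that can be written
  with cofactors of degree strictly below \<open>n\<close>. The strictness drives the induction on
  the degree in \<open>filt_subset_span_bounded_monoms\<close>.\<close>

definition filt_ideal ::
  "'a set \<Rightarrow> 'a set \<Rightarrow> nat \<Rightarrow> 'a set" where
  "filt_ideal X C n = span ({x * f |x f. x \<in> X \<and> (\<exists>d<n. f \<in> filt C d)} \<union> N)"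

lemma subspace_filt: "subspace (filt C d)"
  by (simp add: filt_def)

lemma subspace_filt_ideal: "subspace (filt_ideal X C d)"
  by (simp add: filt_ideal_def)

lemma ideal_in_filt: "f \<in> N \<Longrightarrow> f \<in> filt C d"
  by (simp add: filt_def span_base)

lemma ideal_in_filt_ideal: "f \<in> N \<Longrightarrow> f \<in> filt_ideal X C d"
  by (simp add: filt_ideal_def span_base)

lemma monoms_mono: "d \<le> d' \<Longrightarrow> monoms C d \<subseteq> monoms C d'"
  by (induction d' rule: nat_induct_at_least[of d] ) auto

lemma filt_mono: "d \<le> d' \<Longrightarrow> filt C d \<subseteq> filt C d'"
  unfolding filt_def by (intro span_mono) (use monoms_mono in blast)

lemma filt_ideal_mono: "d \<le> d' \<Longrightarrow> filt_ideal X C d \<subseteq> filt_ideal X C d'"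
  unfolding filt_ideal_def by (intro span_mono) (auto intro: less_le_trans)

lemma monoms_filt: "f \<in> monoms C d \<Longrightarrow> f \<in> filt C d"
  by (simp add: filt_def span_base)

lemma one_in_filt: "1 \<in> filt C d"
  using filt_mono[of 0 d C] monoms_filt[of 1 C 0] by auto

lemma gen_in_filt: "x \<in> C \<Longrightarrow> x \<in> filt C 1"
proof (rule monoms_filt)
  assume "x \<in> C"
  then have "\<exists>y f. x = y * f \<and> y \<in> C \<and> f \<in> monoms C 0" by (intro exI[of _ x] exI[of _ 1]) simp
  then show "x \<in> monoms C 1" by auto
qed

lemma monoms_mult: "f \<in> monoms C d \<Longrightarrow> g \<in> monoms C d' \<Longrightarrow> f * g \<in> monoms C (d + d')"
proof (induction d arbitrary: f)
  case 0 then show ?case by simp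
next
  case (Suc d)
  then consider "f \<in> monoms C d" | x h where "f = x * h" "x \<in> C" "h \<in> monoms C d" by auto
  then show ?case
  proof cases
    case (2 x h)
    then have "f * g = x * (h * g)" "h * g \<in> monoms C (d + d')"
      using Suc by (simp_all add: mult.assoc)
    then show ?thesis using 2(2) by auto
  qed (use Suc in simp)
qed

lemma filt_mult:
  assumes "f \<in> filt C d" "g \<in> filt C d'"
  shows "f * g \<in> filt C (d + d')"
proof -
  have *: "h * g \<in> filt C (d + d')" if "h \<in> monoms C d" for h
    using assms(2) unfolding filt_def
    by (rule span_mult_closed[rotated])
       (use that monoms_mult[OF that] in \<open>auto intro: span_base ideal_mult\<close>)
  have "g * f \<in> filt C (d + d')"
    using assms(1) unfolding filt_def
  proof (rule span_mult_closed[rotated])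
    fix a assume "a \<in> monoms C d \<union> N"
    then show "g * a \<in> span (monoms C (d + d') \<union> N)"
      using *[of a] ideal_mult[of a g] by (auto simp: filt_def mult.commute intro: span_base)
  qed
  then show ?thesis by (simp add: mult.commute)
qed

lemma filt_power: "f \<in> filt C d \<Longrightarrow> f ^ n \<in> filt C (n * d)"
  by (induction n) (auto simp: one_in_filt filt_mult)

lemma filt_prod:
  "(\<And>i. i \<in> A \<Longrightarrow> f i \<in> filt C d) \<Longrightarrow> (\<Prod>i\<in>A. f i) \<in> filt C (card A * d)"
  by (induction A rule: infinite_finite_induct) (auto simp: one_in_filt filt_mult)

lemma filt_ideal_mult:
  assumes "g \<in> filt C d" "f \<in> filt_ideal X C n"
  shows "g * f \<in> filt_ideal X C (d + n)"
  using assms(2) unfolding filt_ideal_def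
proof (rule span_mult_closed[rotated], goal_cases)
  case (1 a)
  then show ?case
  proof
    assume "a \<in> {x * f |x f. x \<in> X \<and> (\<exists>d<n. f \<in> filt C d)}"
    then obtain x f d' where a: "a = x * f" "x \<in> X" "d' < n" "f \<in> filt C d'" by blast
    have "g * a = x * (g * f)" using a by (simp add: mult_ac)
    moreover have "g * f \<in> filt C (d + d')" using filt_mult assms(1) a by blast
    moreover have "d + d' < d + n" using a by simp
    ultimately have "g * a \<in> {x * f |x f. x \<in> X \<and> (\<exists>e<d + n. f \<in> filt C e)}" using a by blast
    then show ?thesis by (intro span_base) blast
  qed (auto intro: span_base ideal_mult)
qed

text \<open>Telescoping: the factors are exchanged one at a time, and each exchange contributes one
  factor from the span of \<open>X\<close> next to \<open>n - 1\<close> factors of degree 1. Applied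
  to the terms of a determinant, this replaces its entries by their restrictions to the
  plane.\<close>

lemma prod_diff_filt_ideal:
  assumes "\<And>i. i < n \<Longrightarrow> l i - m i \<in> span X"
    and "\<And>i. i < n \<Longrightarrow> l i \<in> filt C 1" "\<And>i. i < n \<Longrightarrow> m i \<in> filt C 1"
  shows "(\<Prod>i<n. l i) - (\<Prod>i<n. m i) \<in> filt_ideal X C n"
  using assms
proof (induction n)
  case 0
  then show ?case using subspace_0[OF subspace_filt_ideal] by simp
next
  case (Suc n)
  let ?L = "\<Prod>i<n. l i" and ?M = "\<Prod>i<n. m i"
  have "?L * (l n - m n) \<in> filt_ideal X C (Suc n)"
    unfolding filt_ideal_def
  proof (rule span_mult_closed[where A = X])
    show "l n - m n \<in> span X" using Suc by simp
    have "?L \<in> filt C n" using filt_prod[of "{..<n}" l C 1] Suc by simp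
    then show "?L * a \<in> span ({x * f |x f. x \<in> X \<and> (\<exists>d<Suc n. f \<in> filt C d)} \<union> N)"
      if "a \<in> X" for a using that by (intro span_base) (auto simp: mult.commute)
  qed
  moreover have "m n * (?L - ?M) \<in> filt_ideal X C (Suc n)"
    using filt_ideal_mult[of "m n" C 1 "?L - ?M" X n] Suc by simp
  ultimately have "?L * (l n - m n) + m n * (?L - ?M) \<in> filt_ideal X C (Suc n)"
    using subspace_add[OF subspace_filt_ideal] by blast
  moreover have "?L * (l n - m n) + m n * (?L - ?M) = (\<Prod>i<Suc n. l i) - (\<Prod>i<Suc n. m i)"
    by (simp add: algebra_simps)
  ultimately show ?case by simp
qed

text \<open>A monomial with a factor in \<open>X\<close> lies in the ideal at once. Otherwise it is
  \<open>y1 ^ a * y2 ^ b\<close>, and an exponent of at least \<open>r\<close> makes it a multiple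
  of \<open>y1 ^ r\<close> or \<open>y2 ^ r\<close>, with the degrees adding up.\<close>

lemma monoms_reduce:
  assumes "y1 ^ r \<in> filt_ideal X (insert y1 (insert y2 X)) r"
    and "y2 ^ r \<in> filt_ideal X (insert y1 (insert y2 X)) r"
    and "f \<in> monoms (insert y1 (insert y2 X)) n"
  shows "f \<in> filt_ideal X (insert y1 (insert y2 X)) n \<or> (\<exists>a b. a < r \<and> b < r \<and> f = y1 ^ a * y2 ^ b)"
proof -
  define C where "C = insert y1 (insert y2 X)"
  have y: "y1 \<in> filt C 1" "y2 \<in> filt C 1" using gen_in_filt[of _ C] by (auto simp: C_def)
  have "f \<in> filt_ideal X C n \<or> (\<exists>a b. a + b \<le> n \<and> f = y1 ^ a * y2 ^ b)"
    using assms(3) unfolding C_def[symmetric]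
  proof (induction n arbitrary: f)
    case 0 then show ?case by (auto intro: exI[of _ 0])
  next
    case (Suc n)
    then consider "f \<in> monoms C n" | x g where "f = x * g" "x \<in> C" "g \<in> monoms C n" by auto
    then show ?case
    proof cases
      case 1
      then show ?thesis using Suc.IH[of f] filt_ideal_mono[of n "Suc n" X C] le_SucI[of _ n]
        by blast
    next
      case (2 x g)
      show ?thesis
      proof (cases "x \<in> X")
        case True
        then have "f \<in> {x * f |x f. x \<in> X \<and> (\<exists>d<Suc n. f \<in> filt C d)}"
          using 2 monoms_filt[of g C n] by blast
        then show ?thesis
          unfolding filt_ideal_def by (intro disjI1 span_base) blast
      next
        case False
        then have x: "x = y1 \<or> x = y2" using 2 by (auto simp: C_def)
        have IH: "g \<in> filt_ideal X C n \<or> (\<exists>a b. a + b \<le> n \<and> g = y1 ^ a * y2 ^ b)"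
          using Suc.IH 2 by blast
        then show ?thesis
        proof (elim disjE exE conjE)
          assume "g \<in> filt_ideal X C n"
          then show ?thesis using filt_ideal_mult[of x C 1 g X n] x y 2 by auto
        next
          fix a b assume ab: "a + b \<le> n" "g = y1 ^ a * y2 ^ b"
          have "f = y1 ^ Suc a * y2 ^ b \<or> f = y1 ^ a * y2 ^ Suc b"
            using x 2 ab by (auto simp: mult_ac)
          moreover have "Suc a + b \<le> Suc n" "a + Suc b \<le> Suc n" using ab by simp_all
          ultimately show ?thesis by blast
        qed
      qed
    qed
  qed
  then have "f \<in> filt_ideal X C n \<or> (\<exists>a b. a < r \<and> b < r \<and> f = y1 ^ a * y2 ^ b)"
  proof (elim disjE exE conjE)
    fix a b assume ab: "a + b \<le> n" "f = y1 ^ a * y2 ^ b"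
    have red: "g * h ^ r \<in> filt_ideal X C n"
      if "g \<in> filt C d" "d + r \<le> n" "h ^ r \<in> filt_ideal X C r" for g h d
      using filt_ideal_mult[OF that(1,3)] filt_ideal_mono[OF that(2)] by blast
    consider "a < r" "b < r" | "a \<ge> r" | "b \<ge> r" by linarith
    then show ?thesis
    proof cases
      case 1 then show ?thesis using ab by blast
    next
      case 2
      have "y1 ^ (a - r) * y2 ^ b \<in> filt C ((a - r) + b)"
        using filt_mult[OF filt_power[OF y(1), of "a - r"] filt_power[OF y(2), of b]] by simp
      from red[OF this, of y1] assms(1) have "y1 ^ (a - r) * y2 ^ b * y1 ^ r \<in> filt_ideal X C n"
        using ab 2 by (simp add: C_def)
      also have "y1 ^ (a - r) * y2 ^ b * y1 ^ r = f"
        using 2 power_add[of y1 "a - r" r] ab(2) by (simp add: ac_simps)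
      finally show ?thesis ..
    next
      case 3
      have "y1 ^ a * y2 ^ (b - r) \<in> filt C (a + (b - r))"
        using filt_mult[OF filt_power[OF y(1), of a] filt_power[OF y(2), of "b - r"]] by simp
      from red[OF this, of y2] assms(2) have "y1 ^ a * y2 ^ (b - r) * y2 ^ r \<in> filt_ideal X C n"
        using ab 3 by (simp add: C_def)
      also have "y1 ^ a * y2 ^ (b - r) * y2 ^ r = f"
        using 3 power_add[of y2 "b - r" r] ab(2) by (simp add: ac_simps)
      finally show ?thesis ..
    qed
  qed blast
  then show ?thesis by (simp add: C_def)
qed

text \<open>The exponents over \<open>X\<close> are bounded one by one rather than in total. This
  allows more monomials, but they are counted at once by \<open>Suc n ^ card X * r ^ 2\<close>,
  which has the right growth in \<open>n\<close>.\<close>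

definition bounded_monoms ::
  "'a set \<Rightarrow> 'a \<Rightarrow> 'a \<Rightarrow> nat \<Rightarrow> nat \<Rightarrow> 'a set" where
  "bounded_monoms X y1 y2 r n =
     {(\<Prod>x\<in>X. x ^ c x) * (y1 ^ a * y2 ^ b) |c a b. (\<forall>x\<in>X. c x \<le> n) \<and> a < r \<and> b < r}"

lemma bounded_monoms_mono: "n \<le> n' \<Longrightarrow> bounded_monoms X y1 y2 r n \<subseteq> bounded_monoms X y1 y2 r n'"
  unfolding bounded_monoms_def
proof clarify
  fix c a b assume "n \<le> n'" "\<forall>x\<in>X. c x \<le> n" "a < r" "b < r"
  then show "\<exists>c' a' b'. (\<Prod>x\<in>X. x ^ c x) * (y1 ^ a * y2 ^ b) =
      (\<Prod>x\<in>X. x ^ c' x) * (y1 ^ a' * y2 ^ b') \<and> (\<forall>x\<in>X. c' x \<le> n') \<and> a' < r \<and> b' < r"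
    by (intro exI[of _ c] exI[of _ a] exI[of _ b]) auto
qed

lemma bounded_monoms_mult:
  assumes "finite X" "x \<in> X" "f \<in> bounded_monoms X y1 y2 r n"
  shows "x * f \<in> bounded_monoms X y1 y2 r (Suc n)"
proof -
  obtain c a b where f: "f = (\<Prod>x\<in>X. x ^ c x) * (y1 ^ a * y2 ^ b)" "\<forall>x\<in>X. c x \<le> n" "a < r" "b < r"
    using assms(3) by (auto simp: bounded_monoms_def)
  have "(\<Prod>z\<in>X. z ^ (c(x := Suc (c x))) z) = x * (\<Prod>z\<in>X. z ^ c z)"
    using prod.remove[OF assms(1,2), of "\<lambda>z. z ^ (c(x := Suc (c x))) z"]
      prod.remove[OF assms(1,2), of "\<lambda>z. z ^ c z"]
      prod.cong[of "X - {x}" "X - {x}" "\<lambda>z. z ^ (c(x := Suc (c x))) z" "\<lambda>z. z ^ c z"]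
    by (simp add: mult.assoc)
  then have "x * f = (\<Prod>z\<in>X. z ^ (c(x := Suc (c x))) z) * (y1 ^ a * y2 ^ b)"
    using f(1) by (simp add: mult.assoc)
  moreover have "\<forall>z\<in>X. (c(x := Suc (c x))) z \<le> Suc n" using f(2) assms(2) by (auto intro: le_SucI)
  ultimately show ?thesis using f(3,4) unfolding bounded_monoms_def mem_Collect_eq
    by (intro exI[of _ "c(x := Suc (c x))"] exI[of _ a] exI[of _ b]) simp
qed

lemma card_bounded_monoms:
  assumes "finite X"
  shows "finite (bounded_monoms X y1 y2 r n)" "card (bounded_monoms X y1 y2 r n) \<le> Suc n ^ card X * r ^ 2"
proof -
  let ?P = "(X \<rightarrow>\<^sub>E {..n}) \<times> {..<r} \<times> {..<r}"
  let ?g = "\<lambda>(c, a, b). (\<Prod>x\<in>X. x ^ c x) * (y1 ^ a * y2 ^ b)"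
  have sub: "bounded_monoms X y1 y2 r n \<subseteq> ?g ` ?P"
  proof
    fix f assume "f \<in> bounded_monoms X y1 y2 r n"
    then obtain c a b where f: "f = (\<Prod>x\<in>X. x ^ c x) * (y1 ^ a * y2 ^ b)"
      "\<forall>x\<in>X. c x \<le> n" "a < r" "b < r" by (auto simp: bounded_monoms_def)
    have "f = ?g (restrict c X, a, b)" using f(1) by (auto intro!: prod.cong)
    moreover have "(restrict c X, a, b) \<in> ?P" using f by auto
    ultimately show "f \<in> ?g ` ?P" by blast
  qed
  have fin: "finite ?P" using assms by (intro finite_cartesian_product finite_PiE) auto
  then show "finite (bounded_monoms X y1 y2 r n)" using sub finite_subset by blast
  have "card (bounded_monoms X y1 y2 r n) \<le> card ?P"
    using card_mono[OF _ sub] card_image_le[OF fin, of ?g] fin by (meson finite_imageI le_trans)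
  also have "\<dots> = Suc n ^ card X * r ^ 2"
    using assms by (simp add: card_cartesian_product card_PiE power2_eq_square)
  finally show "card (bounded_monoms X y1 y2 r n) \<le> Suc n ^ card X * r ^ 2" .
qed

text \<open>A monomial of degree at most \<open>n\<close> is a small monomial in \<open>y1\<close>
  and \<open>y2\<close>, or modulo \<open>N\<close> a combination of products of an element of
  \<open>X\<close> with a cofactor of degree below \<open>n\<close>, to which the induction
  hypothesis applies.\<close>

lemma filt_subset_span_bounded_monoms:
  assumes "finite X"
    and "y1 ^ r \<in> filt_ideal X (insert y1 (insert y2 X)) r"
    and "y2 ^ r \<in> filt_ideal X (insert y1 (insert y2 X)) r"
  shows "filt (insert y1 (insert y2 X)) n \<subseteq> span (bounded_monoms X y1 y2 r n \<union> N)"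
proof (induction n rule: less_induct)
  case (less n)
  define C where "C = insert y1 (insert y2 X)"
  let ?S = "span (bounded_monoms X y1 y2 r n \<union> N)"
  have "x * f \<in> ?S" if "x \<in> X" "d < n" "f \<in> filt C d" for x f d
  proof (rule span_mult_closed)
    show "f \<in> span (bounded_monoms X y1 y2 r d \<union> N)" using less that by (auto simp: C_def)
    show "x * a \<in> ?S" if "a \<in> bounded_monoms X y1 y2 r d \<union> N" for a
      using that bounded_monoms_mult[OF assms(1) \<open>x \<in> X\<close>, of a y1 y2 r d]
        bounded_monoms_mono[of "Suc d" n X y1 y2 r] \<open>d < n\<close> ideal_mult[of a x]
      by (intro span_base) auto
  qed
  then have "filt_ideal X C n \<subseteq> ?S"
    unfolding filt_ideal_def by (intro span_minimal) (auto intro: span_base)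
  moreover have "y1 ^ a * y2 ^ b \<in> ?S" if "a < r" "b < r" for a b
  proof (intro span_base UnI1)
    show "y1 ^ a * y2 ^ b \<in> bounded_monoms X y1 y2 r n" unfolding bounded_monoms_def mem_Collect_eq
      using that by (intro exI[of _ "\<lambda>_. 0"] exI[of _ a] exI[of _ b]) simp
  qed
  ultimately have "monoms C n \<subseteq> ?S"
    using monoms_reduce[OF assms(2,3), of _ n] unfolding C_def by blast
  then show ?case unfolding filt_def C_def[symmetric]
    by (intro span_minimal) (auto intro: span_base)
qed

end

section \<open>Functions modulo those that vanish on a set, and chains of sets\<close>

definition fscale :: "'k::field \<Rightarrow> ('p \<Rightarrow> 'k) \<Rightarrow> 'p \<Rightarrow> 'k" where
  "fscale c f = (\<lambda>z. c * f z)"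

definition vanishing :: "'p set \<Rightarrow> ('p \<Rightarrow> 'k::field) set" where
  "vanishing Z = {f. \<forall>z\<in>Z. f z = 0}"

interpretation F: algebra_with_ideal fscale "vanishing Z" for Z
  by unfold_locales (auto simp: fscale_def vanishing_def algebra_simps fun_eq_iff)

lemma fun_sum_apply: "(\<Sum>a\<in>A. f a) z = (\<Sum>a\<in>A. f a z)" for f :: "'a \<Rightarrow> 'p \<Rightarrow> 'k::field"
  by (induction A rule: infinite_finite_induct) auto

lemma fun_prod_apply: "(\<Prod>a\<in>A. f a) z = (\<Prod>a\<in>A. f a z)" for f :: "'a \<Rightarrow> 'p \<Rightarrow> 'k::field"
  by (induction A rule: infinite_finite_induct) auto

lemma fun_power_apply: "(f ^ n) z = f z ^ n" for f :: "'p \<Rightarrow> 'k::field"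
  by (induction n) auto

definition function_algebra :: "('p \<Rightarrow> 'k::field) set \<Rightarrow> bool" where
  "function_algebra A \<longleftrightarrow> (\<forall>c. (\<lambda>z. c) \<in> A) \<and>
     (\<forall>f\<in>A. \<forall>g\<in>A. (\<lambda>z. f z + g z) \<in> A \<and> (\<lambda>z. f z * g z) \<in> A)"

text \<open>The restrictions to \<open>Z\<close> of the functions in an algebra \<open>A\<close>
  form an integral domain. This is the form in which irreducibility enters the chain
  argument.\<close>

definition integral_on :: "('p \<Rightarrow> 'k::field) set \<Rightarrow> 'p set \<Rightarrow> bool" where
  "integral_on A Z \<longleftrightarrow> Z \<noteq> {} \<and> (\<forall>f\<in>A. \<forall>g\<in>A. (\<lambda>z. f z * g z) \<in> vanishing Z \<longrightarrow>
     f \<in> vanishing Z \<or> g \<in> vanishing Z)"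

lemma function_algebra_sum:
  assumes "function_algebra A" "\<And>i. i \<in> I \<Longrightarrow> f i \<in> A"
  shows "(\<lambda>z. \<Sum>i\<in>I. f i z) \<in> A"
  using assms(2) by (induction I rule: infinite_finite_induct)
    (use assms(1) in \<open>simp_all add: function_algebra_def\<close>)

lemma function_algebra_prod:
  assumes "function_algebra A" "\<And>i. i \<in> I \<Longrightarrow> f i \<in> A"
  shows "(\<lambda>z. \<Prod>i\<in>I. f i z) \<in> A"
  using assms(2) by (induction I rule: infinite_finite_induct)
    (use assms(1) in \<open>simp_all add: function_algebra_def\<close>)

lemma function_algebra_power:
  assumes "function_algebra A" "f \<in> A"
  shows "(\<lambda>z. f z ^ n) \<in> A"
  by (induction n) (use assms in \<open>simp_all add: function_algebra_def\<close>)

text \<open>In a domain the common factor \<open>g ^ j0\<close> can be cancelled from the relation;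
  on \<open>Z0\<close>, where \<open>g\<close> vanishes, only the lowest remaining coefficient
  survives.\<close>

lemma integral_on_lowest_coeff:
  assumes A: "function_algebra A" and Z: "integral_on A Z" "Z0 \<subseteq> Z"
    and g: "g \<in> A" "g \<in> vanishing Z0" "g \<notin> vanishing Z"
    and P: "\<And>j. P j \<in> A" "\<And>j z. j < j0 \<Longrightarrow> P j z = 0" and j0: "j0 \<le> m"
    and sum: "\<And>z. z \<in> Z \<Longrightarrow> (\<Sum>j\<le>m. P j z * g z ^ j) = 0"
  shows "P j0 \<in> vanishing Z0"
proof -
  define Q where "Q = (\<lambda>z. \<Sum>j\<le>m - j0. P (j0 + j) z * g z ^ j)"
  have QA: "Q \<in> A" unfolding Q_def
    using P(1) function_algebra_power[OF A g(1)] A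
    by (intro function_algebra_sum) (auto simp: function_algebra_def)
  have eq: "(\<Sum>j\<le>m. P j z * g z ^ j) = g z ^ j0 * Q z" for z
  proof -
    have "(\<Sum>j\<le>m. P j z * g z ^ j) = (\<Sum>j\<in>{j0..m}. P j z * g z ^ j)"
      by (rule sum.mono_neutral_right) (auto simp: P(2))
    also have "\<dots> = (\<Sum>j\<le>m - j0. P (j0 + j) z * g z ^ (j0 + j))"
      by (rule sum.reindex_bij_witness[of _ "\<lambda>j. j0 + j" "\<lambda>j. j - j0"]) (use j0 in auto)
    finally show ?thesis by (simp add: Q_def sum_distrib_left power_add mult_ac)
  qed
  have nv: "(\<lambda>z. g z ^ j) \<notin> vanishing Z" for j
  proof (induction j)
    case 0 then show ?case using Z by (auto simp: integral_on_def vanishing_def)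
  next
    case (Suc j)
    then show ?case using Z(1) g function_algebra_power[OF A g(1), of j] by (auto simp: integral_on_def)
  qed
  have "(\<lambda>z. g z ^ j0 * Q z) \<in> vanishing Z" using sum eq by (auto simp: vanishing_def)
  then have "Q \<in> vanishing Z"
    using Z(1) nv QA function_algebra_power[OF A g(1), of j0] by (auto simp: integral_on_def)
  moreover have "Q z = P j0 z" if "z \<in> Z0" for z
  proof -
    have "g z = 0" using g(2) that by (auto simp: vanishing_def)
    then have "Q z = (\<Sum>j\<le>m - j0. if j = 0 then P j0 z else 0)"
      unfolding Q_def by (intro sum.cong) auto
    then show ?thesis by simp
  qed
  ultimately show ?thesis using Z(2) by (fastforce simp: vanishing_def)
qed

lemma sum_PiE_lessThan_Suc:
  "(\<Sum>a\<in>PiE {..<Suc k} (\<lambda>_. T). h a) = (\<Sum>j\<in>T. \<Sum>a\<in>PiE {..<k} (\<lambda>_. T). h (a(k := j)))"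
proof -
  have "PiE {..<Suc k} (\<lambda>_. T) = (\<lambda>(y, g). g(k := y)) ` (T \<times> PiE {..<k} (\<lambda>_. T))"
    by (simp add: lessThan_Suc PiE_insert_eq)
  moreover have "inj_on (\<lambda>(y, g). g(k := y)) (T \<times> PiE {..<k} (\<lambda>_. T))"
    by (rule inj_combinator) simp
  ultimately show ?thesis
    by (simp add: sum.reindex sum.cartesian_product case_prod_unfold o_def)
qed

text \<open>A relation among the functions is a polynomial in the last one, \<open>f k\<close>,
  whose coefficients are polynomials in the earlier ones. Its lowest coefficient vanishes on
  \<open>Zs k\<close> by \<open>integral_on_lowest_coeff\<close>, so it is a relation one level down
  and trivial by induction; this makes the next coefficient the lowest.\<close>

lemma chain_algebraically_independent:
  assumes A: "function_algebra A"
    and "\<And>i. i \<le> k \<Longrightarrow> integral_on A (Zs i)" "\<And>i. i < k \<Longrightarrow> Zs i \<subseteq> Zs (Suc i)"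
    and "\<And>i. i < k \<Longrightarrow> f i \<in> A" "\<And>i. i < k \<Longrightarrow> f i \<in> vanishing (Zs i)"
    and "\<And>i. i < k \<Longrightarrow> f i \<notin> vanishing (Zs (Suc i))"
    and "\<And>z. z \<in> Zs k \<Longrightarrow> (\<Sum>a\<in>PiE {..<k} (\<lambda>_. {..m}). c a * (\<Prod>i<k. f i z ^ a i)) = 0"
    and "a \<in> PiE {..<k} (\<lambda>_. {..m::nat})"
  shows "c a = 0"
  using assms(2-)
proof (induction k arbitrary: c a)
  case 0
  obtain z where "z \<in> Zs 0" using 0(1)[of 0] by (auto simp: integral_on_def)
  then show ?case using 0 by auto
next
  case (Suc k)
  let ?E = "PiE {..<k} (\<lambda>_. {..m})"
  define P where "P j z = (\<Sum>a\<in>?E. c (a(k := j)) * (\<Prod>i<k. f i z ^ a i))" for j z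
  have PA: "P j \<in> A" for j
  proof -
    have "(\<lambda>z. \<Prod>i<k. f i z ^ a i) \<in> A" for a
      using Suc.prems(3)
      by (intro function_algebra_prod[OF A] function_algebra_power[OF A]) auto
    then show ?thesis unfolding P_def[abs_def] using A
      by (intro function_algebra_sum) (auto simp: function_algebra_def)
  qed
  have eq: "(\<Sum>j\<le>m. P j z * f k z ^ j) = 0" if "z \<in> Zs (Suc k)" for z
  proof -
    have "(\<Sum>a\<in>PiE {..<Suc k} (\<lambda>_. {..m}). c a * (\<Prod>i<Suc k. f i z ^ a i)) =
      (\<Sum>j\<le>m. \<Sum>a\<in>?E. c (a(k := j)) * ((\<Prod>i<k. f i z ^ a i) * f k z ^ j))"
      unfolding sum_PiE_lessThan_Suc by simp
    also have "\<dots> = (\<Sum>j\<le>m. P j z * f k z ^ j)"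
      by (simp add: P_def sum_distrib_right mult.assoc)
    finally show ?thesis using Suc.prems(6)[OF that] by simp
  qed
  have all: "\<forall>a\<in>?E. c (a(k := j)) = 0" if "j \<le> m" for j
    using that
  proof (induction j rule: less_induct)
    case (less j)
    have "P j' z = 0" if "j' < j" for j' z
    proof -
      have "\<forall>a\<in>?E. c (a(k := j')) = 0" using less.IH[OF that] less.prems that by linarith
      then show ?thesis unfolding P_def by (intro sum.neutral ballI) (simp del: fun_upd_apply)
    qed
    then have "P j \<in> vanishing (Zs k)"
      using Suc.prems(1)[of "Suc k"] Suc.prems(2)[of k] Suc.prems(3-5)[of k]
      by (intro integral_on_lowest_coeff[where Z = "Zs (Suc k)", OF A _ _ _ _ _ PA _ less.prems eq]) simp_all
    then have "(\<Sum>a\<in>?E. c (a(k := j)) * (\<Prod>i<k. f i z ^ a i)) = 0" if "z \<in> Zs k" for z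
      using that by (simp add: P_def vanishing_def del: fun_upd_apply)
    then show ?case
      by (intro ballI, intro Suc.IH[where c = "\<lambda>a. c (a(k := j))"])
        (simp_all add: Suc.prems(1-5) del: fun_upd_apply)
  qed
  \<comment> \<open>An extensional exponent vector splits into its restriction to
    \<open>{..<k}\<close>, which is \<open>undefined\<close> at \<open>k\<close>, and its value at
    \<open>k\<close>.\<close>
  have "a(k := undefined) \<in> ?E" "a k \<le> m" using Suc.prems(7) by (auto simp: PiE_iff extensional_def)
  then have "c ((a(k := undefined))(k := a k)) = 0" using all by blast
  then show ?case by simp
qed

text \<open>Restriction to \<open>Z\<close>, extended by 0, is linear and kills
  \<open>vanishing Z\<close>, so the \<open>G a\<close> turn into independent vectors in the span of
  the restrictions of \<open>T\<close>.\<close>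

lemma card_le_if_independent_on:
  fixes G :: "'c \<Rightarrow> 'a \<Rightarrow> 'b::field"
  assumes E: "finite E" and T: "finite T"
    and G: "\<And>a. a \<in> E \<Longrightarrow> G a \<in> F.span (T \<union> vanishing Z)"
    and indep: "\<And>c a. (\<And>z. z \<in> Z \<Longrightarrow> (\<Sum>a\<in>E. c a * G a z) = 0) \<Longrightarrow> a \<in> E \<Longrightarrow> c a = 0"
  shows "card E \<le> card T"
proof -
  define res where "res f = (\<lambda>z. if z \<in> Z then f z else 0)" for f :: "'a \<Rightarrow> 'b"
  have res_lin: "res (fscale c f + g) = fscale c (res f) + res g" for c f g
    by (auto simp: res_def fscale_def fun_eq_iff)
  have span: "res f \<in> F.span (res ` T)" if "f \<in> F.span (T \<union> vanishing Z)" for f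
    using that
  proof (induction rule: F.span_induct_alt)
    case base
    have "res 0 = 0" by (auto simp: res_def fun_eq_iff)
    show ?case unfolding \<open>res 0 = 0\<close> by (rule F.span_zero)
  next
    case (step c x y)
    have "res x \<in> F.span (res ` T)"
    proof (cases "x \<in> T")
      case False
      then have "res x = 0" using step by (auto simp: res_def vanishing_def fun_eq_iff)
      then show ?thesis by (simp add: F.span_zero)
    qed (auto intro: F.span_base)
    then show ?case unfolding res_lin using step by (intro F.span_add F.span_scale)
  qed
  let ?H = "\<lambda>a. res (G a)"
  have fam: "indep_family fscale E ?H"
    unfolding indep_family_def
  proof (intro allI impI ballI)
    fix c a assume c: "(\<Sum>a\<in>E. fscale (c a) (?H a)) = 0" and a: "a \<in> E"
    have "(\<Sum>a\<in>E. c a * G a z) = 0" if "z \<in> Z" for z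
      using fun_cong[OF c, of z] that by (simp add: fun_sum_apply fscale_def res_def)
    then show "c a = 0" using a by (rule indep)
  qed
  have inj: "inj_on ?H E" by (rule F.indep_family_inj_on[OF E fam])
  have "F.independent (?H ` E)" by (rule F.indep_family_independent[OF E fam])
  moreover have "?H ` E \<subseteq> F.span (res ` T)" using span G by auto
  ultimately have "card (?H ` E) \<le> card (res ` T)"
    using F.independent_span_bound[of "res ` T" "?H ` E"] T by auto
  also have "\<dots> \<le> card T" using T by (rule card_image_le)
  finally show ?thesis using card_image[OF inj] by simp
qed

text \<open>Functions that separate consecutive members of the chain have \<open>Suc M ^ k\<close>
  monomials with exponents at most \<open>M\<close>. These are independent on \<open>Zs k\<close>,
  but lie in a space whose dimension there grows at most like \<open>M ^ card X\<close>.\<close>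

lemma chain_length_le:
  assumes A: "function_algebra A"
    and Z: "\<And>i. i \<le> k \<Longrightarrow> integral_on A (Zs i)" "\<And>i. i < k \<Longrightarrow> Zs i \<subseteq> Zs (Suc i)"
    and f: "\<And>i. i < k \<Longrightarrow> \<exists>f\<in>A. f \<in> vanishing (Zs i) \<and> f \<notin> vanishing (Zs (Suc i))"
    and fin: "finite X"
    and y: "y1 ^ r \<in> F.filt_ideal (Zs k) X (insert y1 (insert y2 X)) r"
      "y2 ^ r \<in> F.filt_ideal (Zs k) X (insert y1 (insert y2 X)) r"
    and gen: "\<And>f. f \<in> A \<Longrightarrow> \<exists>d. f \<in> F.filt (Zs k) (insert y1 (insert y2 X)) d"
  shows "k \<le> card X"
proof (rule ccontr)
  assume "\<not> k \<le> card X"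
  then have k: "Suc (card X) \<le> k" by simp
  define C where "C = insert y1 (insert y2 X)"
  obtain f where f: "\<And>i. i < k \<Longrightarrow> f i \<in> A" "\<And>i. i < k \<Longrightarrow> f i \<in> vanishing (Zs i)"
    "\<And>i. i < k \<Longrightarrow> f i \<notin> vanishing (Zs (Suc i))" using assms(4) by metis
  have "\<exists>d. \<forall>i. i < k \<longrightarrow> f i \<in> F.filt (Zs k) C (d i)" using gen f(1) unfolding C_def by (intro choice) metis
  then obtain d where d: "\<And>i. i < k \<Longrightarrow> f i \<in> F.filt (Zs k) C (d i)" by blast
  define D where "D = (\<Sum>i<k. d i)"
  have D: "f i \<in> F.filt (Zs k) C D" if "i < k" for i
  proof -
    have "d i \<le> D" unfolding D_def using that by (intro member_le_sum) auto
    then show ?thesis using F.filt_mono[of "d i" D "Zs k" C] d[OF that] by blast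
  qed
  \<comment> \<open>With \<open>D\<close> a common degree bound of the \<open>f i\<close>, the
    dimension is at most \<open>(Suc (k * D) * Suc M) ^ card X * r ^ 2\<close>. Taking for
    \<open>M\<close> the factor in front of \<open>Suc M ^ card X\<close> turns this into
    \<open>M * Suc M ^ card X\<close>, which is below \<open>Suc M ^ Suc (card X)\<close>.\<close>
  define M where "M = Suc (k * D) ^ card X * r ^ 2"
  let ?E = "PiE {..<k} (\<lambda>_. {..M})"
  let ?T = "F.bounded_monoms X y1 y2 r (k * (M * D))"
  have "card ?E \<le> card ?T"
  proof (rule card_le_if_independent_on[where Z = "Zs k" and G = "\<lambda>a. \<Prod>i<k. f i ^ a i"])
    show "finite ?E" by (intro finite_PiE) auto
    show "finite ?T" using fin by (rule F.card_bounded_monoms)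
    fix a assume a: "a \<in> ?E"
    have "f i ^ a i \<in> F.filt (Zs k) C (M * D)" if "i < k" for i
    proof -
      have "a i * D \<le> M * D" using a that by (auto simp: PiE_iff)
      then show ?thesis using F.filt_power[OF D[OF that], of "a i"] F.filt_mono by blast
    qed
    then have "(\<Prod>i<k. f i ^ a i) \<in> F.filt (Zs k) C (k * (M * D))"
      using F.filt_prod[of "{..<k}" "\<lambda>i. f i ^ a i" "Zs k" C "M * D"] by simp
    then show "(\<Prod>i<k. f i ^ a i) \<in> F.span (?T \<union> vanishing (Zs k))"
      using F.filt_subset_span_bounded_monoms[OF fin y] unfolding C_def by blast
  next
    fix c a assume c: "\<And>z. z \<in> Zs k \<Longrightarrow> (\<Sum>a\<in>?E. c a * (\<Prod>i<k. f i ^ a i) z) = 0" and a: "a \<in> ?E"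
    show "c a = 0"
      using chain_algebraically_independent[where A = A and Zs = Zs and f = f and k = k and m = M and c = c,
          OF A Z f] c a
      by (auto simp: fun_prod_apply fun_power_apply)
  qed
  then have "Suc M ^ k \<le> card ?T" by (simp add: card_PiE)
  also have "\<dots> \<le> Suc (k * (M * D)) ^ card X * r ^ 2" by (rule F.card_bounded_monoms(2)[OF fin])
  also have "\<dots> \<le> (Suc (k * D) * Suc M) ^ card X * r ^ 2"
    by (intro mult_right_mono power_mono) simp_all
  also have "\<dots> = (Suc (k * D) ^ card X * r ^ 2) * Suc M ^ card X"
    by (simp only: power_mult_distrib mult_ac)
  also have "\<dots> = M * Suc M ^ card X" by (simp only: M_def[symmetric])
  also have "\<dots> < Suc M ^ Suc (card X)" by simp
  also have "\<dots> \<le> Suc M ^ k" by (rule power_increasing[OF k]) simp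
  finally show False by simp
qed

subsection \<open>Jordan strings of a nilpotent matrix\<close>

context finite_dimensional_vector_space
begin

text \<open>A pair \<open>(w, d)\<close> stands for the string \<open>w, f w, \<dots>, f ^ d w\<close>. The strings of \<open>f ` V\<close> are lengthened
  by preimages of their first vectors, and their last vectors are completed to a basis of the
  kernel by strings of length one.\<close>

lemma exists_jordan_strings:
  assumes f: "Vector_Spaces.linear scale scale f"
    and "subspace V" "f ` V \<subseteq> V" "\<forall>v\<in>V. (f ^^ m) v = 0"
  shows "\<exists>S. finite S \<and> (\<forall>(w, d)\<in>S. w \<in> V \<and> (f ^^ Suc d) w = 0) \<and>
    indep_family scale (SIGMA p:S. {..snd p}) (\<lambda>(p, s). (f ^^ s) (fst p)) \<and>
    V \<subseteq> span ((\<lambda>(p, s). (f ^^ s) (fst p)) ` (SIGMA p:S. {..snd p}))"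
  using assms(2-)
proof (induction m arbitrary: V)
  case 0
  then show ?case by (intro exI[of _ "{}"]) (auto simp: indep_family_def)
next
  case (Suc m)
  interpret P: finite_dimensional_vector_space_pair scale Basis scale Basis ..
  interpret f: Vector_Spaces.linear scale scale f by fact
  define G where "G = (\<lambda>(p :: 'b \<times> nat, s). (f ^^ s) (fst p))"
  define I where "I S = (SIGMA p:S. {..snd p})" for S :: "('b \<times> nat) set"
  have fpow_V: "(f ^^ s) v \<in> V" if "v \<in> V" for s v
    using that Suc.prems(2) by (induction s) auto
  have fW: "f ` f ` V \<subseteq> f ` V" using Suc.prems(2) by blast
  have "\<forall>v\<in>f ` V. (f ^^ m) v = 0"
    using Suc.prems(3) by (auto simp: funpow_swap1)
  from Suc.IH[OF f.subspace_image[OF Suc.prems(1)] fW this, folded I_def G_def] obtain S where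
    S: "finite S" "\<forall>(w, d)\<in>S. w \<in> f ` V \<and> (f ^^ Suc d) w = 0"
      "indep_family scale (I S) G" "f ` V \<subseteq> span (G ` I S)"
    by (elim exE conjE)
  have Sd: "w \<in> f ` V \<and> (f ^^ Suc d) w = 0" if "(w, d) \<in> S" for w d
    using S(2) that by blast
  have finI: "finite (I S)" if "finite S" for S using that by (auto simp: I_def)
  have sumI: "(\<Sum>x\<in>I S. F x) = (\<Sum>p\<in>S. \<Sum>s\<le>snd p. F (p, s))" if "finite S" for S and F :: "_ \<Rightarrow> 'b"
    unfolding I_def using that by (simp add: sum.Sigma)
  have "\<exists>v. v \<in> V \<and> f v = u" if "u \<in> f ` V" for u using that by blast
  then obtain g where g: "\<And>u. u \<in> f ` V \<Longrightarrow> g u \<in> V \<and> f (g u) = u" by metis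
  define \<phi> where "\<phi> = (\<lambda>(u, d). (g u, Suc d))"
  have inj\<phi>: "inj_on \<phi> S"
  proof (rule inj_onI, clarify)
    fix u d u' d' assume *: "(u, d) \<in> S" "(u', d') \<in> S" "\<phi> (u, d) = \<phi> (u', d')"
    then have "f (g u) = f (g u')" "d = d'" by (simp_all add: \<phi>_def)
    then show "u = u' \<and> d = d'" using g[of u] g[of u'] Sd * by metis
  qed
  define h where "h = (\<lambda>p :: 'b \<times> nat. (f ^^ snd p) (fst p))"
  have h_indep: "indep_family scale S h"
  proof -
    have "bij_betw (\<lambda>p. (p, snd p)) S ((\<lambda>p. (p, snd p)) ` S)" by (auto simp: bij_betw_def inj_on_def)
    moreover have "(\<lambda>p. (p, snd p)) ` S \<subseteq> I S" by (auto simp: I_def)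
    ultimately have "indep_family scale S (\<lambda>p. G (p, snd p))"
      using indep_family_reindex[OF _ indep_family_subset[OF finI[OF S(1)] S(3)]] by blast
    then show ?thesis by (simp add: G_def h_def)
  qed
  let ?K = "{v \<in> V. f v = 0}"
  have K: "subspace ?K" using Suc.prems(1) by (auto simp: subspace_def f.add f.scale)
  have hK: "h ` S \<subseteq> ?K"
  proof
    fix x assume "x \<in> h ` S"
    then obtain u d where u: "(u, d) \<in> S" "x = (f ^^ d) u" by (auto simp: h_def)
    then show "x \<in> ?K" using Sd[OF u(1)] fpow_V[of u d] Suc.prems(2) by auto
  qed
  obtain B where B: "h ` S \<subseteq> B" "B \<subseteq> ?K" "independent B" "?K \<subseteq> span B"
    by (rule maximal_independent_subset_extend[OF hK indep_family_independent[OF S(1) h_indep]])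
  have finB: "finite B" by (rule finiteI_independent[OF B(3)])
  define Z where "Z = B - h ` S"
  define S' where "S' = \<phi> ` S \<union> (\<lambda>z. (z, 0)) ` Z"
  have finS': "finite S'" using S(1) finB by (simp add: S'_def Z_def)
  have disj: "\<phi> ` S \<inter> (\<lambda>z. (z, 0)) ` Z = {}" by (auto simp: \<phi>_def)
  have fpow_g: "(f ^^ Suc s) (g u) = (f ^^ s) u" if "(u, d) \<in> S" for u d s
    using g[of u] Sd[OF that] by (simp add: funpow_swap1)
  have strings: "w \<in> V \<and> (f ^^ Suc d) w = 0" if wd: "(w, d) \<in> S'" for w d
  proof -
    consider u d' where "(u, d') \<in> S" "w = g u" "d = Suc d'" | "w \<in> Z" "d = 0"
      using wd by (auto simp: S'_def \<phi>_def)
    then show ?thesis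
    proof cases
      case (1 u d')
      then show ?thesis using g[of u] Sd[OF 1(1)] fpow_g[OF 1(1), of "Suc d'"] by simp
    next
      case 2
      then show ?thesis using B(2) by (auto simp: Z_def)
    qed
  qed
  have indep: "indep_family scale (I S') G"
    unfolding indep_family_def
  proof (intro allI impI)
    fix c assume c: "(\<Sum>i\<in>I S'. scale (c i) (G i)) = 0"
    \<comment> \<open>\<open>T\<close> collects the last vectors of all strings, which lie in the
      kernel, and \<open>A\<close> the other vectors. Applying \<open>f\<close> kills
      \<open>T\<close> and turns \<open>A\<close> into a combination of the old strings, so the
      coefficients in \<open>A\<close> vanish; what remains is a relation in the basis
      \<open>B\<close> of the kernel.\<close>
    define A where "A = (\<Sum>p\<in>S. \<Sum>s\<le>snd p. scale (c (\<phi> p, s)) ((f ^^ s) (g (fst p))))"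
    define T where "T = (\<Sum>p\<in>S. scale (c (\<phi> p, Suc (snd p))) (h p)) + (\<Sum>z\<in>Z. scale (c ((z, 0), 0)) z)"
    have "(\<Sum>s\<le>snd (\<phi> p). scale (c (\<phi> p, s)) (G (\<phi> p, s))) =
        (\<Sum>s\<le>snd p. scale (c (\<phi> p, s)) ((f ^^ s) (g (fst p)))) + scale (c (\<phi> p, Suc (snd p))) (h p)"
      if "p \<in> S" for p
    proof -
      obtain u d where p: "p = (u, d)" by (cases p)
      show ?thesis using fpow_g[of u d d] that unfolding p by (simp add: \<phi>_def G_def h_def)
    qed
    then have "(\<Sum>p\<in>\<phi> ` S. \<Sum>s\<le>snd p. scale (c (p, s)) (G (p, s))) =
        A + (\<Sum>p\<in>S. scale (c (\<phi> p, Suc (snd p))) (h p))"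
      by (simp add: sum.reindex[OF inj\<phi>] A_def sum.distrib)
    moreover have "(\<Sum>p\<in>(\<lambda>z. (z, 0)) ` Z. \<Sum>s\<le>snd p. scale (c (p, s)) (G (p, s))) = (\<Sum>z\<in>Z. scale (c ((z, 0), 0)) z)"
      by (subst sum.reindex) (auto simp: inj_on_def G_def)
    moreover have "(\<Sum>i\<in>I S'. scale (c i) (G i)) =
      (\<Sum>p\<in>\<phi> ` S. \<Sum>s\<le>snd p. scale (c (p, s)) (G (p, s))) +
      (\<Sum>p\<in>(\<lambda>z. (z, 0)) ` Z. \<Sum>s\<le>snd p. scale (c (p, s)) (G (p, s)))"
      unfolding sumI[OF finS'] unfolding S'_def
      using S(1) finB disj by (intro sum.union_disjoint) (auto simp: Z_def)
    ultimately have AT: "A + T = 0" using c by (simp add: T_def add.assoc)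
    have "T \<in> span B" unfolding T_def
      using B(1) by (intro span_add span_sum span_scale span_base) (auto simp: Z_def)
    also have "span B \<subseteq> ?K" by (rule span_minimal[OF B(2) K])
    finally have "f T = 0" by simp
    then have "f A = 0" using arg_cong[OF AT, of f] by (simp add: f.add f.zero)
    moreover have "f A = (\<Sum>i\<in>I S. scale (c (\<phi> (fst i), snd i)) (G i))"
      unfolding sumI[OF S(1)] A_def f.sum
    proof (intro sum.cong refl)
      fix p s assume "p \<in> S"
      then obtain u d where p: "p = (u, d)" "(u, d) \<in> S" by (cases p) auto
      show "f (scale (c (\<phi> p, s)) ((f ^^ s) (g (fst p)))) = scale (c (\<phi> (fst (p, s)), snd (p, s))) (G (p, s))"
        using fpow_g[OF p(2), of s] by (simp add: f.scale G_def p(1))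
    qed
    ultimately have c0: "c (\<phi> p, s) = 0" if "p \<in> S" "s \<le> snd p" for p s
      using indep_familyD[OF S(3), of "\<lambda>i. c (\<phi> (fst i), snd i)" "(p, s)"] that by (auto simp: I_def)
    then have "A = 0" unfolding A_def by (intro sum.neutral ballI) simp
    then have T0: "T = 0" using AT by simp
    have inj_h: "inj_on h S" by (rule indep_family_inj_on[OF S(1) h_indep])
    define b where "b x = (if x \<in> Z then c ((x, 0), 0) else
      c (\<phi> (inv_into S h x), Suc (snd (inv_into S h x))))" for x
    have bh: "b (h p) = c (\<phi> p, Suc (snd p))" if "p \<in> S" for p
      using that inj_h by (simp add: b_def Z_def)
    have "(\<Sum>x\<in>B. scale (b x) x) = (\<Sum>x\<in>h ` S. scale (b x) x) + (\<Sum>z\<in>Z. scale (b z) z)"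
      unfolding Z_def by (subst add.commute) (rule sum.subset_diff[OF B(1) finB])
    also have "\<dots> = T" unfolding T_def sum.reindex[OF inj_h] using bh by (simp add: b_def)
    finally have "(\<Sum>x\<in>B. scale (b x) x) = 0" using T0 by simp
    then have b0: "\<forall>x\<in>B. b x = 0"
      using B(3) unfolding dependent_finite[OF finB] by blast
    then have cZ: "c ((z, 0), 0) = 0" if "z \<in> Z" for z
    proof -
      have "z \<in> B" using that by (simp add: Z_def)
      then show ?thesis using bspec[OF b0, of z] that by (simp add: b_def)
    qed
    have cT: "c (\<phi> p, Suc (snd p)) = 0" if "p \<in> S" for p 
    proof -
      have "h p \<in> B" using that B(1) by blast
      then show ?thesis using bspec[OF b0, of "h p"] bh[OF that] by simp
    qed
    show "\<forall>i\<in>I S'. c i = 0"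
    proof
      fix i assume "i \<in> I S'"
      then consider p s where "i = (\<phi> p, s)" "p \<in> S" "s \<le> Suc (snd p)" | z where "i = ((z, 0), 0)" "z \<in> Z"
        by (auto simp: I_def S'_def \<phi>_def)
      then show "c i = 0"
      proof cases
        case (1 p s)
        then show ?thesis using c0[of p s] cT[of p] by (cases "s = Suc (snd p)") auto
      qed (use cZ in simp)
    qed
  qed
  have GI: "(f ^^ s) w \<in> G ` I S'" if "(w, d) \<in> S'" "s \<le> d" for w d s
    using that by (intro image_eqI[of _ _ "((w, d), s)"]) (auto simp: G_def I_def)
  have \<phi>S': "(g u, Suc d) \<in> S'" if "(u, d) \<in> S" for u d
    using that unfolding S'_def by (intro UnI1 image_eqI[of _ _ "(u, d)"]) (auto simp: \<phi>_def)
  have "V \<subseteq> span (G ` I S')"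
  proof
    fix v assume v: "v \<in> V"
    have "B \<subseteq> span (G ` I S')"
    proof
      fix x assume "x \<in> B"
      then consider p where "p \<in> S" "x = h p" | "x \<in> Z" unfolding Z_def by blast
      then show "x \<in> span (G ` I S')"
      proof cases
        case (1 p)
        obtain u d where p: "p = (u, d)" "(u, d) \<in> S" using 1(1) by (cases p) auto
        then show ?thesis using GI[OF \<phi>S'[OF p(2)], of "Suc d"] fpow_g[OF p(2), of d] 1(2)
          by (intro span_base) (simp add: h_def)
      next
        case 2
        then have "(x, 0) \<in> S'" by (auto simp: S'_def)
        then show ?thesis using GI[of x 0 0] by (intro span_base) simp
      qed
    qed
    then have KB: "?K \<subseteq> span (G ` I S')" using B(4) span_minimal[OF _ subspace_span, of B] by blast
    \<comment> \<open>Each vector of the old strings has a preimage in the lengthened ones, so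
      \<open>v\<close> differs from a vector of their span by a kernel element, and \<open>B\<close>
      spans the kernel.\<close>
    have "f v \<in> f ` (span (G ` I S') \<inter> V)"
    proof -
      have "f v \<in> span (G ` I S)" using S(4) v by blast
      also have "span (G ` I S) \<subseteq> f ` (span (G ` I S') \<inter> V)"
      proof (rule span_minimal)
        show "subspace (f ` (span (G ` I S') \<inter> V))"
          by (intro f.subspace_image subspace_inter subspace_span Suc.prems(1))
        show "G ` I S \<subseteq> f ` (span (G ` I S') \<inter> V)"
        proof
          fix x assume "x \<in> G ` I S"
          then obtain u d s where u: "(u, d) \<in> S" "s \<le> d" "x = (f ^^ s) u" by (auto simp: G_def I_def)
          have "x = f ((f ^^ s) (g u))" using fpow_g[OF u(1), of s] u(3) by simp
          moreover have "(f ^^ s) (g u) \<in> span (G ` I S')"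
            using GI[OF \<phi>S'[OF u(1)], of s] u(2) by (intro span_base) simp
          moreover have "(f ^^ s) (g u) \<in> V" using fpow_V[of "g u" s] g[of u] Sd[OF u(1)] by simp
          ultimately show "x \<in> f ` (span (G ` I S') \<inter> V)" by blast
        qed
      qed
      finally show ?thesis .
    qed
    then obtain a where a: "f v = f a" "a \<in> span (G ` I S')" "a \<in> V" by blast
    then have "v - a \<in> ?K" using v Suc.prems(1) by (simp add: f.diff subspace_diff)
    then have "(v - a) + a \<in> span (G ` I S')" using KB a(2) span_add by blast
    then show "v \<in> span (G ` I S')" by simp
  qed
  then show ?case using finS' strings indep unfolding I_def G_def by (intro exI[of _ S']) blast
qed

end

interpretation VK: vector_space_pair "(*s) :: 'k::field \<Rightarrow> 'k^'n \<Rightarrow> 'k^'n" "(*) :: 'k \<Rightarrow> 'k \<Rightarrow> 'k" ..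

lemma matpow_vector_mult: "matpow e m *v v = ((*v) e ^^ m) v"
proof (induction m)
  case (Suc m)
  have "matpow e (Suc m) = e ** matpow e m" by (simp add: matpow_def)
  then show ?case using Suc by (simp add: matrix_vector_mul_assoc[symmetric])
qed (simp add: matpow_def)

text \<open>The strings are numbered by decreasing length: this makes string 0 the longest and keeps
  the columns of the minors inside the index set of the centraliser. The functionals
  \<open>crd i s\<close> are the dual basis.\<close>

lemma nilpotent_jordan_basis:
  fixes e :: "'k::field^'n^'n"
  assumes "nilpotent_mat e"
  obtains k :: nat and d :: "nat \<Rightarrow> nat" and w :: "nat \<Rightarrow> 'k^'n" and crd :: "nat \<Rightarrow> nat \<Rightarrow> 'k^'n \<Rightarrow> 'k"
  where
    "\<And>i j. i \<le> j \<Longrightarrow> j < k \<Longrightarrow> d j \<le> d i"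
    "\<And>i. i < k \<Longrightarrow> ((*v) e ^^ Suc (d i)) (w i) = 0"
    "\<And>i s. Vector_Spaces.linear (*s) (*) (crd i s)"
    "\<And>i j s t. i < k \<Longrightarrow> j < k \<Longrightarrow> s \<le> d i \<Longrightarrow> t \<le> d j \<Longrightarrow>
      crd i s (((*v) e ^^ t) (w j)) = (if i = j \<and> s = t then 1 else 0)"
    "\<And>v. v = (\<Sum>i<k. \<Sum>s\<le>d i. crd i s v *s ((*v) e ^^ s) (w i))"
    "(\<Sum>i<k. Suc (d i)) = CARD('n)"
proof -
  let ?f = "(*v) e"
  obtain m where "matpow e m = 0" using assms by (auto simp: nilpotent_mat_def)
  then have "\<forall>v\<in>UNIV. (?f ^^ m) v = 0" using matpow_vector_mult[of e m] by simp
  from vec.exists_jordan_strings[OF matrix_vector_mul_linear_gen vec.subspace_UNIV subset_UNIV this]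
  obtain S where S: "finite S" "\<forall>(w, d)\<in>S. w \<in> UNIV \<and> (?f ^^ Suc d) w = 0"
    "indep_family (*s) (SIGMA p:S. {..snd p}) (\<lambda>(p, s). (?f ^^ s) (fst p))"
    "UNIV \<subseteq> vec.span ((\<lambda>(p, s). (?f ^^ s) (fst p)) ` (SIGMA p:S. {..snd p}))"
    by (elim exE conjE)
  obtain xs0 where xs0: "set xs0 = S" "distinct xs0" using finite_distinct_list[OF S(1)] by blast
  define xs where "xs = rev (sort_key snd xs0)"
  have xs: "set xs = S" "distinct xs" using xs0 by (simp_all add: xs_def)
  define k where "k = length xs"
  define d where "d i = snd (xs ! i)" for i
  define w where "w i = fst (xs ! i)" for i
  have xs_in: "xs ! i \<in> S" if "i < k" for i using that xs(1) by (auto simp: k_def)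
  have desc: "d j \<le> d i" if "i \<le> j" "j < k" for i j
  proof -
    have "sorted (map snd (sort_key snd xs0))" by simp
    then have "sorted (rev (map snd xs))" by (simp add: xs_def rev_map)
    then have "map snd xs ! j \<le> map snd xs ! i"
      using that by (intro sorted_rev_nth_mono) (auto simp: k_def)
    then show ?thesis using that by (simp add: d_def k_def)
  qed
  have kill: "(?f ^^ Suc (d i)) (w i) = 0" if "i < k" for i
    using bspec[OF S(2) xs_in[OF that]] by (simp add: w_def d_def case_prod_beta)
  define I where "I = (SIGMA i:{..<k}. {..d i})"
  define G where "G = (\<lambda>(i, s). (?f ^^ s) (w i))"
  have finI: "finite I" by (simp add: I_def)
  have bij: "bij_betw (\<lambda>(i, s). (xs ! i, s)) I (SIGMA p:S. {..snd p})"
  proof (rule bij_betwI')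
    fix x y assume "x \<in> I" "y \<in> I"
    then show "((case x of (i, s) \<Rightarrow> (xs ! i, s)) = (case y of (i, s) \<Rightarrow> (xs ! i, s))) = (x = y)"
      using nth_eq_iff_index_eq[OF xs(2)] by (auto simp: I_def k_def)
  next
    fix x assume "x \<in> I"
    then show "(case x of (i, s) \<Rightarrow> (xs ! i, s)) \<in> (SIGMA p:S. {..snd p})"
      using xs_in by (auto simp: I_def d_def)
  next
    fix y assume y: "y \<in> (SIGMA p:S. {..snd p})"
    then obtain p s where ps: "y = (p, s)" "p \<in> S" "s \<le> snd p" by auto
    then obtain i where "i < k" "xs ! i = p" using xs(1) by (auto simp: k_def in_set_conv_nth)
    then show "\<exists>x\<in>I. y = (case x of (i, s) \<Rightarrow> (xs ! i, s))"
      using ps by (intro bexI[of _ "(i, s)"]) (auto simp: I_def d_def)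
  qed
  have G_eq: "G = (\<lambda>x. (\<lambda>(p, s). (?f ^^ s) (fst p)) (case x of (i, s) \<Rightarrow> (xs ! i, s)))"
    by (auto simp: G_def w_def fun_eq_iff)
  have indep: "indep_family (*s) I G"
    unfolding G_eq by (rule vec.indep_family_reindex[OF bij S(3)])
  have "G ` I = (\<lambda>(p, s). (?f ^^ s) (fst p)) ` (SIGMA p:S. {..snd p})"
    unfolding bij_betw_imp_surj_on[OF bij, symmetric] image_image G_eq ..
  then have span: "v \<in> vec.span (G ` I)" for v using S(4) by (simp only: subsetD[OF S(4) UNIV_I])
  have inj: "inj_on G I" and ind: "vec.independent (G ` I)"
    using vec.indep_family_inj_on[OF finI indep] vec.indep_family_independent[OF finI indep] .
  have "\<exists>c. Vector_Spaces.linear (*s) (*) c \<and> (\<forall>x\<in>G ` I. c x = (if x = G p then 1 else 0))" for p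
    by (rule VK.linear_independent_extend[OF ind])
  then have "\<exists>c. \<forall>p. Vector_Spaces.linear (*s) (*) (c p) \<and> (\<forall>x\<in>G ` I. c p x = (if x = G p then 1 else 0))"
    by (intro choice allI)
  then obtain c where c0: "\<forall>p. Vector_Spaces.linear (*s) (*) (c p) \<and> (\<forall>x\<in>G ` I. c p x = (if x = G p then 1 else 0))" ..
  have c: "Vector_Spaces.linear (*s) (*) (c p)"
    "x \<in> G ` I \<Longrightarrow> c p x = (if x = G p then 1 else 0)" for p x
    using spec[OF c0, of p] by blast+
  define crd where "crd i s = c (i, s)" for i s
  have dual: "crd i s ((?f ^^ t) (w j)) = (if i = j \<and> s = t then 1 else 0)"
    if "i < k" "j < k" "s \<le> d i" "t \<le> d j" for i j s t
  proof -
    have p: "(i, s) \<in> I" "(j, t) \<in> I" using that by (auto simp: I_def)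
    have "crd i s (G (j, t)) = (if G (j, t) = G (i, s) then 1 else 0)"
      unfolding crd_def using c(2)[of "G (j, t)" "(i, s)"] p by blast
    also have "\<dots> = (if i = j \<and> s = t then 1 else 0)"
      using inj_on_eq_iff[OF inj p(2) p(1)] by auto
    finally show ?thesis by (simp add: G_def)
  qed
  have expand: "v = (\<Sum>i<k. \<Sum>s\<le>d i. crd i s v *s (?f ^^ s) (w i))" for v
    using span[of v]
  proof (induction rule: vec.span_induct_alt)
    case base
    show ?case using c(1)[THEN VK.linear_0] by (simp add: crd_def)
  next
    case (step a x y)
    obtain j t where jt: "x = G (j, t)" "j < k" "t \<le> d j" using step(1) by (auto simp: I_def)
    have "crd i s (a *s x + y) *s (?f ^^ s) (w i) =
       (if i = j \<and> s = t then a *s x else 0) + crd i s y *s (?f ^^ s) (w i)" if "i < k" "s \<le> d i" for i s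
    proof -
      have "crd i s (a *s x + y) = a * crd i s x + crd i s y"
        using VK.linear_add[OF c(1)] VK.linear_scale[OF c(1)] by (simp add: crd_def)
      then show ?thesis using dual[OF that(1) jt(2) that(2) jt(3)] jt(1) by (auto simp: G_def vec.scale_left_distrib)
    qed
    then have "(\<Sum>i<k. \<Sum>s\<le>d i. crd i s (a *s x + y) *s (?f ^^ s) (w i)) =
      (\<Sum>i<k. \<Sum>s\<le>d i. (if i = j \<and> s = t then a *s x else 0)) + (\<Sum>i<k. \<Sum>s\<le>d i. crd i s y *s (?f ^^ s) (w i))"
      by (simp add: sum.distrib)
    also have "(\<Sum>i<k. \<Sum>s\<le>d i. (if i = j \<and> s = t then a *s x else 0)) = (\<Sum>i<k. if i = j then a *s x else 0)"
    proof (intro sum.cong refl)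
      fix i show "(\<Sum>s\<le>d i. if i = j \<and> s = t then a *s x else 0) = (if i = j then a *s x else 0)"
        using jt(3) by (cases "i = j") auto
    qed
    also have "\<dots> = a *s x" using jt(2) by simp
    finally show ?case using step(2) by simp
  qed
  have "card I = vec.dim (UNIV :: ('k^'n) set)"
    using vec.dim_span_eq_card_independent[OF ind] card_image[OF inj] span by (metis UNIV_eq_I)
  then have "card I = CARD('n)" by (simp only: vec_dim_card)
  then have cnt: "(\<Sum>i<k. Suc (d i)) = CARD('n)" by (simp add: I_def)
  have lin: "Vector_Spaces.linear (*s) (*) (crd i s)" for i s by (simp only: crd_def c(1))
  show thesis by (rule that[OF desc kill lin dual expand cnt])
qed

subsection \<open>Matrices as a vector space\<close>

lemma mscale_nth [simp]: "mscale c A $ i $ j = c * A $ i $ j"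
  by (simp add: mscale_def)

definition munit :: "'n \<Rightarrow> 'n \<Rightarrow> 'k::field^'n^'n" where
  "munit a b = (\<chi> i j. if i = a \<and> j = b then 1 else 0)"

interpretation M: vector_space mscale
  by unfold_locales (auto simp: Finite_Cartesian_Product.vec_eq_iff algebra_simps)

lemma inj_munit: "inj (\<lambda>(i, j). munit i j :: 'k::field^'n^'n)"
proof (rule injI, clarify)
  fix a b c d :: 'n assume "munit a b = (munit c d :: 'k^'n^'n)"
  then have "(munit a b :: 'k^'n^'n) $ a $ b = munit c d $ a $ b" by simp
  then show "a = c \<and> b = d" by (simp add: munit_def split: if_splits)
qed

lemma sum_munit_nth:
  fixes c :: "'n::finite \<times> 'n \<Rightarrow> 'k::field"
  shows "(\<Sum>p\<in>R. mscale (c p) (case p of (a, b) \<Rightarrow> munit a b)) $ i $ j = (if (i, j) \<in> R then c (i, j) else 0)"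
proof -
  have "(\<Sum>p\<in>R. mscale (c p) (case p of (a, b) \<Rightarrow> munit a b)) $ i $ j = (\<Sum>p\<in>R. if p = (i, j) then c p else 0)"
    unfolding sum_component by (intro sum.cong) (auto simp: munit_def split: if_splits)
  then show ?thesis by simp
qed

text \<open>Stated for an arbitrary set \<open>R\<close> of positions: all positions give the
  finite-dimensional structure, and other choices give the dimensions of the triangular and strictly
  triangular matrices.\<close>

lemma munit_basis:
  fixes R :: "('n::finite \<times> 'n) set"
  defines "B \<equiv> (\<lambda>(i, j). munit i j :: 'k::field^'n^'n) ` R"
  shows "M.independent B" "M.span B = {A. \<forall>i j. (i, j) \<notin> R \<longrightarrow> A $ i $ j = 0}"
proof -
  show "M.independent B" unfolding B_def
  proof (rule M.independent_if_scalars_zero)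
    fix f :: "'k^'n^'n \<Rightarrow> 'k" and x :: "'k^'n^'n"
    assume f: "(\<Sum>x\<in>(\<lambda>(i, j). munit i j) ` R. mscale (f x) x) = 0" and x: "x \<in> (\<lambda>(i, j). munit i j) ` R"
    obtain a b where ab: "(a, b) \<in> R" "x = munit a b" using x by auto
    have "(\<Sum>x\<in>(\<lambda>(i, j). munit i j) ` R. mscale (f x) x) $ a $ b =
      (\<Sum>p\<in>R. mscale (f (case p of (a, b) \<Rightarrow> munit a b)) (case p of (a, b) \<Rightarrow> munit a b)) $ a $ b"
      by (subst sum.reindex[OF inj_on_subset[OF inj_munit]]) auto
    also have "\<dots> = f x" using ab by (subst sum_munit_nth) simp
    finally show "f x = 0" using f by simp
  qed simp
  show "M.span B = {A. \<forall>i j. (i, j) \<notin> R \<longrightarrow> A $ i $ j = 0}" (is "_ = ?V")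
  proof
    show "M.span B \<subseteq> ?V"
      by (rule M.span_minimal) (auto simp: B_def munit_def M.subspace_def)
    show "?V \<subseteq> M.span B"
    proof
      fix A :: "'k^'n^'n" assume A: "A \<in> ?V"
      have "A = (\<Sum>p\<in>R. mscale (case p of (a, b) \<Rightarrow> A $ a $ b) (case p of (a, b) \<Rightarrow> munit a b))"
        unfolding Finite_Cartesian_Product.vec_eq_iff sum_munit_nth using A by auto
      moreover have "\<dots> \<in> M.span B"
        by (intro M.span_sum M.span_scale M.span_base) (auto simp: B_def)
      ultimately show "A \<in> M.span B" by simp
    qed
  qed
qed

interpretation M: finite_dimensional_vector_space mscale "range (\<lambda>(i, j). munit i j :: 'k::field^'n^'n)"
  using munit_basis[of UNIV] by unfold_locales auto

interpretation MM: finite_dimensional_vector_space_pair mscale "range (\<lambda>(i, j). munit i j :: 'k::field^'n^'n)"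
  mscale "range (\<lambda>(i, j). munit i j :: 'k::field^'n^'n)" ..

interpretation MK: vector_space_pair mscale "(*) :: 'k::field \<Rightarrow> 'k \<Rightarrow> 'k" ..

lemma dim_entries:
  "M.dim {A :: 'k::field^'n^'n. \<forall>i j. (i, j) \<notin> R \<longrightarrow> A $ i $ j = 0} = card R"
proof -
  have "M.dim {A :: 'k^'n^'n. \<forall>i j. (i, j) \<notin> R \<longrightarrow> A $ i $ j = 0} = card ((\<lambda>(i, j). munit i j :: 'k^'n^'n) ` R)"
    using munit_basis[where 'k = 'k and R = R] M.dim_span_eq_card_independent by metis
  also have "\<dots> = card R" by (intro card_image inj_on_subset[OF inj_munit]) simp
  finally show ?thesis .
qed

lemma mscale_matrix_mult: "mscale c A ** B = mscale c (A ** B)" "A ** mscale c B = mscale c (A ** B)"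
  for A B :: "'k::field^'n^'n"
  by (simp_all add: Finite_Cartesian_Product.vec_eq_iff matrix_matrix_mult_def sum_distrib_left mult_ac)

lemma matrix_add_distrib_right: "(A + B) ** C = A ** C + B ** C" for A :: "'k::field^'n^'n"
  by (simp add: Finite_Cartesian_Product.vec_eq_iff matrix_matrix_mult_def sum.distrib distrib_right)

lemma linear_mult_left: "Vector_Spaces.linear mscale mscale (\<lambda>x. A ** x)" for A :: "'k::field^'n^'n"
  by (simp add: Vector_Spaces.linear_iff M.vector_space_axioms mscale_matrix_mult matrix_add_ldistrib)

lemma linear_mult_right: "Vector_Spaces.linear mscale mscale (\<lambda>x. x ** A)" for A :: "'k::field^'n^'n"
  by (simp add: Vector_Spaces.linear_iff M.vector_space_axioms mscale_matrix_mult matrix_add_distrib_right)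

lemma matrix_diff_ldistrib: "A ** (B - C) = A ** B - A ** C" for A :: "'k::field^'n^'n"
  by (simp add: Finite_Cartesian_Product.vec_eq_iff matrix_matrix_mult_def sum_subtractf right_diff_distrib)

lemma matrix_diff_rdistrib: "(A - B) ** C = A ** C - B ** C" for A :: "'k::field^'n^'n"
  by (simp add: Finite_Cartesian_Product.vec_eq_iff matrix_matrix_mult_def sum_subtractf left_diff_distrib)

lemma linear_lie_bracket: "Vector_Spaces.linear mscale mscale (\<lambda>x. lie_bracket x A)"
  unfolding lie_bracket_def
  by (intro MM.linear_compose_sub linear_mult_left linear_mult_right)

subsection \<open>Centralisers have dimension at least n\<close>

text \<open>The vector \<open>p(B) w\<close>, evaluated by Horner's scheme so that it follows the
  recursion of \<open>pCons\<close>.\<close>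

definition poly_act :: "'k::field^'n^'n \<Rightarrow> 'k poly \<Rightarrow> 'k^'n \<Rightarrow> 'k^'n" where
  "poly_act B p w = fold_coeffs (\<lambda>a v. a *s w + B *v v) p 0"

lemma poly_act_0 [simp]: "poly_act B 0 w = 0"
  by (simp add: poly_act_def)

lemma poly_act_pCons [simp]: "poly_act B (pCons a p) w = a *s w + B *v poly_act B p w"
  by (cases "p = 0 \<and> a = 0") (auto simp: poly_act_def)

lemma poly_act_add: "poly_act B (p + q) w = poly_act B p w + poly_act B q w"
  by (induction p q rule: poly_induct2) (simp_all add: vec.add vec.scale_left_distrib)

lemma poly_act_smult: "poly_act B (smult c p) w = c *s poly_act B p w"
  by (induction p) (simp_all add: vec.scale vec.scale_right_distrib)

lemma poly_act_linear_factor: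
  "poly_act B ([:- c, 1:] * q) w = B *v poly_act B q w - c *s poly_act B q w"
proof -
  have "[:- c, 1:] * q = pCons 0 q + smult (- c) q" by simp
  then show ?thesis by (simp only: poly_act_add poly_act_smult poly_act_pCons) simp
qed

lemma poly_act_monom: "poly_act B (monom c i) w = c *s ((*v) B ^^ i) w"
  by (induction i) (simp_all add: monom_Suc monom_0 vec.scale)

lemma poly_act_sum: "poly_act B (\<Sum>i\<in>I. p i) w = (\<Sum>i\<in>I. poly_act B (p i) w)"
  by (induction I rule: infinite_finite_induct) (simp_all add: poly_act_add)

lemma exists_annihilating_poly:
  fixes B :: "'k::field^'n^'n"
  shows "\<exists>p. p \<noteq> 0 \<and> poly_act B p w = 0"
proof -
  obtain c where c: "\<exists>a\<in>{..CARD('n)}. c a \<noteq> 0" "(\<Sum>a\<le>CARD('n). c a *s ((*v) B ^^ a) w) = 0"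
  proof -
    have "vec.dimension TYPE('k) TYPE('n) < card {..CARD('n)}"
      by (simp add: vec.dimension_def card_cart_basis)
    from vec.exists_nontrivial_relation[OF _ this, of "\<lambda>a. ((*v) B ^^ a) w"] show ?thesis
      using that by auto
  qed
  let ?p = "\<Sum>a\<le>CARD('n). monom (c a) a"
  have "coeff ?p a = c a" if "a \<le> CARD('n)" for a
    using that by (simp add: coeff_sum)
  then have "?p \<noteq> 0" using c(1) by (metis atMost_iff coeff_0)
  moreover have "poly_act B ?p w = 0" using c(2) by (simp add: poly_act_sum poly_act_monom)
  ultimately show ?thesis by blast
qed

text \<open>A root of the monic polynomial of least degree that moves a vector outside \<open>V\<close> into \<open>V\<close>
  gives an eigenvector modulo \<open>V\<close>.\<close>

lemma exists_eigenvector_mod_subspace: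
  fixes B :: "'k::alg_closed_field^'n^'n"
  assumes V: "vec.subspace V" "V \<noteq> UNIV"
  obtains u c where "u \<notin> V" "B *v u - c *s u \<in> V"
proof -
  obtain w where w: "w \<notin> V" using V(2) by blast
  obtain p0 where "p0 \<noteq> 0" "poly_act B p0 w \<in> V"
    using exists_annihilating_poly[of B w] vec.subspace_0[OF V(1)] by metis
  then obtain p where p: "p \<noteq> 0 \<and> poly_act B p w \<in> V"
    and min: "\<And>q. q \<noteq> 0 \<and> poly_act B q w \<in> V \<Longrightarrow> degree p \<le> degree q"
    using ex_has_least_nat[of "\<lambda>p. p \<noteq> 0 \<and> poly_act B p w \<in> V" p0 degree] by blast
  have "degree p \<noteq> 0"
  proof
    assume "degree p = 0"
    then obtain a where a: "p = [:a:]" by (rule degree_eq_zeroE)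
    then have "a \<noteq> 0" "a *s w \<in> V" using p by simp_all
    then have "inverse a *s (a *s w) \<in> V"
      using vec.subspace_scale[OF V(1), of "a *s w" "inverse a"] by blast
    moreover have "inverse a *s (a *s w) = w" using \<open>a \<noteq> 0\<close> by (simp add: Finite_Cartesian_Product.vec_eq_iff)
    ultimately show False using w by simp
  qed
  then obtain c where "poly p c = 0" using alg_closed_imp_poly_has_root by blast
  then have "[:- c, 1:] dvd p" by (simp only: poly_eq_0_iff_dvd)
  then obtain q where q: "p = [:- c, 1:] * q" by (rule dvdE)
  have "q \<noteq> 0" using p unfolding q by fastforce
  then have "degree q < degree p" unfolding q by (subst degree_mult_eq) simp_all
  then have "poly_act B q w \<notin> V" using min[of q] \<open>q \<noteq> 0\<close> by auto
  moreover have "B *v poly_act B q w - c *s poly_act B q w \<in> V"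
    using p unfolding q poly_act_linear_factor by blast
  ultimately show thesis by (rule that)
qed

text \<open>An eigenvector of \<open>B\<close> modulo the span of the vectors found so far extends
  the invariant flag by one step.\<close>

lemma exists_triangular_basis:
  fixes B :: "'k::alg_closed_field^'n^'n"
  assumes "m \<le> CARD('n)"
  shows "\<exists>v. inj_on v {..<m} \<and> vec.independent (v ` {..<m}) \<and> (\<forall>i<m. B *v v i \<in> vec.span (v ` {..i}))"
  using assms
proof (induction m)
  case 0 then show ?case by (simp add: vec.independent_empty)
next
  case (Suc m)
  then obtain v where v: "inj_on v {..<m}" "vec.independent (v ` {..<m})"
    "\<And>i. i < m \<Longrightarrow> B *v v i \<in> vec.span (v ` {..i})" by auto
  let ?V = "vec.span (v ` {..<m})"
  have "vec.dim ?V = m" 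
    unfolding vec.dim_span_eq_card_independent[OF v(2)] using v(1) by (simp add: card_image)
  then have "?V \<noteq> UNIV" using Suc.prems vec_dim_card[where 'a = 'k and 'n = 'n]
    by (metis Suc_n_not_le_n)
  then obtain u c where u: "u \<notin> ?V" "B *v u - c *s u \<in> ?V"
    using exists_eigenvector_mod_subspace[of ?V B] by blast
  let ?v = "v(m := u)"
  have img: "?v ` {..<k} = v ` {..<k}" "?v ` {..i} = v ` {..i}" if "k \<le> m" "i < m" for k i
    using that by auto
  have "?v ` {..<m} = v ` {..<m}" by auto
  then have "?v ` {..<Suc m} = insert u (v ` {..<m})"
    by (simp only: lessThan_Suc image_insert fun_upd_same)
  then have all: "?v ` {..<Suc m} = insert u (v ` {..<m})" "?v ` {..m} = insert u (v ` {..<m})"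
    by (simp_all only: lessThan_Suc_atMost)
  have "u \<notin> v ` {..<m}" using u(1) vec.span_superset[of "v ` {..<m}"] by (meson subsetD)
  then have "inj_on ?v {..<Suc m}" using v(1) by (auto simp: lessThan_Suc inj_on_def)
  moreover have "vec.independent (?v ` {..<Suc m})"
    unfolding all using v(2) u(1) by (rule vec.independent_insertI[rotated])
  moreover have "B *v ?v i \<in> vec.span (?v ` {..i})" if "i < Suc m" for i
  proof (cases "i = m")
    case True
    have "(B *v u - c *s u) + c *s u \<in> vec.span (insert u (v ` {..<m}))"
      using subsetD[OF vec.span_mono[OF subset_insertI] u(2)]
      by (rule vec.span_add) (intro vec.span_scale vec.span_base insertI1)
    then show ?thesis using True by (simp only: all diff_add_cancel fun_upd_same)
  next
    case False
    then show ?thesis using v(3)[of i] that img(2)[of 0 i]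
      by (simp only: less_Suc_eq fun_upd_apply if_False simp_thms le0)
  qed
  ultimately show ?case by blast
qed

lemma matrix_vector_mult_axis: "A *v axis k 1 = column k A" for A :: "'k::field^'n^'m"
  by (simp add: Finite_Cartesian_Product.vec_eq_iff matrix_vector_mult_def axis_def column_def if_distrib cong: if_cong)

text \<open>The index type carries no order, so \<open>h\<close> imports that of the naturals: upper
  triangular means zero wherever \<open>h j < h i\<close>.\<close>

lemma exists_triangular_form:
  fixes B :: "'k::alg_closed_field^'n^'n"
  obtains P Q T :: "'k^'n^'n" and h :: "'n \<Rightarrow> nat" where
    "Q ** P = mat 1" "P ** Q = mat 1" "T = Q ** B ** P" "inj h" "\<And>i j. h j < h i \<Longrightarrow> T $ i $ j = 0"
proof -
  obtain v where v: "inj_on v {..<CARD('n)}" "vec.independent (v ` {..<CARD('n)})"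
    "\<And>i. i < CARD('n) \<Longrightarrow> B *v v i \<in> vec.span (v ` {..i})"
    using exists_triangular_basis[of "CARD('n)" B] by auto
  obtain h :: "'n \<Rightarrow> nat" where h: "bij_betw h UNIV {..<CARD('n)}"
    using ex_bij_betw_finite_nat[of "UNIV :: 'n set"] by (auto simp: atLeast0LessThan)
  have h_inj: "inj h" using h by (simp add: bij_betw_def)
  have h_lt: "h i < CARD('n)" for i using h by (auto simp: bij_betw_def)
  define P :: "'k^'n^'n" where "P = (\<chi> a b. v (h b) $ a)"
  have colP: "column b P = v (h b)" for b by (simp add: P_def column_def Finite_Cartesian_Product.vec_eq_iff)
  have "\<forall>i. c i = 0" if "(\<Sum>i\<in>UNIV. c i *s column i P) = 0" for c
  proof
    fix i
    have inj: "inj (\<lambda>b. v (h b))" using v(1) h_inj h_lt by (auto simp: inj_on_def)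
    have rng: "range (\<lambda>b. v (h b)) = v ` {..<CARD('n)}" using h image_image[of v h UNIV] by (simp add: bij_betw_def)
    let ?u = "\<lambda>x. c (inv_into UNIV (\<lambda>b. v (h b)) x)"
    have "(\<Sum>x\<in>range (\<lambda>b. v (h b)). ?u x *s x) = (\<Sum>i\<in>UNIV. c i *s column i P)"
      by (subst sum.reindex[OF inj]) (simp add: colP inv_f_f[OF inj])
    then have "?u (v (h i)) = 0"
      using that vec.independentD[OF v(2)[folded rng], of "range (\<lambda>b. v (h b))" ?u "v (h i)"] by simp
    then show "c i = 0" by (simp add: inv_f_f[OF inj])
  qed
  then have "\<exists>Q. Q ** P = mat 1"
    by (intro matrix_left_invertible_independent_columns[THEN iffD2] allI impI) blast
  then obtain Q where Q: "Q ** P = mat 1" ..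
  then have PQ: "P ** Q = mat 1" by (rule matrix_left_right_inverse[THEN iffD1])
  have Pv: "P *v axis b 1 = v (h b)" for b by (simp only: matrix_vector_mult_axis colP)
  have Qv: "Q *v v (h b) = axis b 1" for b
    by (simp only: Pv[symmetric] matrix_vector_mul_assoc Q matrix_vector_mul_lid)
  have zero: "(Q *v x) $ i = 0" if "x \<in> vec.span (v ` {..m})" "m < h i" for x i m
    using that(1)
  proof (induction rule: vec.span_induct_alt)
    case base then show ?case by simp
  next
    case (step c x y)
    then obtain l where l: "l \<le> m" "x = v l" by auto
    have "l < CARD('n)" using l that(2) h_lt[of i] by simp
    then obtain b where b: "l = h b" using h by (metis bij_betw_imp_surj_on imageE lessThan_iff)
    then have "b \<noteq> i" using l that(2) by auto
    then show ?case using step l b by (simp add: vec.add vec.scale Qv axis_def)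
  qed
  have "(Q ** B ** P) $ i $ j = 0" if "h j < h i" for i j
  proof -
    have "(Q ** B ** P) $ i $ j = ((Q ** B ** P) *v axis j 1) $ i"
      by (simp only: matrix_vector_mult_axis) (simp add: column_def)
    also have "\<dots> = (Q *v (B *v v (h j))) $ i"
      by (simp only: matrix_vector_mul_assoc[symmetric] Pv)
    also have "\<dots> = 0" using zero[OF v(3)[OF h_lt] that] .
    finally show ?thesis .
  qed
  then show thesis using that[OF Q PQ refl h_inj] by blast
qed

text \<open>For triangular \<open>T\<close>, the map \<open>y \<mapsto> [y, T]\<close> sends upper
  triangular matrices to strictly upper triangular ones, because the diagonal entries commute. The
  two spaces differ in dimension by \<open>CARD('n)\<close>, so the kernel has at least that
  dimension, and conjugation carries it into the centraliser of \<open>B\<close>.\<close>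

lemma dim_centraliser_ge:
  fixes B :: "'k::alg_closed_field^'n^'n"
  shows "CARD('n) \<le> M.dim (centraliser B)"
proof -
  obtain P Q T :: "'k^'n^'n" and h :: "'n \<Rightarrow> nat" where
    PQ: "Q ** P = mat 1" "P ** Q = mat 1" and T: "T = Q ** B ** P" and h: "inj h"
    and tri: "\<And>i j. h j < h i \<Longrightarrow> T $ i $ j = 0"
    using exists_triangular_form[of B] by metis
  let ?RU = "{(i, j). h i \<le> h j}" and ?RN = "{(i, j). h i < h j}"
  define U :: "('k^'n^'n) set" where "U = {A. \<forall>i j. (i, j) \<notin> ?RU \<longrightarrow> A $ i $ j = 0}"
  define N :: "('k^'n^'n) set" where "N = {A. \<forall>i j. (i, j) \<notin> ?RN \<longrightarrow> A $ i $ j = 0}"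
  define f where "f = (\<lambda>y. lie_bracket y T)"
  have prod: "(A ** C) $ i $ j = (if i = j then A $ i $ i * C $ i $ i else 0)"
    if "h j \<le> h i" "A \<in> U" "C \<in> U" for A C :: "'k^'n^'n" and i j
  proof -
    have "A $ i $ l * C $ l $ j = (if l = i \<and> i = j then A $ i $ i * C $ i $ i else 0)" for l
    proof (cases "l = i \<and> i = j")
      case False
      then have "h l < h i \<or> h j < h l" using that(1) h by (metis inj_eq le_less_trans linorder_neqE_nat not_less)
      then show ?thesis using that(2,3) by (auto simp: U_def not_le split: if_splits)
    qed auto
    then have "(A ** C) $ i $ j = (\<Sum>l\<in>UNIV. if l = i \<and> i = j then A $ i $ i * C $ i $ i else 0)"
      unfolding matrix_matrix_mult_def by simp
    also have "\<dots> = (if i = j then A $ i $ i * C $ i $ i else 0)" by (cases "i = j") auto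
    finally show ?thesis .
  qed
  have TU: "T \<in> U" using tri by (auto simp: U_def)
  have fU: "f ` U \<subseteq> N"
    using TU by (auto simp: f_def N_def lie_bracket_def prod mult.commute)
  have flin: "Vector_Spaces.linear mscale mscale f" unfolding f_def by (rule linear_lie_bracket)
  have Usub: "M.subspace U" by (auto simp: U_def M.subspace_def)
  have "?RU = ?RN \<union> (\<lambda>i. (i, i)) ` UNIV" using h by (auto simp: inj_def le_less)
  moreover have "card ((\<lambda>i::'n. (i, i)) ` UNIV) = CARD('n)" by (intro card_image) (auto simp: inj_on_def)
  moreover have "?RN \<inter> (\<lambda>i. (i, i)) ` UNIV = {}" by auto
  ultimately have "card ?RU = card ?RN + CARD('n)" by (simp add: card_Un_disjoint)
  then have "M.dim U = M.dim N + CARD('n)" unfolding U_def N_def dim_entries by simp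
  moreover have "M.dim U \<le> M.dim {y \<in> U. f y = 0} + M.dim (f ` U)"
    by (rule M.dim_le_dim_kernel_add_dim_image[OF flin Usub])
  moreover have "M.dim (f ` U) \<le> M.dim N" using fU by (rule M.dim_subset)
  ultimately have "CARD('n) \<le> M.dim {y \<in> U. f y = 0}" by simp
  also have "\<dots> = M.dim ((\<lambda>y. P ** (y ** Q)) ` {y \<in> U. f y = 0})"
  proof (rule MM.dim_image_eq[symmetric])
    show "Vector_Spaces.linear mscale mscale (\<lambda>y. P ** (y ** Q))"
      using Vector_Spaces.linear_compose[OF linear_mult_right[of Q] linear_mult_left[of P]] by (simp add: o_def)
    have "y = Q ** (P ** (y ** Q)) ** P" for y
      using PQ(1) by (metis matrix_mul_assoc matrix_mul_lid matrix_mul_rid)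
    then show "inj_on (\<lambda>y. P ** (y ** Q)) (M.span {y \<in> U. f y = 0})"
      by (intro inj_on_inverseI[where g = "\<lambda>x. Q ** x ** P"]) simp
  qed
  also have "\<dots> \<le> M.dim (centraliser B)"
  proof (intro M.dim_subset subsetI, elim imageE CollectE conjE)
    fix x y assume x: "x = P ** (y ** Q)" and "f y = 0"
    then have yT: "y ** T = T ** y" by (simp add: f_def lie_bracket_def)
    have PT: "P ** T = B ** P" and TQ: "T ** Q = Q ** B"
      unfolding T using PQ by (metis matrix_mul_assoc matrix_mul_lid matrix_mul_rid)+
    have "x ** B = P ** (y ** T) ** Q" using TQ by (simp add: x matrix_mul_assoc[symmetric])
    also have "\<dots> = P ** T ** y ** Q" by (simp add: yT matrix_mul_assoc)
    also have "\<dots> = B ** x" unfolding PT by (simp add: x matrix_mul_assoc)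
    finally show "x \<in> centraliser B" by (simp add: centraliser_def lie_bracket_def)
  qed
  finally show ?thesis .
qed

subsection \<open>The lower bound for the index\<close>

lemma subspace_centraliser: "M.subspace (centraliser e)"
  using module_hom.subspace_kernel[OF linear_lie_bracket[of e, folded module_hom_iff_linear]]
  by (simp add: centraliser_def)

lemma lie_bracket_centraliser:
  assumes "x \<in> centraliser e" "y \<in> centraliser e"
  shows "lie_bracket x y \<in> centraliser e"
proof -
  have "x ** e = e ** x" "y ** e = e ** y" using assms by (simp_all add: centraliser_def lie_bracket_def)
  then have "x ** y ** e = e ** (x ** y)" "y ** x ** e = e ** (y ** x)"
    by (metis matrix_mul_assoc)+
  then show ?thesis
    by (simp add: centraliser_def lie_bracket_def matrix_diff_ldistrib matrix_diff_rdistrib)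
qed

text \<open>\<open>\<gamma>\<close> is linear on \<open>q\<close> only, so it is replaced by a
  linear extension \<open>g\<close> of its values on a basis of \<open>q\<close>. The trace form
  represents \<open>g\<close> by the matrix with entries \<open>g (munit j i)\<close>.\<close>

lemma dual_space_eq_trace:
  fixes q :: "('k::field^'n^'n) set"
  assumes q: "M.subspace q" and \<gamma>: "\<gamma> \<in> dual_space q"
  obtains A where "\<And>x. x \<in> q \<Longrightarrow> \<gamma> x = trace (A ** x)"
proof -
  obtain B where B: "B \<subseteq> q" "M.independent B" "q \<subseteq> M.span B"
    by (rule M.maximal_independent_subset)
  from MK.linear_independent_extend[OF B(2), of \<gamma>]
  obtain g where g: "Vector_Spaces.linear mscale (*) g" "\<forall>x\<in>B. g x = \<gamma> x"
    by (elim exE conjE)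
  interpret g: Vector_Spaces.linear mscale "(*)" g by fact
  have eq: "x \<in> q \<and> \<gamma> x = g x" if "x \<in> M.span B" for x
    using that
  proof (induction rule: M.span_induct_alt)
    case base
    have "\<gamma> (mscale 0 0) = 0 * \<gamma> 0" using \<gamma> M.subspace_0[OF q] unfolding dual_space_def by blast
    then show ?case using M.subspace_0[OF q] by (simp add: g.zero)
  next
    case (step c x y)
    then have x: "x \<in> q" "mscale c x \<in> q" using B(1) M.subspace_scale[OF q] by auto
    have "\<gamma> (mscale c x + y) = \<gamma> (mscale c x) + \<gamma> y" "\<gamma> (mscale c x) = c * \<gamma> x"
      using \<gamma> x step unfolding dual_space_def by blast+
    then show ?case using step x bspec[OF g(2), of x] M.subspace_add[OF q x(2)] by (simp add: g.add g.scale)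
  qed
  have "g x = trace ((\<chi> i j. g (munit j i)) ** x)" for x
  proof -
    have "x = (\<Sum>p\<in>UNIV. mscale (case p of (a, b) \<Rightarrow> x $ a $ b) (case p of (a, b) \<Rightarrow> munit a b))"
      unfolding Finite_Cartesian_Product.vec_eq_iff sum_munit_nth by auto
    then have "g x = g (\<Sum>p\<in>UNIV. mscale (case p of (a, b) \<Rightarrow> x $ a $ b) (case p of (a, b) \<Rightarrow> munit a b))"
      by (rule arg_cong)
    also have "\<dots> = (\<Sum>p\<in>UNIV. case p of (a, b) \<Rightarrow> x $ a $ b * g (munit a b))"
      unfolding g.sum by (intro sum.cong) (auto simp: g.scale)
    also have "\<dots> = (\<Sum>b\<in>UNIV. \<Sum>a\<in>UNIV. g (munit a b) * x $ a $ b)"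
      by (subst sum.swap) (simp add: sum.cartesian_product mult.commute)
    also have "\<dots> = trace ((\<chi> i j. g (munit j i)) ** x)"
      by (simp add: trace_def matrix_matrix_mult_def)
    finally show ?thesis .
  qed
  then show thesis using that eq B(3) by (metis subsetD)
qed

text \<open>If \<open>[x, e] = 0\<close> and \<open>[x, A] = [z, e]\<close>, invariance of the trace
  form gives \<open>tr (A [x, y]) = - tr ([x, A] y) = - tr (z [e, y]) = 0\<close> for every
  \<open>y\<close> that commutes with \<open>e\<close>. Such \<open>x\<close> are counted by
  \<open>dim_kernel_deformation\<close>, with the centralisers of \<open>e + t A\<close> as
  kernels.\<close>

lemma dim_stabiliser_ge:
  fixes e :: "'k::alg_closed_field^'n^'n"
  assumes \<gamma>: "\<gamma> \<in> dual_space (centraliser e)"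
  shows "CARD('n) \<le> mdim (stabiliser (centraliser e) \<gamma>)"
proof -
  obtain A where A: "\<And>x. x \<in> centraliser e \<Longrightarrow> \<gamma> x = trace (A ** x)"
    using dual_space_eq_trace[OF subspace_centraliser \<gamma>] by blast
  let ?T = "\<lambda>x. lie_bracket x e" and ?R = "\<lambda>x. lie_bracket x A"
  have "CARD('n) \<le> M.dim {x. ?T x = 0 \<and> ?R x \<in> range ?T}"
  proof (rule M.dim_kernel_deformation[OF linear_lie_bracket linear_lie_bracket infinite_UNIV_alg_closed])
    fix t
    have "{x. ?T x + mscale t (?R x) = 0} = centraliser (e + mscale t A)"
      by (simp add: centraliser_def lie_bracket_def matrix_add_ldistrib matrix_add_distrib_right
          mscale_matrix_mult M.scale_right_diff_distrib algebra_simps)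
    then show "CARD('n) \<le> M.dim {x. ?T x + mscale t (?R x) = 0}" using dim_centraliser_ge by metis
  qed
  also have "\<dots> \<le> M.dim (stabiliser (centraliser e) \<gamma>)"
  proof (intro M.dim_subset subsetI, elim CollectE conjE)
    fix x assume x: "?T x = 0" "?R x \<in> range ?T"
    then have xq: "x \<in> centraliser e" by (simp add: centraliser_def)
    obtain z where z: "lie_bracket x A = lie_bracket z e" using x by blast
    have "\<gamma> (lie_bracket x y) = 0" if y: "y \<in> centraliser e" for y
    proof -
      have ye: "y ** e = e ** y" using y by (simp add: centraliser_def lie_bracket_def)
      have "\<gamma> (lie_bracket x y) = trace (A ** (x ** y)) - trace (A ** (y ** x))"
        using A[OF lie_bracket_centraliser[OF xq y]]
        by (simp add: lie_bracket_def matrix_diff_ldistrib trace_sub)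
      also have "trace (A ** (y ** x)) = trace (x ** A ** y)"
        by (metis trace_mul_sym matrix_mul_assoc)
      also have "trace (A ** (x ** y)) - trace (x ** A ** y) = - trace (lie_bracket x A ** y)"
        by (simp add: lie_bracket_def matrix_diff_rdistrib trace_sub matrix_mul_assoc)
      also have "trace (lie_bracket x A ** y) = trace (z ** e ** y) - trace (e ** z ** y)"
        unfolding z by (simp add: lie_bracket_def matrix_diff_rdistrib trace_sub)
      also have "trace (e ** z ** y) = trace (z ** (y ** e))"
        by (metis trace_mul_sym matrix_mul_assoc)
      also have "trace (z ** e ** y) = trace (z ** (y ** e))" by (simp add: ye matrix_mul_assoc)
      finally show ?thesis by simp
    qed
    then show "x \<in> stabiliser (centraliser e) \<gamma>" using xq by (simp add: stabiliser_def)
  qed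
  finally show ?thesis by (simp add: mdim_def)
qed

subsection \<open>A basis of the centraliser\<close>

locale jordan_basis =
  fixes e :: "'k::field^'n^'n" and k :: nat and d :: "nat \<Rightarrow> nat"
    and w :: "nat \<Rightarrow> 'k^'n" and crd :: "nat \<Rightarrow> nat \<Rightarrow> 'k^'n \<Rightarrow> 'k"
  assumes d_antimono: "\<And>i j. i \<le> j \<Longrightarrow> j < k \<Longrightarrow> d j \<le> d i"
    and string_end: "\<And>i. i < k \<Longrightarrow> ((*v) e ^^ Suc (d i)) (w i) = 0"
    and linear_crd: "\<And>i s. Vector_Spaces.linear (*s) (*) (crd i s)"
    and crd_string: "\<And>i j s t. i < k \<Longrightarrow> j < k \<Longrightarrow> s \<le> d i \<Longrightarrow> t \<le> d j \<Longrightarrow>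
      crd i s (((*v) e ^^ t) (w j)) = (if i = j \<and> s = t then 1 else 0)"
    and expand: "\<And>v. v = (\<Sum>i<k. \<Sum>s\<le>d i. crd i s v *s ((*v) e ^^ s) (w i))"
    and sum_d: "(\<Sum>i<k. Suc (d i)) = CARD('n)"
begin

abbreviation str :: "nat \<Rightarrow> nat \<Rightarrow> 'k^'n" where
  "str i s \<equiv> ((*v) e ^^ s) (w i)"

lemmas crd_add = VK.linear_add[OF linear_crd]
  and crd_scale = VK.linear_scale[OF linear_crd]
  and crd_sum = VK.linear_sum[OF linear_crd]
  and crd_0 = VK.linear_0[OF linear_crd]

lemma pow_add: "((*v) e ^^ s) (((*v) e ^^ t) v) = ((*v) e ^^ (s + t)) v"
  by (simp add: funpow_add)

lemma pow_0: "((*v) e ^^ s) 0 = 0"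
  by (induction s) simp_all

lemma str_eq_0: "i < k \<Longrightarrow> d i < s \<Longrightarrow> str i s = 0"
proof -
  assume "i < k" "d i < s"
  then have "str i s = ((*v) e ^^ (s - Suc (d i))) (str i (Suc (d i)))" by (simp only: pow_add) simp
  then show ?thesis using string_end[OF \<open>i < k\<close>] pow_0 by (simp only:)
qed

lemma crd_str: "i < k \<Longrightarrow> j < k \<Longrightarrow> s \<le> d i \<Longrightarrow> crd i s (str j t) = (if i = j \<and> s = t then 1 else 0)"
  by (cases "t \<le> d j") (auto simp: crd_string str_eq_0 crd_0)

lemma vector_eqI:
  assumes "\<And>i s. i < k \<Longrightarrow> s \<le> d i \<Longrightarrow> crd i s x = crd i s y"
  shows "x = y"
proof -
  have "x = (\<Sum>i<k. \<Sum>s\<le>d i. crd i s x *s str i s)" by (rule expand)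
  also have "\<dots> = (\<Sum>i<k. \<Sum>s\<le>d i. crd i s y *s str i s)"
    using assms by (intro sum.cong) auto
  also have "\<dots> = y" by (rule expand[symmetric])
  finally show ?thesis .
qed

lemma matrix_eqI:
  fixes A B :: "'k^'n^'n"
  assumes "\<And>i s. i < k \<Longrightarrow> s \<le> d i \<Longrightarrow> A *v str i s = B *v str i s"
  shows "A = B"
proof (rule matrix_eq[THEN iffD2], intro allI)
  fix v
  have "A *v v = A *v (\<Sum>i<k. \<Sum>s\<le>d i. crd i s v *s str i s)" using expand[of v] by simp
  also have "\<dots> = (\<Sum>i<k. \<Sum>s\<le>d i. crd i s v *s (A *v str i s))"
    by (simp add: vec.sum vec.scale)
  also have "\<dots> = (\<Sum>i<k. \<Sum>s\<le>d i. crd i s v *s (B *v str i s))"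
    using assms by (intro sum.cong) auto
  also have "\<dots> = B *v (\<Sum>i<k. \<Sum>s\<le>d i. crd i s v *s str i s)"
    by (simp add: vec.sum vec.scale)
  also have "\<dots> = B *v v" using expand[of v] by simp
  finally show "A *v v = B *v v" .
qed

lemma crd_Suc_e:
  assumes "i < k" "s \<le> d i"
  shows "crd i s (e *v v) = (case s of 0 \<Rightarrow> 0 | Suc s' \<Rightarrow> crd i s' v)"
proof -
  have "e *v v = e *v (\<Sum>j<k. \<Sum>t\<le>d j. crd j t v *s str j t)" using expand[of v] by simp
  also have "\<dots> = (\<Sum>j<k. \<Sum>t\<le>d j. crd j t v *s str j (Suc t))"
    by (simp add: vec.sum vec.scale)
  finally have "crd i s (e *v v) = (\<Sum>j<k. \<Sum>t\<le>d j. crd j t v * crd i s (str j (Suc t)))"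
    by (simp only: crd_sum crd_scale)
  also have "\<dots> = (\<Sum>j<k. if i = j then (case s of 0 \<Rightarrow> 0 | Suc s' \<Rightarrow> crd i s' v) else 0)"
  proof (intro sum.cong refl)
    fix j assume "j \<in> {..<k}"
    then have c: "crd i s (str j (Suc t)) = (if i = j \<and> s = Suc t then 1 else 0)" for t
      using crd_str[of i j s "Suc t"] assms by simp
    show "(\<Sum>t\<le>d j. crd j t v * crd i s (str j (Suc t))) = (if i = j then (case s of 0 \<Rightarrow> 0 | Suc s' \<Rightarrow> crd i s' v) else 0)"
    proof (cases s)
      case 0 then show ?thesis unfolding c by simp
    next
      case (Suc s')
      then have "(\<Sum>t\<le>d j. crd j t v * crd i s (str j (Suc t))) = (\<Sum>t\<le>d j. if t = s' then (if i = j then crd j t v else 0) else 0)"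
        unfolding c by (intro sum.cong) auto
      then show ?thesis using Suc assms by auto
    qed
  qed
  also have "\<dots> = (case s of 0 \<Rightarrow> 0 | Suc s' \<Rightarrow> crd i s' v)" using assms(1) by simp
  finally show ?thesis .
qed

lemma crd_pow: "i < k \<Longrightarrow> s + t \<le> d i \<Longrightarrow> crd i (s + t) (((*v) e ^^ t) v) = crd i s v"
  by (induction t) (simp_all add: crd_Suc_e)

text \<open>The bound \<open>a \<le> d i\<close> says that \<open>e ^ (d i + 1)\<close> kills
  \<open>e ^ (d j - a) w j\<close>. A map commuting with \<open>e\<close> can send
  \<open>w i\<close> to this vector only then, since \<open>e ^ (d i + 1)\<close> kills
  \<open>w i\<close>.\<close>

definition Idx :: "(nat \<times> nat \<times> nat) set" where
  "Idx = {(i, j, a). i < k \<and> j < k \<and> a \<le> min (d i) (d j)}"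

lemma finite_Idx: "finite Idx"
proof -
  have "Idx \<subseteq> {..<k} \<times> {..<k} \<times> {..(\<Sum>i<k. d i)}"
    by (auto simp: Idx_def intro!: order_trans[OF _ member_le_sum])
  then show ?thesis by (rule finite_subset) simp
qed

text \<open>\<open>eta (i, j, a)\<close> maps the generator \<open>w i\<close> to \<open>e ^ (d j - a) w j\<close> and kills the other generators.
  The exponent is counted from the top, which makes the range of \<open>a\<close> symmetric in \<open>i\<close> and \<open>j\<close>.\<close>

definition eta :: "nat \<times> nat \<times> nat \<Rightarrow> 'k^'n^'n" where
  "eta p = (case p of (i, j, a) \<Rightarrow> matrix (\<lambda>v. \<Sum>s\<le>d i. crd i s v *s str j (s + (d j - a))))"

lemma eta_mult: "eta (i, j, a) *v v = (\<Sum>s\<le>d i. crd i s v *s str j (s + (d j - a)))"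
proof -
  have "Vector_Spaces.linear (*s) (*s) (\<lambda>v. \<Sum>s\<le>d i. crd i s v *s str j (s + (d j - a)))"
    by (simp add: Vector_Spaces.linear_iff vec.vector_space_axioms crd_add crd_scale sum.distrib
        vec.scale_left_distrib vec.scale_sum_right)
  then show ?thesis unfolding eta_def by (simp add: matrix_works)
qed

text \<open>Valid also beyond the end of string \<open>i\<close>, where both sides vanish because
  \<open>a \<le> d i\<close>; commutation with \<open>e\<close> is then uniform along the
  string.\<close>

lemma eta_str:
  assumes "(i, j, a) \<in> Idx" "l < k"
  shows "eta (i, j, a) *v str l s = (if l = i then str j (s + (d j - a)) else 0)"
proof (cases "s \<le> d l")
  case True
  have "eta (i, j, a) *v str l s = (\<Sum>t\<le>d i. if t = s then (if l = i then str j (s + (d j - a)) else 0) else 0)"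
    unfolding eta_mult using assms by (intro sum.cong) (auto simp: crd_str Idx_def)
  then show ?thesis using True by auto
next
  case False
  moreover have "str j (s + (d j - a)) = 0" if "l = i"
    using that False assms by (intro str_eq_0) (auto simp: Idx_def)
  ultimately show ?thesis using assms(2) str_eq_0[of l s] by simp
qed

lemma eta_centraliser: "p \<in> Idx \<Longrightarrow> eta p \<in> centraliser e"
proof -
  assume p: "p \<in> Idx"
  obtain i j a where ija: "p = (i, j, a)" by (metis prod_cases3)
  have "eta p ** e = e ** eta p"
  proof (rule matrix_eqI)
    fix l s assume l: "l < k" "s \<le> d l"
    have "e *v str l s = str l (Suc s)" by simp
    then show "(eta p ** e) *v str l s = (e ** eta p) *v str l s"
      using p l by (simp only: matrix_vector_mul_assoc[symmetric] ija eta_str) simp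
  qed
  then show ?thesis by (simp add: centraliser_def lie_bracket_def)
qed

text \<open>On the centraliser this is the coefficient of \<open>eta p\<close>, read off from the
  image of one generator. It is defined on all matrices, hence linear without side
  conditions.\<close>

definition eta_coeff :: "'k^'n^'n \<Rightarrow> nat \<times> nat \<times> nat \<Rightarrow> 'k" where
  "eta_coeff x p = (case p of (i, j, a) \<Rightarrow> crd j (d j - a) (x *v w i))"

lemma eta_coeff_add: "eta_coeff (x + y) p = eta_coeff x p + eta_coeff y p"
  by (cases p) (simp add: eta_coeff_def matrix_vector_mult_add_rdistrib crd_add)

lemma mscale_vector_mult: "mscale c x *v v = c *s (x *v v)" for x :: "'k^'n^'n"
  by (simp add: Finite_Cartesian_Product.vec_eq_iff matrix_vector_mult_def sum_distrib_left mult.assoc)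

lemma eta_coeff_scale: "eta_coeff (mscale c x) p = c * eta_coeff x p"
  by (cases p) (simp add: eta_coeff_def mscale_vector_mult crd_scale)

lemma eta_w:
  assumes "(i, j, a) \<in> Idx" "l < k"
  shows "eta (i, j, a) *v w l = (if l = i then str j (d j - a) else 0)"
  using eta_str[OF assms, of 0] by simp

lemma eta_coeff_eta:
  assumes "p \<in> Idx" "q \<in> Idx"
  shows "eta_coeff (eta p) q = (if q = p then 1 else 0)"
proof -
  obtain i j a l m b where pq: "p = (i, j, a)" "q = (l, m, b)" by (metis prod_cases3)
  have "d m - b = d j - a \<longleftrightarrow> b = a" if "m = j" using assms that by (auto simp: Idx_def pq)
  then show ?thesis
    using assms unfolding pq by (auto simp: eta_coeff_def eta_w crd_0 crd_str Idx_def)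
qed

lemma centraliser_pow:
  assumes "x \<in> centraliser e"
  shows "x *v ((*v) e ^^ s) v = ((*v) e ^^ s) (x *v v)"
proof (induction s)
  case (Suc s)
  have "x ** e = e ** x" using assms by (simp add: centraliser_def lie_bracket_def)
  then have "x *v (e *v u) = e *v (x *v u)" for u by (simp add: matrix_vector_mul_assoc)
  then show ?case using Suc by simp
qed simp

lemma centraliser_eqI:
  assumes x: "x \<in> centraliser e" and y: "y \<in> centraliser e"
    and eq: "\<And>i j s. i < k \<Longrightarrow> j < k \<Longrightarrow> s \<le> d j \<Longrightarrow> crd j s (x *v w i) = crd j s (y *v w i)"
  shows "x = y"
proof (rule matrix_eqI)
  fix i s assume i: "i < k" "s \<le> d i"
  have "x *v w i = y *v w i" using eq[OF i(1)] by (rule vector_eqI)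
  then show "x *v str i s = y *v str i s" by (simp only: centraliser_pow[OF x] centraliser_pow[OF y])
qed

lemma eta_coeff_sum: "eta_coeff (\<Sum>p\<in>I. f p) q = (\<Sum>p\<in>I. eta_coeff (f p) q)"
proof (induction I rule: infinite_finite_induct)
  case empty
  have "eta_coeff 0 q = 0" using eta_coeff_scale[of 0 0 q] by simp
  then show ?case by simp
next
  case (infinite I)
  have "eta_coeff 0 q = 0" using eta_coeff_scale[of 0 0 q] by simp
  then show ?case using infinite by simp
qed (simp add: eta_coeff_add)

text \<open>An \<open>x\<close> in the centraliser is determined by the vectors
  \<open>x w i\<close>. Their coordinates \<open>s < d j - d i\<close> vanish, because
  \<open>x\<close> commutes with \<open>e ^ (d i + 1)\<close>, which kills \<open>w i\<close>; the
  other coordinates are the \<open>eta_coeff\<close>.\<close>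

lemma centraliser_expand:
  assumes x: "x \<in> centraliser e"
  shows "x = (\<Sum>p\<in>Idx. mscale (eta_coeff x p) (eta p))" (is "x = ?y")
proof (rule centraliser_eqI[OF x])
  show y: "?y \<in> centraliser e"
    using eta_centraliser by (intro M.subspace_sum[OF subspace_centraliser] M.subspace_scale[OF subspace_centraliser])
  have coef: "eta_coeff ?y q = eta_coeff x q" if "q \<in> Idx" for q
  proof -
    have "eta_coeff ?y q = (\<Sum>p\<in>Idx. if q = p then eta_coeff x p else 0)"
      unfolding eta_coeff_sum eta_coeff_scale using that by (intro sum.cong) (auto simp: eta_coeff_eta)
    then show ?thesis using that finite_Idx by simp
  qed
  have low: "crd j s (z *v w i) = 0" if "z \<in> centraliser e" "i < k" "j < k" "s + Suc (d i) \<le> d j" for z i j s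
  proof -
    have "crd j s (z *v w i) = crd j (s + Suc (d i)) (z *v str i (Suc (d i)))"
      using crd_pow[OF that(3,4), of "z *v w i"] by (simp only: centraliser_pow[OF that(1)])
    then show ?thesis using string_end[OF that(2)] by (simp add: crd_0 del: funpow.simps)
  qed
  fix i j s assume ij: "i < k" "j < k" "s \<le> d j"
  show "crd j s (x *v w i) = crd j s (?y *v w i)"
  proof (cases "d j - s \<le> d i")
    case True
    then have "(i, j, d j - s) \<in> Idx" using ij by (simp add: Idx_def)
    from coef[OF this] show ?thesis using ij by (simp add: eta_coeff_def)
  next
    case False
    then show ?thesis using low[OF x ij(1,2)] low[OF y ij(1,2)] ij(3) by simp
  qed
qed

lemma indep_eta: "indep_family mscale Idx eta"
  unfolding indep_family_def
proof (intro allI impI ballI)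
  fix c q assume c: "(\<Sum>p\<in>Idx. mscale (c p) (eta p)) = 0" and q: "q \<in> Idx"
  have "eta_coeff (\<Sum>p\<in>Idx. mscale (c p) (eta p)) q = (\<Sum>p\<in>Idx. if q = p then c p else 0)"
    unfolding eta_coeff_sum eta_coeff_scale using q by (intro sum.cong) (auto simp: eta_coeff_eta)
  then have "eta_coeff 0 q = c q" using c q finite_Idx by simp
  then show "c q = 0" using eta_coeff_scale[of 0 0 q] by simp
qed

lemma dim_centraliser: "mdim (centraliser e) = card Idx"
proof -
  have "M.span (eta ` Idx) = centraliser e"
  proof
    show "M.span (eta ` Idx) \<subseteq> centraliser e"
      using eta_centraliser by (intro M.span_minimal subspace_centraliser) auto
    show "centraliser e \<subseteq> M.span (eta ` Idx)"
    proof
      fix x assume "x \<in> centraliser e"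
      moreover have "(\<Sum>p\<in>Idx. mscale (eta_coeff x p) (eta p)) \<in> M.span (eta ` Idx)"
        by (intro M.span_sum M.span_scale M.span_base) auto
      ultimately show "x \<in> M.span (eta ` Idx)" using centraliser_expand[of x] by simp
    qed
  qed
  then show ?thesis
    using M.dim_span_eq_card_independent[OF M.indep_family_independent[OF finite_Idx indep_eta]]
      card_image[OF M.indep_family_inj_on[OF finite_Idx indep_eta]] by (simp add: mdim_def)
qed

subsection \<open>The pairing on a plane of functionals\<close>

text \<open>The values on the basis \<open>eta\<close> of a point of the plane: \<open>y1\<close>
  belongs to the maps from string \<open>j + 1\<close> to the end of string \<open>j\<close>, and
  \<open>y2\<close> to those from string \<open>i\<close> to the end of string
  \<open>i + 1\<close>.\<close>

definition plane_coord :: "'k \<Rightarrow> 'k \<Rightarrow> nat \<times> nat \<times> nat \<Rightarrow> 'k" where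
  "plane_coord y1 y2 p = (case p of (i, j, a) \<Rightarrow>
     if a = 0 then (if i = Suc j then y1 else 0) + (if j = Suc i then y2 else 0) else 0)"

definition plane_functional :: "'k \<Rightarrow> 'k \<Rightarrow> 'k^'n^'n \<Rightarrow> 'k" where
  "plane_functional y1 y2 x = (\<Sum>p\<in>Idx. eta_coeff x p * plane_coord y1 y2 p)"

text \<open>Closed form of \<open>plane_functional\<close> on \<open>[eta u, eta v]\<close>. The
  product of \<open>eta (i, j, a)\<close> and \<open>eta (l, m, b)\<close> vanishes unless
  \<open>m = i\<close>; it leads from string \<open>l\<close> to string \<open>j\<close> and reaches
  the last vector there exactly if \<open>a + b = d i\<close>, the only case in which the functional
  sees it.\<close>

definition plane_pairing :: "'k \<Rightarrow> 'k \<Rightarrow> nat \<times> nat \<times> nat \<Rightarrow> nat \<times> nat \<times> nat \<Rightarrow> 'k" where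
  "plane_pairing y1 y2 u v = (case (u, v) of ((i, j, a), (l, m, b)) \<Rightarrow>
     (if m = i \<and> a + b = d i then plane_coord y1 y2 (l, j, 0) else 0)
     - (if j = l \<and> a + b = d j then plane_coord y1 y2 (i, m, 0) else 0))"

lemma plane_functional_diff: "plane_functional y1 y2 (x - y) = plane_functional y1 y2 x - plane_functional y1 y2 y"
proof -
  have "eta_coeff (x - y) p = eta_coeff x p - eta_coeff y p" for p
    using eta_coeff_add[of "x - y" y p] by simp
  then show ?thesis by (simp add: plane_functional_def left_diff_distrib sum_subtractf)
qed

lemma plane_functional_eta_mult:
  assumes u: "(i, j, a) \<in> Idx" and v: "(l, m, b) \<in> Idx"
  shows "plane_functional y1 y2 (eta (i, j, a) ** eta (l, m, b)) = (if m = i \<and> a + b = d i then plane_coord y1 y2 (l, j, 0) else 0)"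
proof -
  have lj: "l < k" "j < k" "i < k" "m < k" "a \<le> d j" "b \<le> d m" using u v by (auto simp: Idx_def)
  have "eta_coeff (eta (i, j, a) ** eta (l, m, b)) (i', j', 0) =
      (if (i', j', 0) = (l, j, 0) then if m = i \<and> a + b = d i then 1 else 0 else 0)"
    if "i' < k" "j' < k" for i' j'
  proof -
    have "(eta (i, j, a) ** eta (l, m, b)) *v w i' =
      (if i' = l \<and> m = i then str j (d m - b + (d j - a)) else 0)"
      using that lj by (simp add: matrix_vector_mul_assoc[symmetric] eta_w[OF v] eta_str[OF u])
    moreover have "d j = d m - b + (d j - a) \<longleftrightarrow> a + b = d m" using lj by auto
    ultimately show ?thesis
      using that lj by (auto simp: eta_coeff_def crd_0 crd_str)
  qed
  then have "eta_coeff (eta (i, j, a) ** eta (l, m, b)) p * plane_coord y1 y2 p =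
      (if p = (l, j, 0) then if m = i \<and> a + b = d i then plane_coord y1 y2 p else 0 else 0)" if "p \<in> Idx" for p
    using that by (cases p) (auto simp: plane_coord_def Idx_def)
  then have "plane_functional y1 y2 (eta (i, j, a) ** eta (l, m, b)) =
      (\<Sum>p\<in>Idx. if p = (l, j, 0) then if m = i \<and> a + b = d i then plane_coord y1 y2 p else 0 else 0)"
    unfolding plane_functional_def by (intro sum.cong) auto
  also have "\<dots> = (if m = i \<and> a + b = d i then plane_coord y1 y2 (l, j, 0) else 0)"
    using finite_Idx lj by (auto simp: Idx_def)
  finally show ?thesis .
qed

lemma plane_functional_bracket:
  assumes "u \<in> Idx" "v \<in> Idx"
  shows "plane_functional y1 y2 (lie_bracket (eta u) (eta v)) = plane_pairing y1 y2 u v"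
proof -
  obtain i j a l m b where uv: "u = (i, j, a)" "v = (l, m, b)" by (metis prod_cases3)
  show ?thesis
    using assms unfolding uv lie_bracket_def plane_functional_diff by (simp add: plane_functional_eta_mult plane_pairing_def add.commute)
qed

end

section \<open>Functionals on the centraliser and the lower bound for its index\<close>

lemma dual_space_add: "\<gamma> \<in> dual_space q \<Longrightarrow> x \<in> q \<Longrightarrow> y \<in> q \<Longrightarrow> \<gamma> (x + y) = \<gamma> x + \<gamma> y"
  by (simp add: dual_space_def)

lemma dual_space_scale: "\<gamma> \<in> dual_space q \<Longrightarrow> x \<in> q \<Longrightarrow> \<gamma> (mscale c x) = c * \<gamma> x"
  by (simp add: dual_space_def)

lemma dual_space_sum:
  assumes \<gamma>: "\<gamma> \<in> dual_space q" and q: "M.subspace q" and "\<And>i. i \<in> I \<Longrightarrow> f i \<in> q"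
  shows "\<gamma> (\<Sum>i\<in>I. mscale (c i) (f i)) = (\<Sum>i\<in>I. c i * \<gamma> (f i))"
  using assms(3)
proof (induction I rule: infinite_finite_induct)
  case empty
  show ?case using dual_space_scale[OF \<gamma> M.subspace_0[OF q], of 0] by simp
next
  case (infinite I)
  then show ?case using dual_space_scale[OF \<gamma> M.subspace_0[OF q], of 0] by simp
next
  case (insert a I)
  have "(\<Sum>i\<in>I. mscale (c i) (f i)) \<in> q"
    using insert.prems by (intro M.subspace_sum[OF q] M.subspace_scale[OF q]) simp
  then show ?case
    using insert M.subspace_scale[OF q] by (simp add: dual_space_add[OF \<gamma>] dual_space_scale[OF \<gamma>])
qed

lemma lie_bracket_sum_left:
  "lie_bracket (\<Sum>i\<in>I. mscale (c i) (f i)) y = (\<Sum>i\<in>I. mscale (c i) (lie_bracket (f i) y))"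
  by (simp only: MM.linear_sum[OF linear_lie_bracket] MM.linear_scale[OF linear_lie_bracket])

lemma subspace_stabiliser:
  assumes \<gamma>: "\<gamma> \<in> dual_space (centraliser e)"
  shows "M.subspace (stabiliser (centraliser e) \<gamma>)"
proof -
  note q = subspace_centraliser[of e]
  have 0: "\<gamma> 0 = 0" using dual_space_scale[OF \<gamma> M.subspace_0[OF q], of 0] by simp
  show ?thesis
    unfolding M.subspace_def stabiliser_def
    using M.subspace_0[OF q] M.subspace_add[OF q] M.subspace_scale[OF q]
    by (auto simp: MM.linear_0[OF linear_lie_bracket] MM.linear_add[OF linear_lie_bracket]
        MM.linear_scale[OF linear_lie_bracket] 0 lie_bracket_centraliser
        dual_space_add[OF \<gamma>] dual_space_scale[OF \<gamma>])
qed

text \<open>Vinberg's inequality for the matrix algebra. The minimum in \<open>lie_index\<close> is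
  attained because the stabiliser dimensions are bounded by that of the space of all
  matrices.\<close>

lemma lie_index_centraliser_ge:
  fixes e :: "'k::alg_closed_field^'n^'n"
  shows "CARD('n) \<le> lie_index (centraliser e)"
proof -
  let ?S = "(\<lambda>\<gamma>. mdim (stabiliser (centraliser e) \<gamma>)) ` dual_space (centraliser e)"
  have "?S \<subseteq> {..M.dim (UNIV :: ('k^'n^'n) set)}"
    unfolding mdim_def by (intro image_subsetI) (simp del: M.dim_UNIV add: M.dim_subset)
  then have "finite ?S" using finite_subset by blast
  moreover have "(\<lambda>_. 0) \<in> dual_space (centraliser e)" by (simp add: dual_space_def)
  then have "?S \<noteq> {}" by blast
  ultimately have "Min ?S \<in> ?S" by (rule Min_in)
  then show ?thesis unfolding lie_index_def using dim_stabiliser_ge by auto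
qed

section \<open>Minors of the bracket form and their reduction to the plane\<close>

context jordan_basis
begin

lemma dual_space_expand:
  assumes \<gamma>: "\<gamma> \<in> dual_space (centraliser e)" and x: "x \<in> centraliser e"
  shows "\<gamma> x = (\<Sum>p\<in>Idx. eta_coeff x p * \<gamma> (eta p))"
proof -
  have "\<gamma> x = \<gamma> (\<Sum>p\<in>Idx. mscale (eta_coeff x p) (eta p))" using centraliser_expand[OF x] by (rule arg_cong)
  also have "\<dots> = (\<Sum>p\<in>Idx. eta_coeff x p * \<gamma> (eta p))"
    using eta_centraliser by (rule dual_space_sum[OF \<gamma> subspace_centraliser])
  finally show ?thesis .
qed

text \<open>A stabiliser of dimension above \<open>CARD('n)\<close> contains a nonzero
  \<open>x\<close> whose \<open>CARD('n)\<close> coordinates outside \<open>us\<close> vanish. Its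
  other coordinates are the coefficients of a linear relation between the rows of the minor.\<close>

lemma minor_eq_0:
  assumes \<gamma>: "\<gamma> \<in> dual_space (centraliser e)"
    and big: "CARD('n) < mdim (stabiliser (centraliser e) \<gamma>)"
    and us: "distinct us" "set us \<subseteq> Idx" "card (Idx - set us) = CARD('n)"
    and ws: "\<And>t. t < length us \<Longrightarrow> ws t \<in> Idx"
  shows "leibniz_det (length us) (\<lambda>s t. \<gamma> (lie_bracket (eta (us ! s)) (eta (ws t)))) = 0"
proof -
  let ?q = "centraliser e" and ?J = "Idx - set us"
  define \<pi> where "\<pi> x = (\<Sum>p\<in>?J. mscale (eta_coeff x p) (eta p))" for x
  have lin: "Vector_Spaces.linear mscale mscale \<pi>"
    unfolding \<pi>_def[abs_def] Vector_Spaces.linear_iff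
    by (simp add: M.vector_space_axioms eta_coeff_add eta_coeff_scale M.scale_left_distrib sum.distrib M.scale_sum_right)
  have sub: "M.subspace (stabiliser ?q \<gamma>)" by (rule subspace_stabiliser[OF \<gamma>])
  have "\<not> inj_on \<pi> (stabiliser ?q \<gamma>)"
  proof
    assume "inj_on \<pi> (stabiliser ?q \<gamma>)"
    then have "inj_on \<pi> (M.span (stabiliser ?q \<gamma>))" using sub by (simp only: M.span_eq_iff[THEN iffD2])
    from MM.dim_image_eq[OF lin this] have "M.dim (stabiliser ?q \<gamma>) = M.dim (\<pi> ` stabiliser ?q \<gamma>)" by simp
    also have "\<dots> \<le> card (eta ` ?J)"
    proof (rule M.dim_le_card)
      show "\<pi> ` stabiliser ?q \<gamma> \<subseteq> M.span (eta ` ?J)"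
        unfolding \<pi>_def by (intro image_subsetI M.span_sum M.span_scale M.span_base) simp
    qed (use finite_Idx in simp)
    also have "\<dots> \<le> CARD('n)" using card_image_le[of ?J eta] finite_Idx us(3) by simp
    finally show False using big by (simp add: mdim_def)
  qed
  then obtain x where x: "x \<in> stabiliser ?q \<gamma>" "\<pi> x = 0" "x \<noteq> 0"
    unfolding MM.linear_inj_on_iff_eq_0[OF lin sub] by blast
  have xq: "x \<in> ?q" using x(1) by (simp add: stabiliser_def)
  have J_indep: "indep_family mscale ?J eta"
    by (rule M.indep_family_subset[OF finite_Idx indep_eta]) blast
  have J0: "eta_coeff x p = 0" if "p \<in> ?J" for p
    by (rule M.indep_familyD[OF J_indep x(2)[unfolded \<pi>_def] that])
  have "x = (\<Sum>p\<in>Idx. mscale (eta_coeff x p) (eta p))" by (rule centraliser_expand[OF xq])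
  also have "\<dots> = (\<Sum>p\<in>set us. mscale (eta_coeff x p) (eta p))"
    using us(2) finite_Idx J0 by (intro sum.mono_neutral_right) auto
  also have "\<dots> = (\<Sum>s<length us. mscale (eta_coeff x (us ! s)) (eta (us ! s)))"
    using sum.reindex_bij_betw[OF bij_betw_nth[OF us(1) refl refl], of "\<lambda>p. mscale (eta_coeff x p) (eta p)"]
    by simp
  finally have xs: "x = (\<Sum>s<length us. mscale (eta_coeff x (us ! s)) (eta (us ! s)))" .
  have in_q: "eta (us ! s) \<in> ?q" if "s < length us" for s
    using that us(2) nth_mem[OF that] by (intro eta_centraliser) blast
  have "\<exists>s<length us. eta_coeff x (us ! s) \<noteq> 0"
  proof (rule ccontr)
    assume "\<not> (\<exists>s<length us. eta_coeff x (us ! s) \<noteq> 0)"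
    then have "x = 0" by (subst xs) simp
    then show False using x(3) by simp
  qed
  then obtain s where s: "s < length us" "eta_coeff x (us ! s) \<noteq> 0" by blast
  show ?thesis
  proof (rule leibniz_det_eq_0[where c = "\<lambda>s. eta_coeff x (us ! s)", OF _ s])
    fix t assume t: "t < length us"
    have y: "eta (ws t) \<in> ?q" using ws[OF t] by (rule eta_centraliser)
    have "lie_bracket x (eta (ws t)) = (\<Sum>s<length us. mscale (eta_coeff x (us ! s)) (lie_bracket (eta (us ! s)) (eta (ws t))))"
      using lie_bracket_sum_left[of "\<lambda>s. eta_coeff x (us ! s)" "\<lambda>s. eta (us ! s)" "{..<length us}" "eta (ws t)"] xs by simp
    then have "\<gamma> (lie_bracket x (eta (ws t))) =
        (\<Sum>s<length us. eta_coeff x (us ! s) * \<gamma> (lie_bracket (eta (us ! s)) (eta (ws t))))"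
      by (simp only:) (rule dual_space_sum[OF \<gamma> subspace_centraliser lie_bracket_centraliser[OF in_q y]], simp)
    then show "(\<Sum>s<length us. eta_coeff x (us ! s) * \<gamma> (lie_bracket (eta (us ! s)) (eta (ws t)))) = 0"
      using x(1) y by (simp add: stabiliser_def)
  qed
qed

definition coord :: "nat \<times> nat \<times> nat \<Rightarrow> ('k^'n^'n \<Rightarrow> 'k) \<Rightarrow> 'k" where
  "coord p = (\<lambda>\<gamma>. \<gamma> (eta p))"

abbreviation Y1 :: "('k^'n^'n \<Rightarrow> 'k) \<Rightarrow> 'k" where "Y1 \<equiv> coord (1, 0, 0)"

abbreviation Y2 :: "('k^'n^'n \<Rightarrow> 'k) \<Rightarrow> 'k" where "Y2 \<equiv> coord (0, 1, 0)"

text \<open>The form \<open>coord p\<close> composed with the projection to the plane that keeps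
  \<open>Y1\<close> and \<open>Y2\<close>.\<close>

definition plane_part :: "nat \<times> nat \<times> nat \<Rightarrow> ('k^'n^'n \<Rightarrow> 'k) \<Rightarrow> 'k" where
  "plane_part p = (\<lambda>\<gamma>. plane_coord (Y1 \<gamma>) (Y2 \<gamma>) p)"

text \<open>Linear forms that cut out the plane. At the two omitted indices the difference is
  0.\<close>

definition plane_forms :: "(('k^'n^'n \<Rightarrow> 'k) \<Rightarrow> 'k) set" where
  "plane_forms = (\<lambda>p. coord p - plane_part p) ` (Idx - {(1, 0, 0), (0, 1, 0)})"

abbreviation gens :: "(('k^'n^'n \<Rightarrow> 'k) \<Rightarrow> 'k) set" where
  "gens \<equiv> insert Y1 (insert Y2 plane_forms)"

lemma coord_diff_span: "p \<in> Idx \<Longrightarrow> coord p - plane_part p \<in> F.span plane_forms"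
proof (cases "p = (1, 0, 0) \<or> p = (0, 1, 0)")
  case True
  then have "plane_part p = coord p" by (auto simp: plane_part_def plane_coord_def fun_eq_iff)
  then show ?thesis by (simp only: diff_self F.span_zero)
next
  case False
  assume "p \<in> Idx"
  then show ?thesis using False unfolding plane_forms_def by (intro F.span_base imageI) simp
qed

lemma plane_part_filt: "plane_part p \<in> F.filt Z gens 1"
proof -
  obtain i j a where p: "p = (i, j, a)" by (metis prod_cases3)
  have "plane_part p = fscale (if a = 0 \<and> i = Suc j then 1 else 0) Y1 + fscale (if a = 0 \<and> j = Suc i then 1 else 0) Y2"
    by (auto simp: plane_part_def p plane_coord_def fscale_def fun_eq_iff)
  moreover have "Y1 \<in> F.filt Z gens 1" "Y2 \<in> F.filt Z gens 1" by (rule F.gen_in_filt, blast)+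
  ultimately show ?thesis
    using F.subspace_add[OF F.subspace_filt] F.subspace_scale[OF F.subspace_filt] by metis
qed

lemma coord_filt: "p \<in> Idx \<Longrightarrow> coord p \<in> F.filt Z gens 1"
proof -
  assume p: "p \<in> Idx"
  have "F.span plane_forms \<subseteq> F.filt Z gens 1"
    by (rule F.span_minimal[OF _ F.subspace_filt]) (intro subsetI F.gen_in_filt, blast)
  then have "(coord p - plane_part p) + plane_part p \<in> F.filt Z gens 1"
    using coord_diff_span[OF p] plane_part_filt by (intro F.subspace_add[OF F.subspace_filt]) blast
  then show ?thesis by (simp only: diff_add_cancel)
qed

text \<open>With two strings both omitted indices belong to \<open>Idx\<close>, so two forms are
  saved. The bound \<open>2 \<le> card Idx\<close> guards the truncated subtraction.\<close>

lemma card_plane_forms: "2 \<le> k \<Longrightarrow> finite plane_forms \<and> card plane_forms \<le> card Idx - 2 \<and> 2 \<le> card Idx"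
proof -
  assume "2 \<le> k"
  then have sub: "{(1, 0, 0), (0, 1, 0)} \<subseteq> Idx" by (auto simp: Idx_def)
  have two: "card {(1 :: nat, 0 :: nat, 0 :: nat), (0, 1, 0)} = 2" by simp
  have "card plane_forms \<le> card (Idx - {(1, 0, 0), (0, 1, 0)})"
    unfolding plane_forms_def using finite_Idx by (intro card_image_le) simp
  also have "\<dots> = card Idx - 2" using card_Diff_subset[OF _ sub] two by simp
  finally show ?thesis using card_mono[OF finite_Idx sub] two finite_Idx by (simp add: plane_forms_def)
qed

text \<open>Written in the forms \<open>coord p\<close>, the minor vanishes on \<open>Z\<close>;
  with each form replaced by its plane part it is triangular and equals a nonzero multiple of a
  power of \<open>sel\<close>. The two differ by an element of \<open>filt_ideal\<close>. The
  parameter \<open>sel\<close> stands for \<open>y1\<close> or \<open>y2\<close>, so that both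
  powers are covered.\<close>

lemma minor_reduction:
  assumes Z: "\<And>\<gamma>. \<gamma> \<in> Z \<Longrightarrow> \<gamma> \<in> dual_space (centraliser e) \<and> CARD('n) < mdim (stabiliser (centraliser e) \<gamma>)"
    and us: "distinct us" "set us \<subseteq> Idx" "card (Idx - set us) = CARD('n)"
    and ws: "\<And>t. t < length us \<Longrightarrow> ws t \<in> Idx"
    and tri: "\<And>y1 y2 s t. t < s \<Longrightarrow> s < length us \<Longrightarrow> plane_pairing y1 y2 (us ! s) (ws t) = 0"
    and diag: "\<And>y1 y2 s. s < length us \<Longrightarrow> plane_pairing y1 y2 (us ! s) (ws s) = \<epsilon> s * sel y1 y2"
    and \<epsilon>: "\<And>s. s < length us \<Longrightarrow> \<epsilon> s \<noteq> 0"
  shows "(\<lambda>\<gamma>. sel (Y1 \<gamma>) (Y2 \<gamma>)) ^ length us \<in> F.filt_ideal Z plane_forms gens (length us)"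
proof -
  let ?r = "length us" and ?P = "{p. p permutes {0..<length us}}"
  define b where "b s t = lie_bracket (eta (us ! s)) (eta (ws t))" for s t
  \<comment> \<open>As a function \<open>l s t\<close> is a combination of coordinates everywhere;
    it agrees with evaluation at \<open>b s t\<close> on members of the dual space, hence on
    \<open>Z\<close>.\<close>
  define l where "l s t = (\<Sum>p\<in>Idx. fscale (eta_coeff (b s t) p) (coord p))" for s t
  define m where "m s t = (\<Sum>p\<in>Idx. fscale (eta_coeff (b s t) p) (plane_part p))" for s t
  define SEL where "SEL = (\<lambda>\<gamma>. sel (Y1 \<gamma>) (Y2 \<gamma>))"
  have us_Idx: "us ! s \<in> Idx" if "s < ?r" for s using us(2) nth_mem[OF that] by blast
  have b_q: "b s t \<in> centraliser e" if "s < ?r" "t < ?r" for s t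
    unfolding b_def by (intro lie_bracket_centraliser eta_centraliser us_Idx ws that)
  have l_filt: "l s t \<in> F.filt Z gens 1" for s t
    unfolding l_def by (intro F.subspace_sum[OF F.subspace_filt] F.subspace_scale[OF F.subspace_filt] coord_filt)
  have m_filt: "m s t \<in> F.filt Z gens 1" for s t
    unfolding m_def by (intro F.subspace_sum[OF F.subspace_filt] F.subspace_scale[OF F.subspace_filt] plane_part_filt)
  have lm: "l s t - m s t \<in> F.span plane_forms" for s t
  proof -
    have "l s t - m s t = (\<Sum>p\<in>Idx. fscale (eta_coeff (b s t) p) (coord p - plane_part p))"
      unfolding l_def m_def sum_subtractf[symmetric] F.scale_right_diff_distrib ..
    also have "\<dots> \<in> F.span plane_forms" by (intro F.span_sum F.span_scale coord_diff_span)
    finally show ?thesis .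
  qed
  have l_eval: "l s t \<gamma> = \<gamma> (b s t)" if "\<gamma> \<in> Z" "s < ?r" "t < ?r" for s t \<gamma>
    using dual_space_expand[OF conjunct1[OF Z[OF that(1)]] b_q[OF that(2,3)]]
    by (simp add: l_def fun_sum_apply fscale_def coord_def)
  have m_eval: "m s t \<gamma> = plane_pairing (Y1 \<gamma>) (Y2 \<gamma>) (us ! s) (ws t)" if "s < ?r" "t < ?r" for s t \<gamma>
    using plane_functional_bracket[OF us_Idx[OF that(1)] ws[OF that(2)], of "Y1 \<gamma>" "Y2 \<gamma>"]
    by (simp add: m_def fun_sum_apply fscale_def plane_part_def plane_functional_def b_def)
  define L where "L = (\<Sum>p\<in>?P. fscale (signof p) (\<Prod>i<?r. l i (p i)))"
  define N where "N = (\<Sum>p\<in>?P. fscale (signof p) (\<Prod>i<?r. m i (p i)))"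
  have perm: "p i < ?r" if "p \<in> ?P" "i < ?r" for p i
    using permutes_in_image[of p "{0..<?r}" i] that by simp
  have "L - N = (\<Sum>p\<in>?P. fscale (signof p) ((\<Prod>i<?r. l i (p i)) - (\<Prod>i<?r. m i (p i))))"
    unfolding L_def N_def sum_subtractf[symmetric] F.scale_right_diff_distrib ..
  also have "\<dots> \<in> F.filt_ideal Z plane_forms gens ?r"
    by (intro F.subspace_sum[OF F.subspace_filt_ideal] F.subspace_scale[OF F.subspace_filt_ideal]
        F.prod_diff_filt_ideal lm l_filt m_filt)
  finally have LN: "L - N \<in> F.filt_ideal Z plane_forms gens ?r" .
  have "L \<gamma> = 0" if \<gamma>: "\<gamma> \<in> Z" for \<gamma>
  proof -
    have "L \<gamma> = leibniz_det ?r (\<lambda>s t. \<gamma> (b s t))"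
      unfolding L_def leibniz_det_def fun_sum_apply fscale_def fun_prod_apply
      using perm by (intro sum.cong prod.cong arg_cong2[of _ _ _ _ "(*)"] refl l_eval[OF \<gamma>]) auto
    also have "\<dots> = 0" unfolding b_def using Z[OF \<gamma>] us ws by (intro minor_eq_0) auto
    finally show ?thesis .
  qed
  then have "L \<in> F.filt_ideal Z plane_forms gens ?r" by (intro F.ideal_in_filt_ideal) (simp add: vanishing_def)
  then have "L - (L - N) \<in> F.filt_ideal Z plane_forms gens ?r"
    using LN by (rule F.subspace_diff[OF F.subspace_filt_ideal])
  then have N: "N \<in> F.filt_ideal Z plane_forms gens ?r" by (simp only: diff_diff_eq2 add_diff_cancel_left')
  define E where "E = (\<Prod>s<?r. \<epsilon> s)"
  have "E \<noteq> 0" using \<epsilon> by (simp add: E_def)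
  have "N = fscale E (SEL ^ ?r)"
  proof
    fix \<gamma>
    have "N \<gamma> = leibniz_det ?r (\<lambda>s t. plane_pairing (Y1 \<gamma>) (Y2 \<gamma>) (us ! s) (ws t))"
      unfolding N_def leibniz_det_def fun_sum_apply fscale_def fun_prod_apply
      using perm by (intro sum.cong prod.cong arg_cong2[of _ _ _ _ "(*)"] refl m_eval) auto
    also have "\<dots> = (\<Prod>s<?r. plane_pairing (Y1 \<gamma>) (Y2 \<gamma>) (us ! s) (ws s))"
      using tri by (rule leibniz_det_triangular)
    also have "\<dots> = (\<Prod>s<?r. \<epsilon> s * SEL \<gamma>)" using diag by (intro prod.cong) (auto simp: SEL_def)
    also have "\<dots> = fscale E (SEL ^ ?r) \<gamma>"
      by (simp add: prod.distrib E_def fscale_def fun_power_apply)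
    finally show "N \<gamma> = fscale E (SEL ^ ?r) \<gamma>" .
  qed
  then have "SEL ^ ?r = fscale (inverse E) N" using \<open>E \<noteq> 0\<close> by (simp add: fscale_def fun_eq_iff)
  then show ?thesis unfolding SEL_def[symmetric] using F.subspace_scale[OF F.subspace_filt_ideal N] by simp
qed

text \<open>The order \<open>rho\<close> makes the pairing of \<open>u\<close> with \<open>partner u'\<close> triangular on the plane: below the
  diagonal \<open>j\<close> increases, and above it \<open>i\<close> decreases.\<close>

definition partner :: "nat \<times> nat \<times> nat \<Rightarrow> nat \<times> nat \<times> nat" where
  "partner p = (case p of (i, j, a) \<Rightarrow> if i < j then (j, Suc i, d j - a) else (j - 1, i, d i - a))"

definition rho :: "nat \<times> nat \<times> nat \<Rightarrow> nat" where
  "rho p = (case p of (i, j, a) \<Rightarrow> if i < j then 2 * k - i else j)"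

definition Idx_pos :: "(nat \<times> nat \<times> nat) set" where
  "Idx_pos = {p \<in> Idx. fst (snd p) \<noteq> 0}"

text \<open>The order of the strings by length is used here: \<open>d j \<le> d (Suc i)\<close> if
  \<open>i < j\<close>, and \<open>d i \<le> d (j - 1)\<close> otherwise.\<close>

lemma partner_Idx: "u \<in> Idx_pos \<Longrightarrow> partner u \<in> Idx"
proof -
  assume u: "u \<in> Idx_pos"
  obtain i j a where p: "u = (i, j, a)" by (metis prod_cases3)
  have ij: "i < k" "j < k" "a \<le> d i" "a \<le> d j" "j \<noteq> 0" using u by (auto simp: p Idx_pos_def Idx_def)
  show ?thesis
  proof (cases "i < j")
    case True
    then show ?thesis using ij d_antimono[of "Suc i" j] by (auto simp: p partner_def Idx_def)
  next
    case False
    then show ?thesis using ij d_antimono[of "j - 1" i]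
      by (auto simp: p partner_def Idx_def intro: le_trans[OF diff_le_self])
  qed
qed

text \<open>For \<open>i < j\<close> the second term of the pairing survives and reads the entry at
  \<open>(i, i + 1)\<close>, with a minus sign; otherwise the first survives and reads the entry at
  \<open>(j - 1, j)\<close>. Both entries are \<open>y2\<close>; \<open>j \<noteq> 0\<close> makes
  \<open>j - 1\<close> a true predecessor.\<close>

lemma plane_pairing_partner_diag:
  "u \<in> Idx_pos \<Longrightarrow> plane_pairing y1 y2 u (partner u) = (if fst u < fst (snd u) then - 1 else 1) * y2"
  by (cases u) (auto simp: Idx_pos_def Idx_def partner_def plane_pairing_def plane_coord_def)

text \<open>Every term that survives the index conditions either forces \<open>u = v\<close> or
  occurs only for \<open>rho u < rho v\<close>. This also disposes of the unwanted entries
  \<open>y1\<close>.\<close>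

lemma plane_pairing_partner_eq_0:
  assumes u: "u \<in> Idx_pos" and v: "v \<in> Idx_pos" and "u \<noteq> v" "rho v \<le> rho u"
  shows "plane_pairing y1 y2 u (partner v) = 0"
proof -
  obtain i j a where p: "u = (i, j, a)" by (metis prod_cases3)
  obtain i' j' a' where p': "v = (i', j', a')" by (metis prod_cases3)
  have *: "i < k" "j < k" "a \<le> d i" "a \<le> d j" "j \<noteq> 0" "i' < k" "j' < k" "a' \<le> d i'" "a' \<le> d j'" "j' \<noteq> 0"
    using u v by (auto simp: p p' Idx_pos_def Idx_def)
  show ?thesis
  proof (cases "i' < j'")
    case True
    \<comment> \<open>\<open>2 * k - i'\<close> exceeds \<open>k\<close> and so every value of
      \<open>rho\<close> on the indices with \<open>i \<ge> j\<close>; hence \<open>u\<close> also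
      has \<open>i < j\<close>.\<close>
    then have R: "i < j" "i \<le> i'" using * assms(4) by (auto simp: p p' rho_def split: if_splits)
    have "a = a'" if "j = j'" "a + (d j' - a') = d j" using that * by simp
    then have "plane_coord y1 y2 (i, Suc i', 0) = 0" if "j = j'" "a + (d j' - a') = d j"
      using that R assms(3) by (auto simp: plane_coord_def p p')
    then show ?thesis using True R by (simp add: p p' partner_def plane_pairing_def)
  next
    case False
    have g1: "plane_coord y1 y2 (j' - 1, j, 0) = 0" if "i' = i" "a + (d i' - a') = d i"
    proof -
      have "a = a'" using that * by simp
      then have "j \<noteq> j'" using that assms(3) by (auto simp: p p')
      moreover have "j' \<noteq> Suc (Suc j)" using that(1) False assms(4) by (auto simp: p p' rho_def split: if_splits)
      ultimately show ?thesis using * by (simp add: plane_coord_def)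
    qed
    have g2: "plane_coord y1 y2 (i, i', 0) = 0" if "j = j' - 1"
    proof -
      have "Suc i \<noteq> i' \<and> i \<noteq> Suc i'" using that False assms(4) * by (auto simp: p p' rho_def split: if_splits)
      then show ?thesis by (auto simp: plane_coord_def)
    qed
    have "plane_pairing y1 y2 u (partner v) =
        (if i' = i \<and> a + (d i' - a') = d i then plane_coord y1 y2 (j' - 1, j, 0) else 0)
        - (if j = j' - 1 \<and> a + (d i' - a') = d j then plane_coord y1 y2 (i, i', 0) else 0)"
      using False by (simp only: p p' partner_def plane_pairing_def prod.case if_False)
    also have "\<dots> = 0 - 0"
    proof (rule arg_cong2[of _ _ _ _ "(-)"])
      show "(if i' = i \<and> a + (d i' - a') = d i then plane_coord y1 y2 (j' - 1, j, 0) else 0) = 0"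
        by (split if_split) (use g1 in blast)
      show "(if j = j' - 1 \<and> a + (d i' - a') = d j then plane_coord y1 y2 (i, i', 0) else 0) = 0"
        by (split if_split) (use g2 in blast)
    qed
    finally show ?thesis by simp
  qed
qed

text \<open>These are the maps into string 0. It is the longest, so for each \<open>i\<close> all
  \<open>a \<le> d i\<close> occur, and the count is the total length of the strings.\<close>

lemma card_Idx_diff_pos: "card (Idx - Idx_pos) = CARD('n)"
proof -
  have "Idx - Idx_pos = (\<lambda>(i, a). (i, 0, a)) ` (SIGMA i:{..<k}. {..d i})"
  proof (intro equalityI subsetI)
    fix p assume "p \<in> (\<lambda>(i, a). (i, 0 :: nat, a)) ` (SIGMA i:{..<k}. {..d i})"
    then show "p \<in> Idx - Idx_pos" using d_antimono[of 0] by (fastforce simp: Idx_def Idx_pos_def)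
  qed (auto simp: Idx_def Idx_pos_def)
  moreover have "inj_on (\<lambda>(i, a). (i, 0 :: nat, a)) (SIGMA i:{..<k}. {..d i})" by (auto simp: inj_on_def)
  ultimately show ?thesis using sum_d by (simp add: card_image)
qed

text \<open>Exchanging source and target string exchanges \<open>y1\<close> and \<open>y2\<close> in
  the pairing up to sign, so the minor for \<open>y1\<close> is the mirror image of the one for
  \<open>y2\<close>.\<close>

definition transpose_idx :: "nat \<times> nat \<times> nat \<Rightarrow> nat \<times> nat \<times> nat" where
  "transpose_idx p = (case p of (i, j, a) \<Rightarrow> (j, i, a))"

lemma transpose_idx_idem: "transpose_idx (transpose_idx p) = p"
  by (cases p) (simp add: transpose_idx_def)

lemma transpose_idx_in_Idx: "transpose_idx p \<in> Idx \<longleftrightarrow> p \<in> Idx"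
  by (cases p) (auto simp: transpose_idx_def Idx_def)

lemma plane_pairing_transpose: "plane_pairing y1 y2 (transpose_idx u) (transpose_idx v) = - plane_pairing y2 y1 u v"
proof -
  obtain i j a l m b where uv: "u = (i, j, a)" "v = (l, m, b)" by (metis prod_cases3)
  have plane_coord_sym: "plane_coord y1 y2 (i', j', 0) = plane_coord y2 y1 (j', i', 0)" for i' j'
    by (simp add: plane_coord_def add.commute)
  have comm: "(l = j) = (j = l)" "(i = m) = (m = i)" by blast+
  show ?thesis
    by (simp only: uv transpose_idx_def plane_pairing_def prod.case plane_coord_sym[of m i] plane_coord_sym[of j l] comm minus_diff_eq)
qed

lemma powers_in_filt_ideal:
  assumes Z: "\<And>\<gamma>. \<gamma> \<in> Z \<Longrightarrow> \<gamma> \<in> dual_space (centraliser e) \<and> CARD('n) < mdim (stabiliser (centraliser e) \<gamma>)"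
  shows "Y1 ^ card Idx_pos \<in> F.filt_ideal Z plane_forms gens (card Idx_pos)" "Y2 ^ card Idx_pos \<in> F.filt_ideal Z plane_forms gens (card Idx_pos)"
proof -
  have "finite Idx_pos" using finite_Idx by (simp add: Idx_pos_def)
  then obtain us0 where us0: "set us0 = Idx_pos" "distinct us0" using finite_distinct_list by blast
  define us where "us = sort_key rho us0"
  have us: "set us = Idx_pos" "distinct us" using us0 by (simp_all add: us_def)
  have len: "length us = card Idx_pos" using us distinct_card[of us] by simp
  have us_pos: "us ! s \<in> Idx_pos" if "s < length us" for s using us nth_mem[OF that] by simp
  have tri: "plane_pairing y1 y2 (us ! s) (partner (us ! t)) = 0" if "t < s" "s < length us" for y1 y2 s t
  proof (rule plane_pairing_partner_eq_0)
    have "sorted (map rho us)" by (simp add: us_def)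
    then have "map rho us ! t \<le> map rho us ! s" using that by (intro sorted_nth_mono) auto
    then show "rho (us ! t) \<le> rho (us ! s)" using that by simp
    show "us ! s \<noteq> us ! t" using that nth_eq_iff_index_eq[OF us(2), of s t] by simp
  qed (use us_pos that in auto)
  let ?\<epsilon> = "\<lambda>u :: nat \<times> nat \<times> nat. (if fst u < fst (snd u) then - 1 else 1) :: 'k"
  have "(\<lambda>\<gamma>. (\<lambda>y1 y2. y2) (Y1 \<gamma>) (Y2 \<gamma>)) ^ length us \<in> F.filt_ideal Z plane_forms gens (length us)"
  proof (rule minor_reduction[where ws = "\<lambda>t. partner (us ! t)" and \<epsilon> = "\<lambda>s. ?\<epsilon> (us ! s)", OF Z])
    show "card (Idx - set us) = CARD('n)" using card_Idx_diff_pos us by simp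
    show "set us \<subseteq> Idx" using us by (auto simp: Idx_pos_def)
    show "plane_pairing y1 y2 (us ! s) (partner (us ! s)) = ?\<epsilon> (us ! s) * y2" if "s < length us" for y1 y2 s
      by (rule plane_pairing_partner_diag[OF us_pos[OF that]])
  qed (use us us_pos partner_Idx tri in auto)
  then show "Y2 ^ card Idx_pos \<in> F.filt_ideal Z plane_forms gens (card Idx_pos)" by (simp add: len)
  let ?us = "map transpose_idx us"
  have "inj transpose_idx" using transpose_idx_idem by (metis injI)
  have "(\<lambda>\<gamma>. (\<lambda>y1 y2. y1) (Y1 \<gamma>) (Y2 \<gamma>)) ^ length ?us \<in> F.filt_ideal Z plane_forms gens (length ?us)"
  proof (rule minor_reduction[where ws = "\<lambda>t. transpose_idx (partner (us ! t))" and \<epsilon> = "\<lambda>s. - ?\<epsilon> (us ! s)", OF Z])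
    show "distinct ?us" using us \<open>inj transpose_idx\<close> by (auto simp: distinct_map intro: inj_on_subset)
    have "transpose_idx ` Idx = Idx"
    proof (intro equalityI subsetI)
      fix p assume "p \<in> Idx"
      then show "p \<in> transpose_idx ` Idx" using transpose_idx_in_Idx[of p] transpose_idx_idem[of p] by (intro image_eqI[of _ _ "transpose_idx p"]) simp_all
    qed (use transpose_idx_in_Idx in auto)
    then have "Idx - set ?us = transpose_idx ` (Idx - Idx_pos)" using us image_set_diff[OF \<open>inj transpose_idx\<close>, of Idx Idx_pos] by simp
    then show "card (Idx - set ?us) = CARD('n)"
      using card_Idx_diff_pos card_image[OF inj_on_subset[OF \<open>inj transpose_idx\<close>], of "Idx - Idx_pos"] by simp
    show "set ?us \<subseteq> Idx" using us transpose_idx_in_Idx by (auto simp: Idx_pos_def)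
    show "plane_pairing y1 y2 (?us ! s) (transpose_idx (partner (us ! t))) = 0" if "t < s" "s < length ?us" for y1 y2 s t
      using that tri by (simp add: plane_pairing_transpose)
    show "plane_pairing y1 y2 (?us ! s) (transpose_idx (partner (us ! s))) = - ?\<epsilon> (us ! s) * y1" if "s < length ?us" for y1 y2 s
      using that plane_pairing_partner_diag[OF us_pos, of s y2 y1] by (simp add: plane_pairing_transpose)
    show "transpose_idx (partner (us ! t)) \<in> Idx" if "t < length ?us" for t
      using that partner_Idx[OF us_pos] transpose_idx_in_Idx by simp
  qed auto
  then show "Y1 ^ card Idx_pos \<in> F.filt_ideal Z plane_forms gens (card Idx_pos)" by (simp add: len)
qed

text \<open>Polynomial functions take arbitrary maps as arguments, while the expansion of evaluation
  at \<open>x\<close> in basis coordinates holds on the dual space; the discrepancy is absorbed by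
  \<open>vanishing Z\<close>.\<close>

lemma poly_fun_filt:
  assumes f: "f \<in> poly_fun (centraliser e)" and Z: "Z \<subseteq> dual_space (centraliser e)"
  shows "\<exists>n. f \<in> F.filt Z gens n"
  using f
proof induction
  case (const c)
  have "(\<lambda>\<gamma>. c) = fscale c 1" by (simp add: fscale_def fun_eq_iff)
  moreover have "fscale c 1 \<in> F.filt Z gens 0"
    by (rule F.subspace_scale[OF F.subspace_filt F.one_in_filt])
  ultimately show ?case by metis
next
  case (coord x)
  let ?g = "\<Sum>p\<in>Idx. fscale (eta_coeff x p) (coord p)"
  have g: "?g \<in> F.filt Z gens 1"
    by (intro F.subspace_sum[OF F.subspace_filt] F.subspace_scale[OF F.subspace_filt] coord_filt)
  have "(\<lambda>\<gamma>. \<gamma> x) - ?g \<in> vanishing Z"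
    using dual_space_expand[OF _ coord] Z by (auto simp: vanishing_def fun_sum_apply fscale_def coord_def)
  then have "((\<lambda>\<gamma>. \<gamma> x) - ?g) + ?g \<in> F.filt Z gens 1"
    by (intro F.subspace_add[OF F.subspace_filt F.ideal_in_filt g])
  then show ?case unfolding diff_add_cancel by blast
next
  case (add f g)
  then obtain n n' where "f \<in> F.filt Z gens n" "g \<in> F.filt Z gens n'" by blast
  then have "f \<in> F.filt Z gens (n + n')" "g \<in> F.filt Z gens (n + n')"
    using F.filt_mono[of n "n + n'" Z gens] F.filt_mono[of n' "n + n'" Z gens] by auto
  then have "f + g \<in> F.filt Z gens (n + n')" by (rule F.subspace_add[OF F.subspace_filt])
  then show ?case unfolding plus_fun_def by blast
next
  case (mult f g)
  then obtain n n' where "f \<in> F.filt Z gens n" "g \<in> F.filt Z gens n'" by blast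
  then have "f * g \<in> F.filt Z gens (n + n')" by (rule F.filt_mult)
  then show ?case unfolding times_fun_def by blast
qed

end

section \<open>Irreducible Zariski closed sets and the codimension\<close>

lemma function_algebra_poly_fun: "function_algebra (poly_fun q)"
  by (auto simp: function_algebra_def intro: poly_fun.intros)

lemma zariski_closed_Int_zeros:
  assumes "zariski_closed q Z" "f \<in> poly_fun q"
  shows "zariski_closed q {\<gamma> \<in> Z. f \<gamma> = 0}"
proof -
  obtain S where S: "S \<subseteq> poly_fun q" "Z = {\<gamma> \<in> dual_space q. \<forall>f\<in>S. f \<gamma> = 0}"
    using assms(1) by (auto simp: zariski_closed_def)
  then show ?thesis unfolding zariski_closed_def
    by (intro exI[of _ "insert f S"]) (use assms(2) in auto)
qed

text \<open>If a product vanishes on \<open>Z\<close>, the zero sets of its factors are closed and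
  cover \<open>Z\<close>, so one of them is all of \<open>Z\<close>.\<close>

lemma zariski_irreducible_integral_on:
  assumes "zariski_irreducible q Z"
  shows "integral_on (poly_fun q) Z"
  unfolding integral_on_def
proof (intro conjI ballI impI)
  show "Z \<noteq> {}" using assms by (simp add: zariski_irreducible_def)
  fix f g assume f: "f \<in> poly_fun q" and g: "g \<in> poly_fun q" and fg: "(\<lambda>z. f z * g z) \<in> vanishing Z"
  let ?A = "{\<gamma> \<in> Z. f \<gamma> = 0}" and ?B = "{\<gamma> \<in> Z. g \<gamma> = 0}"
  have "zariski_closed q ?A" "zariski_closed q ?B"
    using assms zariski_closed_Int_zeros f g by (auto simp: zariski_irreducible_def)
  moreover have "Z = ?A \<union> ?B" using fg by (auto simp: vanishing_def)
  ultimately have "Z = ?A \<or> Z = ?B" using assms unfolding zariski_irreducible_def by blast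
  then show "f \<in> vanishing Z \<or> g \<in> vanishing Z" unfolding vanishing_def by blast
qed

lemma zariski_closed_psubset_separated:
  assumes "zariski_closed q Z" "Z \<subset> Z'" "Z' \<subseteq> dual_space q"
  shows "\<exists>f\<in>poly_fun q. f \<in> vanishing Z \<and> f \<notin> vanishing Z'"
proof -
  obtain S where S: "S \<subseteq> poly_fun q" "Z = {\<gamma> \<in> dual_space q. \<forall>f\<in>S. f \<gamma> = 0}"
    using assms(1) by (auto simp: zariski_closed_def)
  obtain \<gamma> where \<gamma>: "\<gamma> \<in> Z'" "\<gamma> \<notin> Z" using assms(2) by blast
  then obtain f where "f \<in> S" "f \<gamma> \<noteq> 0" using S(2) assms(3) by blast
  then show ?thesis using S \<gamma>(1) by (intro bexI[of _ f]) (auto simp: vanishing_def)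
qed

lemma (in jordan_basis) chain_length_le_card_Idx:
  assumes Zs: "\<And>i. i \<le> c \<Longrightarrow> zariski_irreducible (centraliser e) (Zs i)"
    "\<And>i. i < c \<Longrightarrow> Zs i \<subset> Zs (Suc i)"
    and top: "\<And>\<gamma>. \<gamma> \<in> Zs c \<Longrightarrow> \<gamma> \<in> dual_space (centraliser e) \<and> CARD('n) < mdim (stabiliser (centraliser e) \<gamma>)"
    and k: "2 \<le> k"
  shows "c \<le> card Idx - 2"
proof -
  have dual: "Zs i \<subseteq> dual_space (centraliser e)" if "i \<le> c" for i
    using Zs(1)[OF that] by (auto simp: zariski_irreducible_def zariski_closed_def)
  have "c \<le> card plane_forms"
  proof (rule chain_length_le[OF function_algebra_poly_fun])
    show "integral_on (poly_fun (centraliser e)) (Zs i)" if "i \<le> c" for i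
      by (rule zariski_irreducible_integral_on[OF Zs(1)[OF that]])
    show "Zs i \<subseteq> Zs (Suc i)" if "i < c" for i using Zs(2)[OF that] by blast
    show "\<exists>f\<in>poly_fun (centraliser e). f \<in> vanishing (Zs i) \<and> f \<notin> vanishing (Zs (Suc i))" if "i < c" for i
      using Zs(1)[of i] Zs(2)[OF that] dual[of "Suc i"] that
      by (intro zariski_closed_psubset_separated) (auto simp: zariski_irreducible_def)
    show "finite plane_forms" using card_plane_forms[OF k] by simp
    show "Y1 ^ card Idx_pos \<in> F.filt_ideal (Zs c) plane_forms gens (card Idx_pos)" "Y2 ^ card Idx_pos \<in> F.filt_ideal (Zs c) plane_forms gens (card Idx_pos)"
      by (rule powers_in_filt_ideal[OF top], assumption)+
    show "\<exists>n. f \<in> F.filt (Zs c) gens n" if "f \<in> poly_fun (centraliser e)" for f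
      using poly_fun_filt[OF that dual[OF order_refl]] .
  qed
  then show ?thesis using card_plane_forms[OF k] by simp
qed

theorem theorem3p4:
  fixes e :: "'k::alg_closed_field ^'n^'n"
  assumes "CARD('n) \<ge> 2"
    and "nilpotent_mat e"
  shows "codim_in_dual (centraliser e) (sing_set (centraliser e)) \<ge> 2"
proof (cases "sing_set (centraliser e) = {}")
  case True
  then show ?thesis by (simp add: codim_in_dual_def)
next
  case False
  obtain k d w crd where "jordan_basis e k d w crd"
    by (rule nilpotent_jordan_basis[OF assms(2)]) (rule that, rule jordan_basis.intro)
  then interpret jordan_basis e k d w crd .
  have sing: "\<gamma> \<in> dual_space (centraliser e) \<and> CARD('n) < mdim (stabiliser (centraliser e) \<gamma>)"
    if "\<gamma> \<in> sing_set (centraliser e)" for \<gamma>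
    using that lie_index_centraliser_ge[of e] by (auto simp: sing_set_def)
  \<comment> \<open>A singular functional forces \<open>n < N\<close>, hence an index whose target
    string is not string 0. So there are at least two strings, and both plane coordinates
    exist.\<close>
  obtain \<gamma> where "\<gamma> \<in> sing_set (centraliser e)" using False by blast
  then have "CARD('n) < mdim (stabiliser (centraliser e) \<gamma>)" using sing by blast
  also have "\<dots> \<le> mdim (centraliser e)"
    unfolding mdim_def by (intro M.dim_subset) (auto simp: stabiliser_def)
  finally have "CARD('n) < card Idx" by (simp add: dim_centraliser)
  then have "Idx - Idx_pos \<noteq> Idx" using card_Idx_diff_pos by auto
  then obtain p where "p \<in> Idx_pos" by blast
  then have k: "2 \<le> k" by (cases p) (auto simp: Idx_pos_def Idx_def)
  have "krull_dim (centraliser e) (sing_set (centraliser e)) \<le> enat (card Idx - 2)"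
    unfolding krull_dim_def
  proof (rule Sup_least, elim CollectE exE conjE)
    fix x c Zs
    assume x: "x = enat c" and Zs: "\<forall>i\<le>c. zariski_irreducible (centraliser e) (Zs i)"
      "\<forall>i<c. Zs i \<subset> Zs (Suc i)" "Zs c \<subseteq> sing_set (centraliser e)"
    have "c \<le> card Idx - 2"
      using Zs sing k by (intro chain_length_le_card_Idx[of c Zs]) blast+
    then show "x \<le> enat (card Idx - 2)" by (simp add: x)
  qed
  \<comment> \<open>The Krull dimension is finite, so the subtraction in
    \<open>codim_in_dual\<close> is one of natural numbers.\<close>
  then obtain m where m: "krull_dim (centraliser e) (sing_set (centraliser e)) = enat m" "m \<le> card Idx - 2"
    by (cases "krull_dim (centraliser e) (sing_set (centraliser e))") auto
  have "2 \<le> card Idx - m" using m(2) card_plane_forms[OF k] by linarith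
  then show ?thesis
    using False by (simp add: codim_in_dual_def dim_centraliser m(1) numeral_eq_enat)
qed

end
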